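(* Let $f=(f_1,f_2)$ be a pair of polynomials in $\mathbb{C}[x,y]$ such that the affine curves $(f_1)=\{f_1=0\}$ and $(f_2)=\{f_2=0\}$ intersect only at discrete points of $\mathbb{C}^2$. Suppose that: (RC1) for some positive integer $n$, $f_1$ and $f_2$ both have total degree $n$ and the leading (degree $n$) homogeneous part of each is $x^n$; (RC2) all intersection points of $(f_1)$ and $(f_2)$ in $\mathbb{C}^2$ lie on the line $\{y=0\}$. Then: (1) There is a unique pair of polynomials $g=(g_1,g_2)$ in $\mathbb{C}[x,y]$ with $\deg g_i\le n-1$ $(i=1,2)$ such that $$y\,\mathcal{J}(f)=f_1g_1+f_2g_2 .$$ (2) The total intersection number (counting multiplicity) of the affine curves $(f_1)$ and $(f_2)$ in $\mathbb{C}^2$ equals the coefficient of $x^{n-1}$ in $g_2$.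
   Context: $\mathcal{J}(f)=\frac{\partial(f_1,f_2)}{\partial(x,y)}=\frac{\partial f_1}{\partial x}\frac{\partial f_2}{\partial y}-\frac{\partial f_1}{\partial y}\frac{\partial f_2}{\partial x}$ denotes the Jacobian determinant. $\deg$ denotes total degree in $(x,y)$. The intersection multiplicity of $(f_1)$ and $(f_2)$ at a common zero $p\in\mathbb{C}^2$ is $\dim_{\mathbb{C}}\mathcal{O}_p/(f_1,f_2)\mathcal{O}_p$, where $\mathcal{O}_p$ is the ring of germs of holomorphic functions at $p$ (equivalently, the local degree of the map $f$ at $p$); the total intersection number is the sum of these multiplicities over all common zeros in $\mathbb{C}^2$. *)

theory Defs
  imports
    "HOL-Analysis.Analysis"
    "HOL-Computational_Algebra.Polynomial"
    "HOL-Library.Extended_Nat"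
    "HOL-Algebra.QuotRing"
    "HOL-Algebra.Embedded_Algebras"
begin

section \<open>Polynomials in two variables\<close>

text \<open>
  The ring \<open>\<complex>[x,y]\<close> is represented by \<^typ>\<open>complex poly poly\<close>, read as \<open>\<complex>[y][x]\<close>: the outer
  variable is \<open>x\<close>, the coefficients are polynomials in \<open>y\<close>.
\<close>

definition coeff2 :: "complex poly poly \<Rightarrow> nat \<Rightarrow> nat \<Rightarrow> complex"  \<comment> \<open>coefficient of \<open>x^i y^j\<close>\<close>
  where "coeff2 p i j = Polynomial.coeff (Polynomial.coeff p i) j"

definition varX :: "complex poly poly"
  where "varX = [:0, 1:]"

definition varY :: "complex poly poly"
  where "varY = [:[:0, 1:]:]"

definition poly2 :: "complex poly poly \<Rightarrow> complex \<times> complex \<Rightarrow> complex"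
  where "poly2 p = (\<lambda>(a, b). poly (poly p [:a:]) b)"

text \<open>Total degree; the zero polynomial gets degree \<open>0\<close>.\<close>
definition total_degree :: "complex poly poly \<Rightarrow> nat"
  where "total_degree p = Max (insert 0 {i + j | i j. coeff2 p i j \<noteq> 0})"

definition homogeneous_part :: "nat \<Rightarrow> complex poly poly \<Rightarrow> complex poly poly"
  where "homogeneous_part d p = (\<Sum>i\<le>d. Polynomial.monom (Polynomial.monom (coeff2 p i (d - i)) (d - i)) i)"

definition dx :: "complex poly poly \<Rightarrow> complex poly poly"
  where "dx p = pderiv p"

definition dy :: "complex poly poly \<Rightarrow> complex poly poly"
  where "dy p = map_poly pderiv p"

definition jacobian_det :: "complex poly poly \<Rightarrow> complex poly poly \<Rightarrow> complex poly poly"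
  where "jacobian_det f1 f2 = dx f1 * dy f2 - dy f1 * dx f2"

definition common_zeros :: "complex poly poly \<Rightarrow> complex poly poly \<Rightarrow> (complex \<times> complex) set"
  where "common_zeros f1 f2 = {p. poly2 f1 p = 0 \<and> poly2 f2 p = 0}"


section \<open>Germs of holomorphic functions on \<open>\<complex>\<^sup>2\<close>\<close>

text \<open>Holomorphic near \<open>p\<close>: complex differentiable (the derivative is \<open>\<complex>\<close>-linear) at every point of
  some neighbourhood of \<open>p\<close>.\<close>
definition holomorphic_near :: "complex \<times> complex \<Rightarrow> (complex \<times> complex \<Rightarrow> complex) \<Rightarrow> bool"
  where "holomorphic_near p F \<longleftrightarrow>
    (\<exists>U. open U \<and> p \<in> U \<and>
      (\<forall>z\<in>U. \<exists>a b. (F has_derivative (\<lambda>v. a * fst v + b * snd v)) (at z)))"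

definition germ :: "complex \<times> complex \<Rightarrow> (complex \<times> complex \<Rightarrow> complex)
    \<Rightarrow> (complex \<times> complex \<Rightarrow> complex) set"
  where "germ p F = {G. \<forall>\<^sub>F z in nhds p. G z = F z}"

text \<open>The ring \<open>\<O>\<^sub>p\<close>. Its elements are equivalence classes, so the operations take unions over
  representatives, as \<^const>\<open>rcoset_mult\<close> does; all these unions consist of a single germ.\<close>
definition germ_ring :: "complex \<times> complex \<Rightarrow> (complex \<times> complex \<Rightarrow> complex) set ring"
  where "germ_ring p =
    \<lparr>carrier = germ p ` {F. holomorphic_near p F},
     mult = (\<lambda>A B. \<Union>F\<in>A. \<Union>G\<in>B. germ p (\<lambda>z. F z * G z)),
     one = germ p (\<lambda>z. 1),
     zero = germ p (\<lambda>z. 0),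
     add = (\<lambda>A B. \<Union>F\<in>A. \<Union>G\<in>B. germ p (\<lambda>z. F z + G z))\<rparr>"


section \<open>Intersection multiplicity\<close>

definition local_ideal :: "complex \<times> complex \<Rightarrow> complex poly poly \<Rightarrow> complex poly poly
    \<Rightarrow> (complex \<times> complex \<Rightarrow> complex) set set"
  where "local_ideal p f1 f2 = Idl\<^bsub>germ_ring p\<^esub> {germ p (poly2 f1), germ p (poly2 f2)}"

definition local_algebra :: "complex \<times> complex \<Rightarrow> complex poly poly \<Rightarrow> complex poly poly
    \<Rightarrow> (complex \<times> complex \<Rightarrow> complex) set set ring"
  where "local_algebra p f1 f2 = germ_ring p Quot local_ideal p f1 f2"

text \<open>The image of \<open>\<complex>\<close> in the local algebra, as needed for \<^const>\<open>ring.dimension\<close>.\<close>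
definition local_scalars :: "complex \<times> complex \<Rightarrow> complex poly poly \<Rightarrow> complex poly poly
    \<Rightarrow> (complex \<times> complex \<Rightarrow> complex) set set set"
  where "local_scalars p f1 f2 =
    range (\<lambda>c. local_ideal p f1 f2 +>\<^bsub>germ_ring p\<^esub> germ p (\<lambda>z. c))"

definition intersection_multiplicity ::
    "complex \<times> complex \<Rightarrow> complex poly poly \<Rightarrow> complex poly poly \<Rightarrow> enat"
  where "intersection_multiplicity p f1 f2 =
    (let A = local_algebra p f1 f2; K = local_scalars p f1 f2
     in if ring.finite_dimension A K (carrier A) then enat (ring.dim A K (carrier A)) else \<infinity>)"

text \<open>Every multiplicity is at least \<open>1\<close>, so infinitely many common zeros give \<open>\<infinity>\<close>.\<close>
definition total_intersection_number :: "complex poly poly \<Rightarrow> complex poly poly \<Rightarrow> enat"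
  where "total_intersection_number f1 f2 =
    (if finite (common_zeros f1 f2)
     then \<Sum>p\<in>common_zeros f1 f2. intersection_multiplicity p f1 f2 else \<infinity>)"

end

theory Submission
  imports Defs
    "HOL-Complex_Analysis.Complex_Analysis"
    "HOL-Computational_Algebra.Computational_Algebra"
    "HOL-Computational_Algebra.Field_as_Ring"
begin

text \<open>
  Both \<open>f\<^sub>1\<close> and \<open>f\<^sub>2\<close> are monic in \<open>x\<close>, so by Puiseux's theorem they split as \<open>\<Prod>(x - a\<^sub>i)\<close> and
  \<open>\<Prod>(x - b\<^sub>j)\<close> over \<open>\<complex>[[s]]\<close>, \<open>y = s\<^sup>m\<close>. With \<open>D = y d/dy\<close> and \<open>c\<^sub>i\<^sub>j = D(a\<^sub>i - b\<^sub>j) / (a\<^sub>i - b\<^sub>j)\<close>, partial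
  fractions give \<open>y \<J>(f) = f\<^sub>1 g\<^sub>1 + f\<^sub>2 g\<^sub>2\<close> with \<open>g\<^sub>2 = \<Sum>\<^sub>i (\<Sum>\<^sub>j c\<^sub>i\<^sub>j) \<Prod>\<^sub>k\<^sub>\<noteq>\<^sub>i (x - a\<^sub>k)\<close>. A logarithmic
  derivative of a power series has at most a simple pole, so the \<open>c\<^sub>i\<^sub>j\<close> are power series and \<open>g\<^sub>2\<close> is
  regular at \<open>y = 0\<close>; off \<open>y = 0\<close> it is regular because \<open>f\<^sub>1\<close> and \<open>f\<^sub>2\<close> have no common zeros
  there. So \<open>g\<^sub>2\<close> is a polynomial. The substitution \<open>(x, y) \<mapsto> (x/y, 1/y)\<close> turns the pair into another
  one whose common zeros lie on \<open>y = 0\<close>, and regularity there is the bound on the total degree.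

  The coefficient of \<open>x\<^sup>n\<^sup>-\<^sup>1\<close> in \<open>g\<^sub>2\<close> has constant term \<open>(1/m) \<Sum>\<^sub>i\<^sub>j ord (a\<^sub>i - b\<^sub>j)\<close>, which is the codimension
  of \<open>(f\<^sub>1, f\<^sub>2)\<close> in \<open>\<complex>[x,y]\<close>. By the Chinese remainder theorem this codimension is the sum of those of
  the ideals \<open>(f\<^sub>1, f\<^sub>2, (x - a)\<^sup>K)\<close> over the common zeros \<open>(a, 0)\<close>. Since the local ideal contains powers
  of \<open>x - a\<close> and of \<open>y\<close>, Taylor expansion identifies the quotient by such an ideal with the local
  algebra of germs.
\<close>

hide_const (open) up_ring.coeff up_ring.monom Coset.order Module.smult


section \<open>Hensel factorization and Puiseux expansions\<close>

text \<open>Uniqueness is what allows separately built solutions to be compared: one from Bezout's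
  identity, one from the Puiseux roots, one for the reversed pair. It needs only that g_2 has degree
  below n in x. Indeed the ideal contains some y^M, so the difference B of two such g_2 has y^M B
  divisible by f_1; as f_1 is monic of degree n in x, B = 0. Regularity along y = 0 thus becomes
  divisibility by a power of y, and no fraction field is needed.

  The factor y in y J(f) is exactly what cancels the simple pole of the logarithmic derivative.
  Under y = s^m one has s d/ds = m y d/dy, while passing from C[x,y] to C[[s]][x] multiplies the
  codimension of the ideal by m. These two factors cancel, which is why the coefficient of x^(n-1)
  is an integer although the roots may have fractional exponents.\<close>

definition slice :: "nat \<Rightarrow> complex fps poly \<Rightarrow> complex poly"
  where "slice k F = map_poly (\<lambda>a. fps_nth a k) F"

lemma coeff_slice [simp]: "coeff (slice k F) i = fps_nth (coeff F i) k"
  by (simp add: slice_def coeff_map_poly)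

lemma slice_eqI: "(\<And>k. slice k F = slice k G) \<Longrightarrow> F = G"
  by (metis coeff_slice fps_ext poly_eqI)

lemma slice_mult: "slice k (F * G) = (\<Sum>j\<le>k. slice j F * slice (k - j) G)"
proof (rule poly_eqI)
  fix i
  have "coeff (slice k (F * G)) i
      = (\<Sum>l\<le>i. \<Sum>j\<le>k. fps_nth (coeff F l) j * fps_nth (coeff G (i - l)) (k - j))"
    by (simp add: coeff_mult fps_sum_nth fps_mult_nth atLeast0AtMost)
  also have "\<dots> = (\<Sum>j\<le>k. \<Sum>l\<le>i. fps_nth (coeff F l) j * fps_nth (coeff G (i - l)) (k - j))"
    by (rule sum.swap)
  also have "\<dots> = coeff (\<Sum>j\<le>k. slice j F * slice (k - j) G) i"
    by (simp add: coeff_sum coeff_mult)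
  finally show "coeff (slice k (F * G)) i = \<dots>" .
qed

text \<open>The common bound \<open>N\<close> matters: without it the slices would only assemble to
  a power series in s with polynomial coefficients, not to a polynomial in x.\<close>

lemma ex_poly_of_slices:
  assumes "\<And>k i. i > N \<Longrightarrow> coeff (g k) i = 0"
  shows "\<exists>G. \<forall>k. slice k G = g k"
proof -
  define G where "G = Poly (map (\<lambda>i. Abs_fps (\<lambda>k. coeff (g k) i)) [0..<Suc N])"
  have "slice k G = g k" for k
    by (rule poly_eqI) (use assms in \<open>auto simp: G_def nth_default_def simp del: upt_Suc\<close>)
  thus ?thesis by blast
qed

text \<open>Reducing the multiplier \<open>u\<close> of a Bezout solution modulo \<open>g\<close>
  bounds it; then \<open>g * v = r - h * u\<close> has degree below
  \<open>degree g + degree h\<close>, which bounds \<open>v\<close>. The bounds are stated by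
  vanishing coefficients so that they force \<open>u = 0\<close> when \<open>g\<close> is
  constant.\<close>

lemma coprime_bezout_reduced:
  fixes g h r :: "complex poly"
  assumes "coprime g h" "g \<noteq> 0" "h \<noteq> 0" "\<And>i. i \<ge> degree g + degree h \<Longrightarrow> coeff r i = 0"
  shows "\<exists>u v. g * v + h * u = r \<and> (\<forall>i\<ge>degree g. coeff u i = 0) \<and>
           (\<forall>i\<ge>degree h. coeff v i = 0)"
proof -
  obtain a b where ab: "a * g + b * h = 1"
    using bezout_coefficients_fst_snd[of g h] assms(1) by (simp add: coprime_iff_gcd_eq_1)
  define u where "u = (b * r) mod g"
  have u: "coeff u i = 0" if "i \<ge> degree g" for i
    using degree_mod_less[OF assms(2), of "b * r"] that
    by (metis coeff_0 coeff_eq_0 order_less_le_trans u_def)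
  have "g dvd r - h * u"
  proof -
    have "r - h * u = g * (a * r + h * ((b * r) div g))"
    proof -
      have hu: "h * u = h * (b * r) - h * (g * ((b * r) div g))"
        unfolding u_def by (simp add: minus_mult_div_eq_mod[symmetric] algebra_simps)
      have "r - h * u = (a * g * r + b * h * r) - h * u"
        by (metis ab distrib_right mult_1)
      also have "\<dots> = g * (a * r + h * ((b * r) div g))"
        unfolding hu by (simp add: algebra_simps)
      finally show ?thesis .
    qed
    thus ?thesis by simp
  qed
  then obtain v where v: "r - h * u = g * v" by blast
  have "coeff v i = 0" if "i \<ge> degree h" for i
  proof (rule ccontr)
    assume *: "coeff v i \<noteq> 0"
    hence "v \<noteq> 0" "degree v \<ge> degree h" using that le_degree order_trans by fastforce+
    have d: "degree (g * v) \<ge> degree g + degree h"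
      using \<open>v \<noteq> 0\<close> \<open>degree v \<ge> degree h\<close> assms by (simp add: degree_mult_eq)
    have "coeff (h * u) (degree (g * v)) = 0"
    proof (cases "u = 0")
      case False
      have "degree u < degree g" using u False by (metis leading_coeff_0_iff not_le)
      thus ?thesis using d by (intro coeff_eq_0) (use degree_mult_le[of h u] in linarith)
    qed auto
    hence "coeff (g * v) (degree (g * v)) = 0"
      using assms(4)[OF d] v by (metis coeff_diff diff_self)
    thus False using \<open>v \<noteq> 0\<close> assms by simp
  qed
  thus ?thesis using u v by (intro exI[of _ u] exI[of _ v]) (auto simp: algebra_simps)
qed

text \<open>The slices of \<open>G\<close> and \<open>H\<close> are found recursively: once the
  lower ones are known, those of order k solve a linear equation g v + h u = s, which coprimality
  makes solvable. Solutions of degree below \<open>degree g\<close> and \<open>degree h\<close>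
  leave the leading coefficients alone, so both factors stay monic.\<close>

lemma hensel_factorization:
  fixes F :: "complex fps poly"
  assumes "lead_coeff F = 1" "slice 0 F = g * h" "lead_coeff g = 1" "lead_coeff h = 1" "coprime g h"
  shows "\<exists>G H. F = G * H \<and> lead_coeff G = 1 \<and> lead_coeff H = 1 \<and> degree G = degree g \<and> degree H = degree h"
proof -
  have nz: "g \<noteq> 0" "h \<noteq> 0" using assms by auto
  have degF: "degree F = degree g + degree h"
  proof (rule antisym)
    have "coeff (g * h) (degree F) \<noteq> 0"
      using assms(1) by (simp flip: assms(2))
    thus "degree F \<le> degree g + degree h"
      by (metis degree_mult_le le_degree order_trans)
    have "coeff (slice 0 F) (degree (g * h)) \<noteq> 0"
      unfolding assms(2) using nz by simp
    hence "degree (g * h) \<le> degree F" by (intro le_degree) (auto simp: )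
    thus "degree g + degree h \<le> degree F" using nz by (simp add: degree_mult_eq)
  qed
  have sliceF: "coeff (slice k F) i = 0" if "k > 0" "i \<ge> degree g + degree h" for k i
  proof (cases "i = degree F")
    case True thus ?thesis using assms(1) that by simp
  next
    case False
    hence "coeff F i = 0" using that degF by (intro coeff_eq_0) auto
    thus ?thesis by simp
  qed
  define small where "small = (\<lambda>r :: complex poly \<times> complex poly.
      (\<forall>i\<ge>degree g. coeff (fst r) i = 0) \<and> (\<forall>i\<ge>degree h. coeff (snd r) i = 0))"
  \<comment> \<open>\<open>P f k r\<close> says that \<open>r\<close> is an admissible pair of k-th
    slices given the earlier pairs \<open>f\<close>. Order 0 is prescribed; the middle terms of the
    Cauchy product move to the right-hand side.\<close>
  define P where "P = (\<lambda>(f :: nat \<Rightarrow> complex poly \<times> complex poly) (k::nat) r.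
     if k = 0 then r = (g, h)
     else small r \<and> g * snd r + h * fst r = slice k F - (\<Sum>j\<in>{0<..<k}. fst (f j) * snd (f (k - j))))"
  have "\<exists>f. \<forall>x. P f x (f x)"
  proof (rule dependent_wellorder_choice)
    fix r and f f' :: "nat \<Rightarrow> complex poly \<times> complex poly" and x :: nat
    assume "\<And>y. y < x \<Longrightarrow> f y = f' y"
    hence "(\<Sum>j\<in>{0<..<x}. fst (f j) * snd (f (x - j))) = (\<Sum>j\<in>{0<..<x}. fst (f' j) * snd (f' (x - j)))"
      by (intro sum.cong) auto
    thus "P f x r = P f' x r" unfolding P_def by simp
  next
    fix x and f :: "nat \<Rightarrow> complex poly \<times> complex poly" assume *: "\<And>y::nat. y < x \<Longrightarrow> P f y (f y)"
    show "\<exists>r. P f x r"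
    proof (cases "x = 0")
      case False
      define s where "s = slice x F - (\<Sum>j\<in>{0<..<x}. fst (f j) * snd (f (x - j)))"
      have "coeff s i = 0" if i: "i \<ge> degree g + degree h" for i
      proof -
        have "coeff (fst (f j) * snd (f (x - j))) i = 0" if j: "j \<in> {0<..<x}" for j
        proof -
          have "small (f j)" "small (f (x - j))"
            using *[of j] *[of "x - j"] j by (auto simp: P_def split: if_splits)
          hence "coeff (fst (f j)) l * coeff (snd (f (x - j))) (i - l) = 0" for l
            using i unfolding small_def by (cases "l \<ge> degree g") auto
          thus ?thesis unfolding coeff_mult by (intro sum.neutral ballI)
        qed
        thus ?thesis unfolding s_def using sliceF[of x i] False i by (simp add: coeff_sum)
      qed
      from coprime_bezout_reduced[OF assms(5) nz this]
      obtain u v where "g * v + h * u = s" "\<forall>i\<ge>degree g. coeff u i = 0"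
           "\<forall>i\<ge>degree h. coeff v i = 0" by blast
      hence "P f x (u, v)" using False by (simp add: P_def small_def s_def)
      thus ?thesis by blast
    qed (auto simp: P_def)
  qed
  then obtain f where f: "\<And>k. P f k (f k)" by blast
  have f0: "f 0 = (g, h)" using f[of 0] by (simp add: P_def)
  have fs: "small (f k)" "g * snd (f k) + h * fst (f k) = slice k F - (\<Sum>j\<in>{0<..<k}. fst (f j) * snd (f (k - j)))"
    if "k > 0" for k using f[of k] that by (simp_all add: P_def)
  have "\<exists>G. \<forall>k. slice k G = fst (f k)"
    by (rule ex_poly_of_slices[of "degree g"]) (metis f0 fs(1) small_def coeff_eq_0 fst_conv neq0_conv less_imp_le)
  then obtain G where G: "\<And>k. slice k G = fst (f k)" by blast
  have "\<exists>G. \<forall>k. slice k G = snd (f k)"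
    by (rule ex_poly_of_slices[of "degree h"]) (metis f0 fs(1) small_def coeff_eq_0 snd_conv neq0_conv less_imp_le)
  then obtain H where H: "\<And>k. slice k H = snd (f k)" by blast
  have FGH: "F = G * H"
  proof (rule slice_eqI)
    fix k show "slice k F = slice k (G * H)"
    proof (cases "k = 0")
      case True thus ?thesis by (simp add: slice_mult G H f0 assms(2))
    next
      case False
      have "{..k} = insert 0 (insert k {0<..<k})" using False by auto
      hence "slice k (G * H) = g * snd (f k) + (fst (f k) * h + (\<Sum>j\<in>{0<..<k}. fst (f j) * snd (f (k - j))))"
        using False by (simp add: slice_mult G H f0)
      thus ?thesis using fs(2)[of k] False by (simp add: algebra_simps)
    qed
  qed
  have monic: "lead_coeff G' = 1 \<and> degree G' = degree g'"
    if van: "\<And>k. k > 0 \<Longrightarrow> \<forall>i\<ge>degree g'. coeff (slice k G') i = 0" and s0: "slice 0 G' = g'" and mon: "lead_coeff g' = 1" for G' g'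
  proof -
    have 1: "coeff G' (degree g') = 1"
    proof (rule fps_ext)
      fix k show "fps_nth (coeff G' (degree g')) k = fps_nth 1 k"
        using van[of k] mon by (cases "k = 0") (auto simp flip: coeff_slice simp: s0)
    qed
    have 2: "coeff G' i = 0" if i: "i > degree g'" for i
    proof (rule fps_ext)
      fix k show "fps_nth (coeff G' i) k = fps_nth 0 k"
        using van[of k] i
        by (cases "k = 0") (auto simp flip: coeff_slice simp: coeff_eq_0 s0)
    qed
    have "degree G' = degree g'"
      by (rule antisym) (use 1 2 in \<open>auto intro: degree_le le_degree\<close>)
    thus ?thesis using 1 by simp
  qed
  have "lead_coeff G = 1 \<and> degree G = degree g"
    by (rule monic) (use fs(1) f0 assms in \<open>auto simp: G small_def\<close>)
  moreover have "lead_coeff H = 1 \<and> degree H = degree h"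
    by (rule monic) (use fs(1) f0 assms in \<open>auto simp: H small_def\<close>)
  ultimately show ?thesis using FGH by blast
qed

lemma map_poly_mult_hom:
  assumes "f 0 = 0" "\<And>a b. f (a + b) = f a + f b" "\<And>a b. f (a * b) = f a * f b"
  shows "map_poly f (p * q) = map_poly f p * map_poly f q"
proof (rule poly_eqI)
  fix i
  have s: "f (sum g A) = (\<Sum>x\<in>A. f (g x))" for g :: "nat \<Rightarrow> _" and A
    by (induction A rule: infinite_finite_induct) (auto simp: assms)
  show "coeff (map_poly f (p * q)) i = coeff (map_poly f p * map_poly f q) i"
    by (simp add: coeff_mult coeff_map_poly assms s)
qed

lemma map_poly_add_hom:
  assumes "f 0 = 0" "\<And>a b. f (a + b) = f a + f b"
  shows "map_poly f (p + q) = map_poly f p + map_poly f q"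
  by (rule poly_eqI) (simp add: coeff_map_poly assms)

section \<open>Products of linear factors, and splitting after adjoining a root of the series
  variable\<close>

definition linprod :: "'a::comm_ring_1 list \<Rightarrow> 'a poly"
  where "linprod as = (\<Prod>a\<leftarrow>as. [:-a, 1:])"

lemma linprod_Nil [simp]: "linprod [] = 1"
  and linprod_Cons [simp]: "linprod (a # as) = [:-a, 1:] * linprod as"
  and linprod_append [simp]: "linprod (as @ bs) = linprod as * linprod bs"
  by (simp_all add: linprod_def)

lemma lead_coeff_linprod [simp]: "lead_coeff (linprod as :: 'a::idom poly) = 1"
  by (induction as) (simp_all add: lead_coeff_mult del: mult_pCons_left)

lemma degree_linprod [simp]: "degree (linprod as :: 'a::idom poly) = length as"
proof (induction as)
  case (Cons a as)
  have "linprod as \<noteq> 0" using lead_coeff_linprod[of as] by force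
  thus ?case using Cons by (simp add: degree_mult_eq del: mult_pCons_left)
qed auto

lemma poly_linprod_eq_0: "a \<in> set as \<Longrightarrow> poly (linprod as) a = 0"
  by (induction as) auto

lemma pcompose_linprod: "pcompose (linprod as) [:c, 1:] = linprod (map (\<lambda>a. a - c) as)"
  by (induction as) (simp_all add: pcompose_mult pcompose_pCons pcompose_1 del: mult_pCons_left)

lemma pcompose_linprod_scale:
  "pcompose (linprod (map ((*) t) as)) [:0, t:] = smult (t ^ length as) (linprod as)"
proof (induction as)
  case (Cons a as)
  have "pcompose [:- (t * a), 1:] [:0, t:] = smult t [:- a, 1:]"
    by (simp add: pcompose_pCons)
  thus ?case
    by (simp only: list.map linprod_Cons pcompose_mult Cons) (simp add: mult_ac smult_diff_right)
qed (simp add: pcompose_1)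

definition ramify :: "nat \<Rightarrow> complex fps poly \<Rightarrow> complex fps poly"
  where "ramify m F = map_poly (\<lambda>a. a oo fps_X ^ m) F"

lemma coeff_ramify [simp]: "coeff (ramify m F) i = coeff F i oo fps_X ^ m"
  by (simp add: ramify_def coeff_map_poly)

lemma ramify_mult: "m > 0 \<Longrightarrow> ramify m (F * G) = ramify m F * ramify m G"
  unfolding ramify_def
  by (intro map_poly_mult_hom) (simp_all add: fps_compose_add_distrib fps_compose_mult_distrib)

lemma ramify_add: "ramify m (F + G) = ramify m F + ramify m G"
  unfolding ramify_def by (intro map_poly_add_hom) (simp_all add: fps_compose_add_distrib)

lemma ramify_1 [simp]: "ramify m 1 = 1"
  by (rule poly_eqI) simp

lemma ramify_linear [simp]: "ramify m [:-a, 1:] = [:-(a oo fps_X ^ m), 1:]"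
  by (rule poly_eqI) (auto simp: coeff_pCons fps_compose_uminus split: nat.splits)

lemma ramify_linprod: "m > 0 \<Longrightarrow> ramify m (linprod as) = linprod (map (\<lambda>a. a oo fps_X ^ m) as)"
  by (induction as) (simp_all add: ramify_mult del: mult_pCons_left)

lemma fps_compose_X_power_X_power:
  "k > 0 \<Longrightarrow> m > 0 \<Longrightarrow> (a oo fps_X ^ m) oo fps_X ^ k = (a :: complex fps) oo fps_X ^ (m * k)"
  by (rule fps_ext) (auto simp: fps_nth_compose_X_power dvd_div_iff_mult div_mult2_eq mult.commute)

lemma ramify_ramify: "k > 0 \<Longrightarrow> m > 0 \<Longrightarrow> ramify k (ramify m F) = ramify (m * k) F"
  by (rule poly_eqI) (simp add: fps_compose_X_power_X_power)

lemma degree_ramify [simp]: assumes "m > 0" shows "degree (ramify m F) = degree F"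
  unfolding ramify_def by (rule degree_map_poly) (use assms in \<open>auto simp: fps_compose_eq_0_iff\<close>)

text \<open>The index \<open>m\<close> is a common denominator of the exponents of the Puiseux
  series that are the roots of \<open>F\<close>.\<close>

definition splits :: "complex fps poly \<Rightarrow> bool"
  where "splits F \<longleftrightarrow> (\<exists>m>0. \<exists>as. ramify m F = linprod as)"

lemma splits_mult:
  assumes "splits F" "splits G" shows "splits (F * G)"
proof -
  from assms obtain k m as bs where *: "k > 0" "m > 0" "ramify k F = linprod as" "ramify m G = linprod bs"
    unfolding splits_def by blast
  have "ramify (k * m) F = linprod (map (\<lambda>a. a oo fps_X ^ m) as)"
    using * by (simp flip: ramify_ramify add: ramify_linprod)
  moreover have "ramify (k * m) G = linprod (map (\<lambda>a. a oo fps_X ^ k) bs)"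
    using * by (subst mult.commute) (simp flip: ramify_ramify add: ramify_linprod)
  ultimately have "ramify (k * m) (F * G)
      = linprod (map (\<lambda>a. a oo fps_X ^ m) as @ map (\<lambda>a. a oo fps_X ^ k) bs)"
    using * by (simp add: ramify_mult)
  thus ?thesis unfolding splits_def using * by (metis nat_0_less_mult_iff)
qed

text \<open>Translation in x commutes with ramification once \<open>c\<close> is ramified too;
  translating back then moves every root by the ramified \<open>c\<close>.\<close>

lemma splits_shift:
  assumes "splits (pcompose F [:c, 1:])" shows "splits F"
proof -
  from assms obtain m as where *: "m > 0" "ramify m (pcompose F [:c, 1:]) = linprod as"
    unfolding splits_def by blast
  define d where "d = c oo fps_X ^ m"
  have "ramify m (pcompose F [:c, 1:]) = pcompose (ramify m F) [:d, 1:]"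
  proof (induction F)
    case 0 thus ?case by (simp add: ramify_def)
  next
    case (pCons a F)
    have p: "ramify m (pCons a p) = pCons (a oo fps_X ^ m) (ramify m p)" for a p
      by (rule poly_eqI) (auto simp: coeff_pCons split: nat.splits)
    have l: "ramify m [:c, 1:] = [:d, 1:]"
      by (rule poly_eqI) (auto simp: coeff_pCons d_def split: nat.splits)
    have c: "ramify m [:a:] = [:a oo fps_X ^ m:]" by (simp add: p) (simp add: ramify_def)
    show ?case using * by (simp only: pcompose_pCons p[of a F] ramify_add ramify_mult pCons.IH l c)
  qed
  hence "pcompose (pcompose (ramify m F) [:d, 1:]) [:-d, 1:] = linprod (map (\<lambda>a. a - (-d)) as)"
    using * by (metis pcompose_linprod)
  moreover have "pcompose (pcompose (ramify m F) [:d, 1:]) [:-d, 1:] = ramify m F"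
    by (simp add: pcompose_assoc[symmetric] pcompose_pCons pcompose_idR)
  ultimately show ?thesis unfolding splits_def using * by metis
qed

text \<open>With n = \<open>degree F\<close>, the last hypothesis says that replacing s by s^q in
  \<open>F\<close> and then x by s^r x gives s^(r n) \<open>G\<close>: the rescaling along an edge
  of slope r/q of the Newton polygon. Up to ramification the roots of \<open>F\<close> are s^r times
  those of \<open>G\<close>.\<close>

lemma splits_scale:
  assumes "q > 0" "splits G" "degree G = degree F"
    and "\<And>i. i \<le> degree F \<Longrightarrow> coeff F i oo fps_X ^ q = fps_X ^ (r * (degree F - i)) * coeff G i"
  shows "splits F"
proof -
  from assms obtain m as where *: "m > 0" "ramify m G = linprod as"
    unfolding splits_def by blast
  have len: "length as = degree F" using * assms(3) by (metis degree_linprod degree_ramify)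
  define t :: "complex fps" where "t = fps_X ^ (m * r)"
  have [simp]: "t \<noteq> 0" by (simp add: t_def)
  have "pcompose (ramify (q * m) F) [:0, t:] = smult (t ^ length as) (linprod as)"
  proof (rule poly_eqI)
    fix i
    show "coeff (pcompose (ramify (q * m) F) [:0, t:]) i
        = coeff (smult (t ^ length as) (linprod as)) i"
    proof (cases "i \<le> degree F")
      case True
      have "coeff (ramify (q * m) F) i = (fps_X ^ (r * (degree F - i)) * coeff G i) oo fps_X ^ m"
        using assms True * by (simp flip: ramify_ramify)
      also have "\<dots> = t ^ (degree F - i) * coeff (ramify m G) i"
        using *(1) by (simp add: fps_compose_mult_distrib fps_X_power_compose t_def power_mult[symmetric] mult.assoc)
      finally have "coeff (ramify (q * m) F) i = t ^ (degree F - i) * coeff (linprod as) i"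
        unfolding *(2) .
      moreover have "t ^ i * t ^ (degree F - i) = t ^ degree F"
        using True by (simp flip: power_add)
      ultimately show ?thesis
        by (simp add: coeff_pcompose_linear len flip: mult.assoc del: coeff_ramify)
    next
      case False
      thus ?thesis using len by (simp add: coeff_pcompose_linear coeff_eq_0)
    qed
  qed
  hence "pcompose (ramify (q * m) F) [:0, t:] = pcompose (linprod (map ((*) t) as)) [:0, t:]"
    by (simp add: pcompose_linprod_scale)
  hence "t ^ i * coeff (ramify (q * m) F) i = t ^ i * coeff (linprod (map ((*) t) as)) i" for i
    by (metis coeff_pcompose_linear)
  hence "ramify (q * m) F = linprod (map ((*) t) as)"
    by (intro poly_eqI) (simp del: coeff_ramify)
  thus ?thesis unfolding splits_def using * assms(1) by (metis nat_0_less_mult_iff)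
qed

lemma fps_X_power_dvd_iff: "fps_X ^ k dvd (a :: complex fps) \<longleftrightarrow> (\<forall>i<k. fps_nth a i = 0)"
proof
  assume "\<forall>i<k. fps_nth a i = 0"
  hence "a = fps_X ^ k * Abs_fps (\<lambda>n. fps_nth a (n + k))"
    by (intro fps_ext) (auto simp: fps_X_power_mult_nth)
  thus "fps_X ^ k dvd a" by (metis dvd_triv_left)
qed (auto simp: fps_X_power_mult_nth)

text \<open>Split off the full power of one root a. If this exhausted \<open>p\<close>, the
  coefficient of x^(n-1) would be -n a; its vanishing forces a = 0 in characteristic zero, so
  \<open>p\<close> would be x^n, against the nonzero lower coefficient.\<close>

lemma monic_complex_poly_coprime_factor:
  fixes p :: "complex poly"
  assumes "lead_coeff p = 1" "degree p = n" "n > 0" "coeff p (n - 1) = 0" "i < n" "coeff p i \<noteq> 0"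
  shows "\<exists>g h. p = g * h \<and> lead_coeff g = 1 \<and> lead_coeff h = 1 \<and> coprime g h \<and> 0 < degree g \<and> degree g < n"
proof -
  have "\<not> constant (poly p)" using assms by (simp add: constant_degree)
  then obtain a where a: "poly p a = 0" using fundamental_theorem_of_algebra by blast
  define k where "k = order a p"
  have p0: "p \<noteq> 0" using assms by auto
  obtain h where h: "p = [:-a, 1:] ^ k * h" "\<not> [:-a, 1:] dvd h"
    using order_decomp[OF p0, of a] k_def by blast
  have "k > 0" using a p0 by (simp add: k_def order_root)
  have h0: "h \<noteq> 0" using h by auto
  have deg: "degree p = k + degree h"
    using h h0 by (simp add: degree_mult_eq degree_linear_power)
  have lh: "lead_coeff h = 1" using assms(1) h by (simp add: lead_coeff_mult lead_coeff_power)
  have "k < n"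
  proof (rule ccontr)
    assume "\<not> k < n"
    hence "degree h = 0" "k = n" using deg assms by auto
    hence "h = 1" using lh by (metis degree_0_id of_nat_1 one_pCons)
    hence p: "p = [:-a, 1:] ^ n" using h \<open>k = n\<close> by simp
    have "coeff p (n - 1) = of_nat n * (-a)"
      using assms(3) using binomial_symmetric[of 1 n] by (simp add: p coeff_linear_poly_power)
    hence "a = 0" using assms by simp
    hence "p = monom 1 n" by (simp add: p monom_altdef)
    thus False using assms by simp
  qed
  moreover have "coprime ([:-a, 1:] ^ k) h"
    using h(2) by (intro prime_elem_imp_coprime coprime_power_left_iff[THEN iffD2] disjI1) (auto intro: prime_elem_linear_field_poly)
  moreover define g where "g = [:-a, 1:] ^ k"
  moreover have "lead_coeff g = 1"
    unfolding g_def lead_coeff_power by simp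
  moreover have "degree g = k"
    unfolding g_def by (rule degree_linear_power)
  ultimately have "p = g * h" "lead_coeff g = 1" "coprime g h" "0 < degree g" "degree g < n"
    using h(1) \<open>k > 0\<close> by auto
  thus ?thesis using lh by blast
qed

text \<open>Newton--Puiseux: once the coefficient of \<open>x\<^sup>n\<^sup>-\<^sup>1\<close> is removed, rescaling by the smallest slope of
  the Newton polygon gives a polynomial whose reduction modulo \<open>s\<close> has at least two distinct roots,
  so that Hensel's lemma applies.\<close>
theorem monic_fps_poly_splits:
  fixes F :: "complex fps poly"
  assumes "lead_coeff F = 1"
  shows "splits F"
  using assms
proof (induction "degree F" arbitrary: F rule: less_induct)
  case less
  define n where "n = degree F"
  show ?case
  proof (cases "n = 0")
    case True
    hence "F = 1" using less.prems n_def by (metis degree_0_id of_nat_1 one_pCons)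
    thus ?thesis unfolding splits_def by (intro exI[of _ 1] conjI exI[of _ "[]"]) auto
  next
    case n0: False
    \<comment> \<open>\<open>c\<close> is the mean of the roots; substituting x + c (Tschirnhaus)
      removes the coefficient of x^(n-1).\<close>
    define c :: "complex fps" where "c = - (fps_const (1 / of_nat n) * coeff F (n - 1))"
    define E where "E = pcompose F [:c, 1:]"
    have degE: "degree E = n" unfolding E_def n_def by (simp add: degree_pcompose)
    have lE: "lead_coeff E = 1" using less.prems by (simp add: E_def lead_coeff_comp)
    have cE: "coeff E (n - 1) = 0"
    proof -
      have "E = (\<Sum>i\<le>n. smult (coeff F i) ([:c, 1:] ^ i))"
        unfolding E_def n_def
        by (simp add: pcompose_altdef poly_altdef degree_map_poly coeff_map_poly)
      hence "coeff E (n - 1) = (\<Sum>i\<le>n. coeff F i * coeff ([:c, 1:] ^ i) (n - 1))"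
        by (simp add: coeff_sum)
      also have "\<dots> = (\<Sum>i\<in>{n - 1, n}. coeff F i * coeff ([:c, 1:] ^ i) (n - 1))"
      proof (rule sum.mono_neutral_right)
        show "\<forall>i\<in>{..n} - {n - 1, n}. coeff F i * coeff ([:c, 1:] ^ i) (n - 1) = 0"
        proof
          fix i assume "i \<in> {..n} - {n - 1, n}"
          hence "degree ([:c, 1:] ^ i) < n - 1" by (auto simp: degree_linear_power)
          thus "coeff F i * coeff ([:c, 1:] ^ i) (n - 1) = 0"
            by (simp add: coeff_eq_0)
        qed
      qed auto
      also have "\<dots> = coeff F (n - 1) + of_nat n * c"
        using n0 less.prems binomial_symmetric[of 1 n]
        by (simp add: coeff_linear_poly_power n_def[symmetric])
      also have "\<dots> = 0"
        using n0 unfolding c_def by (simp add: fps_of_nat[symmetric] mult.assoc[symmetric] fps_const_mult)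
      finally show ?thesis .
    qed
    have "splits E"
    proof (cases "\<exists>i<n. coeff E i \<noteq> 0")
      case False
      have "linprod (replicate k 0) = monom (1 :: complex fps) k" for k
        by (induction k) (simp_all add: monom_Suc)
      moreover have "E = monom 1 n"
      proof (rule poly_eqI)
        fix i show "coeff E i = coeff (monom 1 n) i"
          using False lE degE by (cases i n rule: linorder_cases) (auto simp: coeff_eq_0)
      qed
      ultimately have "ramify 1 E = linprod (replicate n 0)"
        by (metis power_one_right fps_X_fps_compose_startby0 poly_eqI coeff_ramify fps_compose_fps_X)
      thus ?thesis unfolding splits_def by (intro exI[of _ "1::nat"]) auto
    next
      case True
      define S where "S = {i. i < n \<and> coeff E i \<noteq> 0}"
      define v where "v = (\<lambda>i. subdegree (coeff E i))"
      have "finite S" "S \<noteq> {}" using True by (auto simp: S_def)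
      from ex_min_if_finite[of "(\<lambda>i. real (v i) / real (n - i)) ` S"] this
      obtain i0 where i0: "i0 \<in> S" "\<And>i. i \<in> S \<Longrightarrow> real (v i0) / real (n - i0) \<le> real (v i) / real (n - i)"
        by (auto simp: not_less)
      \<comment> \<open>The smallest slope is r/q, not necessarily in lowest terms; ramification by
        q turns it into the integer r.\<close>
      define q r where "q = n - i0" and "r = v i0"
      have q0: "q > 0" using i0 by (simp add: q_def S_def)
      have slope: "r * (n - i) \<le> q * v i" if "i \<in> S" for i
      proof -
        have "n - i > 0" using that by (simp add: S_def)
        hence "real r * real (n - i) \<le> real (v i) * real q"
          using i0(2)[OF that] q0 unfolding q_def r_def by (simp add: divide_simps mult.commute split: if_splits)
        thus ?thesis by (metis mult.commute of_nat_le_iff of_nat_mult)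
      qed
      have "\<exists>g. coeff E i oo fps_X ^ q = fps_X ^ (r * (n - i)) * g" for i
      proof (cases "i \<in> S")
        case True
        have "subdegree (coeff E i oo fps_X ^ q) = v i * q"
          using q0 by (simp add: subdegree_fps_compose v_def)
        hence "fps_X ^ (r * (n - i)) dvd coeff E i oo fps_X ^ q"
          using slope[OF True] by (auto simp: fps_X_power_dvd_iff mult.commute intro!: nth_less_subdegree_zero)
        thus ?thesis by (auto elim: dvdE)
      next
        case False
        show ?thesis
        proof (cases "i < n")
          case True
          hence "coeff E i = 0" using False by (simp add: S_def)
          thus ?thesis by (intro exI[of _ 0]) simp
        next
          \<comment> \<open>For \<open>i \<ge> n\<close> the truncated difference
            \<open>n - i\<close> is 0, so nothing has to be divided out.\<close>
          case False
          thus ?thesis by auto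
        qed
      qed
      then obtain g where g: "\<And>i. coeff E i oo fps_X ^ q = fps_X ^ (r * (n - i)) * g i"
        by metis
      define G where "G = Poly (map g [0..<Suc n])"
      have G: "coeff G i = (if i \<le> n then g i else 0)" for i
        by (simp add: G_def nth_default_def del: upt_Suc)
      have gn: "g n = 1" using g[of n] lE degE by simp
      have degG: "degree G = n"
        by (rule antisym) (auto intro!: degree_le le_degree simp: G gn)
      have lG: "lead_coeff G = 1" by (simp add: degG G gn)
      define p where "p = slice 0 G"
      have lp: "coeff p n = 1" by (simp add: p_def G gn)
      have degp: "degree p = n"
        by (rule antisym) (auto intro!: degree_le le_degree simp: lp, simp add: p_def G)
      have "g (n - 1) = 0" using g[of "n - 1"] cE by simp
      hence cp: "coeff p (n - 1) = 0" by (simp add: p_def G)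
      have "i0 < n" using i0 by (simp add: S_def)
      \<comment> \<open>The index \<open>i0\<close> attains the smallest slope, so exactly its order
        is divided out and its leading coefficient survives in the reduction; hence \<open>p\<close>
        is not x^n.\<close>
      have "fps_nth (coeff E i0 oo fps_X ^ q) (r * q) = fps_nth (g i0) 0"
        unfolding g by (simp add: fps_X_power_mult_nth q_def)
      hence "fps_nth (g i0) 0 = fps_nth (coeff E i0) r"
        using q0 by (simp add: fps_nth_compose_X_power)
      also have "\<dots> \<noteq> 0" using i0 by (simp add: r_def v_def S_def)
      finally have "coeff p i0 \<noteq> 0" using \<open>i0 < n\<close> by (simp add: p_def G)
      from monic_complex_poly_coprime_factor[OF _ degp _ cp \<open>i0 < n\<close> this]
      obtain g1 h1 where gh: "p = g1 * h1" "lead_coeff g1 = 1" "lead_coeff h1 = 1" "coprime g1 h1"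
          "0 < degree g1" "degree g1 < n"
        using lp degp n0 by auto
      from hensel_factorization[OF lG gh(1)[unfolded p_def] gh(2,3,4)]
      obtain G1 H1 where GH: "G = G1 * H1" "lead_coeff G1 = 1" "lead_coeff H1 = 1"
          "degree G1 = degree g1" "degree H1 = degree h1" by blast
      have "degree p = degree g1 + degree h1" unfolding gh(1)
        by (rule degree_mult_eq) (use gh in auto)
      hence "degree h1 < n" using degp gh(5) by simp
      hence "splits G1" "splits H1"
        using less.hyps[of G1] less.hyps[of H1] GH gh(6) unfolding n_def by auto
      hence "splits G" unfolding GH by (rule splits_mult)
      thus ?thesis
        by (rule splits_scale[OF q0]) (use degG degE g G in auto)
    qed
    thus ?thesis unfolding E_def by (rule splits_shift)
  qed
qed


section \<open>Codimension of ideals\<close>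

text \<open>The family \<open>e\<close> represents a basis of the quotient by \<open>S\<close> over
  the complex numbers. Scalars act through the embedding \<open>\<kappa>\<close>, so that one notion
  serves both C[x,y] and C[[s]][x].\<close>

definition quotient_basis :: "(complex \<Rightarrow> 'a::comm_ring_1) \<Rightarrow> 'a set \<Rightarrow> 'i set \<Rightarrow> ('i \<Rightarrow> 'a) \<Rightarrow> bool"
  where "quotient_basis \<kappa> S J e \<longleftrightarrow> finite J \<and>
    (\<forall>v. \<exists>c. v - (\<Sum>i\<in>J. \<kappa> (c i) * e i) \<in> S) \<and>
    (\<forall>c. (\<Sum>i\<in>J. \<kappa> (c i) * e i) \<in> S \<longrightarrow> (\<forall>i\<in>J. c i = 0))"

definition has_codim :: "(complex \<Rightarrow> 'a::comm_ring_1) \<Rightarrow> 'a set \<Rightarrow> nat \<Rightarrow> bool"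
  where "has_codim \<kappa> S d \<longleftrightarrow> (\<exists>e. quotient_basis \<kappa> S {..<d} e)"

lemma has_codimI:
  assumes "quotient_basis \<kappa> S J e"
  shows "has_codim \<kappa> S (card J)"
proof -
  have "finite J" using assms by (simp add: quotient_basis_def)
  then obtain h where h: "bij_betw h {..<card J} J"
    using ex_bij_betw_nat_finite by (auto simp: atLeast0LessThan)
  define g where "g = inv_into {..<card J} h"
  have gh: "g (h i) = i" if "i < card J" for i
    using h that unfolding g_def by (auto simp: bij_betw_def)
  have *: "(\<Sum>i\<in>J. \<kappa> (c i) * e i) = (\<Sum>i<card J. \<kappa> (c (h i)) * e (h i))" for c
    by (rule sum.reindex_bij_betw[OF h, symmetric])
  have "quotient_basis \<kappa> S {..<card J} (e \<circ> h)"
    unfolding quotient_basis_def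
  proof (intro conjI allI impI ballI)
    fix v
    obtain c where "v - (\<Sum>i\<in>J. \<kappa> (c i) * e i) \<in> S"
      using assms unfolding quotient_basis_def by blast
    thus "\<exists>c. v - (\<Sum>i<card J. \<kappa> (c i) * (e \<circ> h) i) \<in> S"
      unfolding * by (intro exI[of _ "c \<circ> h"]) simp
  next
    fix c i assume c: "(\<Sum>i<card J. \<kappa> (c i) * (e \<circ> h) i) \<in> S" and i: "i \<in> {..<card J}"
    have "(\<Sum>i\<in>J. \<kappa> ((c \<circ> g) i) * e i) \<in> S"
      using c unfolding * by (simp add: gh)
    hence "(c \<circ> g) (h i) = 0"
      using assms h i unfolding quotient_basis_def bij_betw_def by blast
    thus "c i = 0" using gh i by simp
  qed simp
  thus ?thesis unfolding has_codim_def by blast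
qed

text \<open>Gaussian elimination, one equation at a time: the unknown of a pivot \<open>p\<close> is
  eliminated by means of equation \<open>j0\<close> and recovered afterwards from the
  others.\<close>

lemma homogeneous_system_nontrivial:
  fixes a :: "'i \<Rightarrow> 'j \<Rightarrow> 'k::field"
  assumes "finite J'" "finite J" "card J' < card J"
  shows "\<exists>c. (\<exists>i\<in>J. c i \<noteq> 0) \<and> (\<forall>j\<in>J'. (\<Sum>i\<in>J. c i * a i j) = 0)"
  using assms
proof (induction J' arbitrary: J a rule: finite_induct)
  case empty
  thus ?case by (intro exI[of _ "\<lambda>_. 1"]) (auto simp: card_gt_0_iff)
next
  case (insert j0 J')
  show ?case
  proof (cases "\<forall>i\<in>J. a i j0 = 0")
    case True
    have "card J' < card J" using insert by simp
    then obtain c where "\<exists>i\<in>J. c i \<noteq> 0" "\<forall>j\<in>J'. (\<Sum>i\<in>J. c i * a i j) = 0"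
      using insert.IH[of J a] insert.prems(1) by blast
    thus ?thesis using True by (intro exI[of _ c]) auto
  next
    case False
    then obtain p where p: "p \<in> J" "a p j0 \<noteq> 0" by blast
    define a' where "a' = (\<lambda>i j. a i j - a i j0 / a p j0 * a p j)"
    have "card J' < card (J - {p})" using insert p by simp
    then obtain c where c: "\<exists>i\<in>J - {p}. c i \<noteq> 0" "\<forall>j\<in>J'. (\<Sum>i\<in>J - {p}. c i * a' i j) = 0"
      using insert.IH[of "J - {p}" a'] insert.prems(1) by blast
    define t where "t = (\<Sum>i\<in>J - {p}. c i * (a i j0 / a p j0))"
    define c' where "c' = c(p := - t)"
    have sum: "(\<Sum>i\<in>J. c' i * a i j) = (\<Sum>i\<in>J - {p}. c i * a' i j)" for j
    proof -
      have "(\<Sum>i\<in>J. c' i * a i j) = - t * a p j + (\<Sum>i\<in>J - {p}. c' i * a i j)"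
        using insert.prems p by (simp add: sum.remove[of J p] c'_def)
      also have "(\<Sum>i\<in>J - {p}. c' i * a i j) = (\<Sum>i\<in>J - {p}. c i * a i j)"
        by (intro sum.cong) (auto simp: c'_def)
      also have "- t * a p j + \<dots> = (\<Sum>i\<in>J - {p}. c i * a' i j)"
        by (simp add: t_def a'_def algebra_simps sum_distrib_left sum_subtractf)
      finally show ?thesis .
    qed
    have "(\<Sum>i\<in>J. c' i * a i j0) = 0" unfolding sum a'_def using p by simp
    hence "\<forall>j\<in>insert j0 J'. (\<Sum>i\<in>J. c' i * a i j) = 0" using c(2) sum by auto
    moreover have "\<exists>i\<in>J. c' i \<noteq> 0" using c(1) by (auto simp: c'_def)
    ultimately show ?thesis by blast
  qed
qed

locale scalar_embedding =
  fixes \<kappa> :: "complex \<Rightarrow> 'a::comm_ring_1"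
  assumes emb_add: "\<kappa> (a + b) = \<kappa> a + \<kappa> b"
    and emb_mult: "\<kappa> (a * b) = \<kappa> a * \<kappa> b"
    and emb_1: "\<kappa> 1 = 1"
begin

lemma emb_0 [simp]: "\<kappa> 0 = 0" using emb_add[of 0 0] by simp

lemma emb_sum: "\<kappa> (sum f A) = (\<Sum>x\<in>A. \<kappa> (f x))"
  by (induction A rule: infinite_finite_induct) (auto simp: emb_add)

lemma emb_minus: "\<kappa> (- a) = - \<kappa> a"
  using emb_add[of a "-a"] by (simp add: add_eq_0_iff)

text \<open>Exchange argument: express each \<open>e i\<close> modulo \<open>S\<close> in the
  \<open>e' j\<close>. With more \<open>e i\<close> than \<open>e' j\<close>, a nontrivial
  combination of the coefficient rows vanishes, against independence. Used in both directions it
  makes the codimension unique.\<close>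

lemma codim_le:
  assumes S: "0 \<in> S" "\<And>u v. u \<in> S \<Longrightarrow> v \<in> S \<Longrightarrow> u + v \<in> S" "\<And>u v. u \<in> S \<Longrightarrow> v * u \<in> S"
    and "has_codim \<kappa> S d" "has_codim \<kappa> S d'"
  shows "d \<le> d'"
proof (rule ccontr)
  assume "\<not> d \<le> d'"
  from assms obtain e e' where e: "quotient_basis \<kappa> S {..<d} e" "quotient_basis \<kappa> S {..<d'} e'"
    unfolding has_codim_def by blast
  have "\<forall>i. \<exists>c. e i - (\<Sum>j<d'. \<kappa> (c j) * e' j) \<in> S"
    using e unfolding quotient_basis_def by blast
  then obtain a where a: "\<And>i. e i - (\<Sum>j<d'. \<kappa> (a i j) * e' j) \<in> S" by metis
  obtain c where c: "\<exists>i<d. c i \<noteq> 0" "\<forall>j<d'. (\<Sum>i<d. c i * a i j) = 0"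
    using homogeneous_system_nontrivial[of "{..<d'}" "{..<d}" a] \<open>\<not> d \<le> d'\<close> by auto
  have Ssum: "(\<Sum>i\<in>A. f i) \<in> S" if "\<And>i. i \<in> A \<Longrightarrow> f i \<in> S" for f and A :: "nat set"
    using that by (induction A rule: infinite_finite_induct) (auto intro: S)
  have "(\<Sum>i<d. \<kappa> (c i) * (e i - (\<Sum>j<d'. \<kappa> (a i j) * e' j))) \<in> S"
    by (intro Ssum S(3) a)
  also have "(\<Sum>i<d. \<kappa> (c i) * (e i - (\<Sum>j<d'. \<kappa> (a i j) * e' j)))
      = (\<Sum>i<d. \<kappa> (c i) * e i) - (\<Sum>i<d. \<Sum>j<d'. \<kappa> (c i * a i j) * e' j)"
    by (simp add: right_diff_distrib sum_subtractf sum_distrib_left emb_mult mult.assoc)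
  also have "(\<Sum>i<d. \<Sum>j<d'. \<kappa> (c i * a i j) * e' j) = (\<Sum>j<d'. \<kappa> (\<Sum>i<d. c i * a i j) * e' j)"
    by (subst sum.swap) (simp add: emb_sum sum_distrib_right)
  also have "\<dots> = 0" using c(2) by simp
  finally have "(\<Sum>i<d. \<kappa> (c i) * e i) \<in> S" by simp
  thus False using c(1) e(1) unfolding quotient_basis_def by blast
qed

text \<open>A spanning subset of least size is a basis, since a relation modulo \<open>S\<close>
  would express one of its members by the others.\<close>

lemma codim_exists:
  assumes S: "\<And>u v. u \<in> S \<Longrightarrow> v \<in> S \<Longrightarrow> u + v \<in> S" "\<And>u v. u \<in> S \<Longrightarrow> v * u \<in> S"
    and "finite J" "\<forall>v. \<exists>c. v - (\<Sum>i\<in>J. \<kappa> (c i) * e i) \<in> S"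
  shows "\<exists>d. has_codim \<kappa> S d"
proof -
  define spans where "spans = (\<lambda>J. \<forall>v. \<exists>c. v - (\<Sum>i\<in>J. \<kappa> (c i) * e i) \<in> S)"
  define P where "P = (\<lambda>k. \<exists>K\<subseteq>J. card K = k \<and> spans K)"
  define d where "d = (LEAST k. P k)"
  have "P (card J)" using assms P_def spans_def by blast
  hence "P d" unfolding d_def by (rule LeastI)
  then obtain K where K: "K \<subseteq> J" "card K = d" "spans K" unfolding P_def by blast
  have finK: "finite K" using K(1) assms(3) by (rule finite_subset)
  have "quotient_basis \<kappa> S K e"
    unfolding quotient_basis_def
  proof (intro conjI allI impI ballI)
    show "finite K" by fact
    show "\<exists>c. v - (\<Sum>i\<in>K. \<kappa> (c i) * e i) \<in> S" for v using K(3) by (simp add: spans_def)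
    fix c i assume c: "(\<Sum>i\<in>K. \<kappa> (c i) * e i) \<in> S" and i: "i \<in> K"
    show "c i = 0"
    proof (rule ccontr)
      assume ci: "c i \<noteq> 0"
      have "\<exists>b. v - (\<Sum>j\<in>K - {i}. \<kappa> (b j) * e j) \<in> S" for v
      proof -
        obtain b where b: "v - (\<Sum>j\<in>K. \<kappa> (b j) * e j) \<in> S" using K(3) unfolding spans_def by blast
        \<comment> \<open>This multiple of the relation makes the coefficient at \<open>i\<close>
          vanish.\<close>
        define b' where "b' = (\<lambda>j. b j + (- (b i / c i)) * c j)"
        have "(\<Sum>j\<in>K - {i}. \<kappa> (b' j) * e j) = (\<Sum>j\<in>K. \<kappa> (b' j) * e j)"
          using ci by (intro sum.mono_neutral_left) (use i finK in \<open>auto simp: b'_def\<close>)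
        also have "\<dots> = (\<Sum>j\<in>K. \<kappa> (b j) * e j) - \<kappa> (b i / c i) * (\<Sum>j\<in>K. \<kappa> (c j) * e j)"
          unfolding b'_def
          by (simp only: emb_add emb_mult emb_minus) (simp add: algebra_simps sum.distrib sum_distrib_left sum_subtractf)
        finally have "v - (\<Sum>j\<in>K - {i}. \<kappa> (b' j) * e j)
            = (v - (\<Sum>j\<in>K. \<kappa> (b j) * e j)) + \<kappa> (b i / c i) * (\<Sum>j\<in>K. \<kappa> (c j) * e j)" by simp
        thus ?thesis using S(1)[OF b S(2)[OF c]] by metis
      qed
      hence "spans (K - {i})" unfolding spans_def by blast
      moreover have "card (K - {i}) = d - 1" using i finK K by simp
      ultimately have "P (d - 1)" using K(1) unfolding P_def by blast
      hence "d \<le> d - 1" unfolding d_def by (rule Least_le)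
      moreover have "d > 0" using i finK K by (auto simp: card_gt_0_iff)
      ultimately show False by simp
    qed
  qed
  thus ?thesis by (blast intro: has_codimI)
qed

end

section \<open>Ideals with two generators, and their codimension when one generator splits\<close>

definition ideal2 :: "'a::comm_ring_1 \<Rightarrow> 'a \<Rightarrow> 'a set"
  where "ideal2 F G = {F * A + G * B | A B. True}"

lemma ideal2I [intro]: "F * A + G * B \<in> ideal2 F G"
  by (auto simp: ideal2_def)

lemma ideal2_0 [simp]: "0 \<in> ideal2 F G"
  using ideal2I[of F 0 G 0] by simp

lemma ideal2_add: "u \<in> ideal2 F G \<Longrightarrow> v \<in> ideal2 F G \<Longrightarrow> u + v \<in> ideal2 F G"
proof -
  assume "u \<in> ideal2 F G" "v \<in> ideal2 F G"
  then obtain A B A' B' where "u = F * A + G * B" "v = F * A' + G * B'" by (auto simp: ideal2_def)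
  hence "u + v = F * (A + A') + G * (B + B')" by (simp add: algebra_simps)
  thus ?thesis by auto
qed

lemma ideal2_mult: "u \<in> ideal2 F G \<Longrightarrow> v * u \<in> ideal2 F G"
proof -
  assume "u \<in> ideal2 F G"
  then obtain A B where "u = F * A + G * B" by (auto simp: ideal2_def)
  hence "v * u = F * (v * A) + G * (v * B)" by (simp add: algebra_simps)
  thus ?thesis by auto
qed

lemma ideal2_diff: "u \<in> ideal2 F G \<Longrightarrow> v \<in> ideal2 F G \<Longrightarrow> u - v \<in> ideal2 F G"
  using ideal2_add[of u F G "-v"] ideal2_mult[of v F G "-1"] by simp

lemma ideal2_sum: "(\<And>i. i \<in> A \<Longrightarrow> f i \<in> ideal2 F G) \<Longrightarrow> sum f A \<in> ideal2 F G"
  by (induction A rule: infinite_finite_induct) (auto intro: ideal2_add)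

abbreviation kfps :: "complex \<Rightarrow> complex fps poly"
  where "kfps c \<equiv> [:fps_const c:]"

interpretation kfps: scalar_embedding kfps
  by unfold_locales (simp_all add: one_pCons)

text \<open>A basis for \<open>(x - a) F\<close> consists of the powers \<open>s\<^sup>t\<close> with \<open>t < ord G(a)\<close> and of a basis for
  \<open>F\<close> multiplied by \<open>x - a\<close>.\<close>
lemma has_codim_linprod:
  assumes "\<And>a. a \<in> set as \<Longrightarrow> poly G a \<noteq> 0"
  shows "has_codim kfps (ideal2 (linprod as) G) (\<Sum>a\<leftarrow>as. subdegree (poly G a))"
  using assms
proof (induction as)
  case Nil
  have "v \<in> ideal2 1 G" for v using ideal2I[of 1 v G 0] by simp
  thus ?case unfolding has_codim_def quotient_basis_def by simp
next
  case (Cons a as)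
  define F where "F = linprod as"
  define L where "L = [:-a, 1:]"
  define d where "d = (\<Sum>a\<leftarrow>as. subdegree (poly G a))"
  define v where "v = subdegree (poly G a)"
  obtain e where e: "quotient_basis kfps (ideal2 F G) {..<d} e"
    using Cons unfolding has_codim_def F_def d_def by auto
  define J where "J = {..<v} <+> {..<d}"
  define e' where "e' = case_sum (\<lambda>t. [:fps_X ^ t:]) (\<lambda>i. L * e i)"
  have sumJ: "(\<Sum>i\<in>J. kfps (c i) * e' i)
     = [:\<Sum>t<v. fps_const (c (Inl t)) * fps_X ^ t:] + L * (\<Sum>i<d. kfps (c (Inr i)) * e i)" for c
  proof -
    have "(\<Sum>t\<in>A. [:f t:]) = [:\<Sum>t\<in>A. f t:]" for f :: "nat \<Rightarrow> complex fps" and A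
      by (induction A rule: infinite_finite_induct) auto
    thus ?thesis unfolding J_def
      by (simp add: sum.Plus e'_def sum_distrib_left mult_ac del: mult_pCons_left mult_pCons_right)
         (simp add: mult_ac)
  qed
  have div: "\<exists>Q. H = [:poly H a:] + L * Q" for H
  proof -
    have "poly (H - [:poly H a:]) a = 0" by simp
    then obtain Q where "H - [:poly H a:] = L * Q" unfolding poly_eq_0_iff_dvd L_def by (rule dvdE)
    thus ?thesis by (intro exI[of _ Q]) (simp add: algebra_simps)
  qed
  have "quotient_basis kfps (ideal2 (L * F) G) J e'"
    unfolding quotient_basis_def
  proof (intro conjI allI impI)
    show "finite J" by (simp add: J_def)
  next
    fix H
    obtain Q where Q: "H = [:poly H a:] + L * Q" using div by blast
    obtain R where R: "G = [:poly G a:] + L * R" using div by blast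
    \<comment> \<open>The truncation of H(a) below the order v of G(a); the rest of H(a) is a
      multiple of G(a), since divisibility of power series is decided by the order.\<close>
    define w where "w = (\<Sum>t<v. fps_const (fps_nth (poly H a) t) * fps_X ^ t)"
    have wn: "fps_nth w k = (if k < v then fps_nth (poly H a) k else 0)" for k
    proof -
      have "fps_nth w k = (\<Sum>t<v. if k = t then fps_nth (poly H a) t else 0)"
        by (simp add: w_def fps_sum_nth fps_X_power_nth if_distrib cong: if_cong)
      thus ?thesis by simp
    qed
    have "poly G a dvd poly H a - w"
    proof (cases "poly H a = w")
      case False
      hence "v \<le> subdegree (poly H a - w)" by (intro subdegree_geI) (simp_all add: wn)
      thus ?thesis using Cons.prems[of a] False by (simp add: fps_dvd_iff v_def)
    qed auto
    then obtain z where z: "poly H a = w + poly G a * z"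
      by (metis add.commute diff_add_cancel dvdE)
    \<comment> \<open>The difference H - w - z G is divisible by \<open>L\<close>; its quotient Q -
      R z is expanded in the basis for \<open>F\<close>.\<close>
    obtain c where c: "(Q - R * [:z:]) - (\<Sum>i<d. kfps (c i) * e i) \<in> ideal2 F G"
      using e unfolding quotient_basis_def by blast
    then obtain A B where AB: "(Q - R * [:z:]) - (\<Sum>i<d. kfps (c i) * e i) = F * A + G * B"
      by (auto simp: ideal2_def)
    define c' where "c' = case_sum (\<lambda>t. fps_nth (poly H a) t) c"
    have "H - (\<Sum>i\<in>J. kfps (c' i) * e' i) = L * F * A + G * ([:z:] + L * B)"
    proof -
      have "H - (\<Sum>i\<in>J. kfps (c' i) * e' i) = H - [:w:] - L * (\<Sum>i<d. kfps (c i) * e i)"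
        unfolding sumJ by (simp add: c'_def w_def)
      also have "(\<Sum>i<d. kfps (c i) * e i) = Q - R * [:z:] - (F * A + G * B)"
        using AB by (simp add: algebra_simps)
      also have "H - [:w:] = [:poly G a:] * [:z:] + L * Q"
        by (subst Q, subst z) simp
      also have "[:poly G a:] = G - L * R" using R by (metis add_diff_cancel_right')
      also have "(G - L * R) * [:z:] + L * Q - L * (Q - R * [:z:] - (F * A + G * B))
          = L * F * A + G * ([:z:] + L * B)"
        by (simp only: algebra_simps)
      finally show ?thesis .
    qed
    hence "H - (\<Sum>i\<in>J. kfps (c' i) * e' i) \<in> ideal2 (L * F) G"
      by (simp only: ideal2I)
    thus "\<exists>c. H - (\<Sum>i\<in>J. kfps (c i) * e' i) \<in> ideal2 (L * F) G" by blast
  next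
    fix c assume "(\<Sum>i\<in>J. kfps (c i) * e' i) \<in> ideal2 (L * F) G"
    then obtain A B where AB: "[:\<Sum>t<v. fps_const (c (Inl t)) * fps_X ^ t:] + L * (\<Sum>i<d. kfps (c (Inr i)) * e i)
        = L * F * A + G * B"
      unfolding sumJ by (auto simp: ideal2_def)
    define w where "w = (\<Sum>t<v. fps_const (c (Inl t)) * fps_X ^ t)"
    have wn: "fps_nth w k = (if k < v then c (Inl k) else 0)" for k
    proof -
      have "fps_nth w k = (\<Sum>t<v. if k = t then c (Inl t) else 0)"
        by (simp add: w_def fps_sum_nth fps_X_power_nth if_distrib cong: if_cong)
      thus ?thesis by simp
    qed
    have La: "poly L a = 0" by (simp add: L_def)
    have "w = poly G a * poly B a"
      using arg_cong[OF AB, of "\<lambda>p. poly p a"] by (simp add: La w_def)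
    hence "fps_nth w k = 0" if "k < v" for k
      using that by (simp add: v_def fps_mult_nth_outside_subdegrees(1))
    hence w0: "w = 0" by (intro fps_ext) (metis wn fps_zero_nth)
    have "poly B a = 0" using \<open>w = poly G a * poly B a\<close> w0 Cons.prems[of a] by simp
    then obtain B' where B': "B = L * B'" unfolding poly_eq_0_iff_dvd L_def by (rule dvdE)
    have eq: "L * (\<Sum>i<d. kfps (c (Inr i)) * e i) = L * (F * A + G * B')"
      using AB unfolding w_def[symmetric] w0 B' by (simp add: algebra_simps)
    have "L \<noteq> 0" by (simp add: L_def)
    hence "(\<Sum>i<d. kfps (c (Inr i)) * e i) = F * A + G * B'"
      using eq by (rule iffD1[OF mult_left_cancel])
    hence "(\<Sum>i<d. kfps (c (Inr i)) * e i) \<in> ideal2 F G" by auto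
    hence "c (Inr i) = 0" if "i < d" for i
      using e that unfolding quotient_basis_def by (auto dest!: spec[of _ "\<lambda>i. c (Inr i)"])
    moreover have "c (Inl t) = 0" if "t < v" for t using wn[of t] w0 that by simp
    ultimately show "\<forall>i\<in>J. c i = 0" by (auto simp: J_def)
  qed
  from has_codimI[OF this] show ?case
    by (simp add: J_def card_Plus F_def L_def v_def d_def)
qed


section \<open>The Wronskian with respect to d/dx and s d/ds\<close>

definition seuler :: "complex fps poly \<Rightarrow> complex fps poly"
  where "seuler F = map_poly (\<lambda>a. fps_X * fps_deriv a) F"

lemma coeff_seuler [simp]: "coeff (seuler F) i = fps_X * fps_deriv (coeff F i)"
  by (simp add: seuler_def coeff_map_poly)

lemma seuler_mult: "seuler (F * G) = F * seuler G + seuler F * G"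
proof (rule poly_eqI)
  fix i
  have "fps_deriv (sum f A) = (\<Sum>x\<in>A. fps_deriv (f x))" for f :: "nat \<Rightarrow> complex fps" and A
    by (induction A rule: infinite_finite_induct) auto
  thus "coeff (seuler (F * G)) i = coeff (F * seuler G + seuler F * G) i"
    by (simp only: coeff_mult coeff_add coeff_seuler fps_deriv_mult sum_distrib_left sum.distrib[symmetric])
       (simp add: algebra_simps)
qed

lemma seuler_1 [simp]: "seuler 1 = 0"
  by (rule poly_eqI) (simp add: coeff_1)

text \<open>The Jacobian determinant with the Euler derivation s d/ds in place of d/ds, so that
  logarithmic derivatives remain power series. For the ramified pair it is \<open>m\<close> times
  the image of y J(f).\<close>

definition wronski :: "complex fps poly \<Rightarrow> complex fps poly \<Rightarrow> complex fps poly"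
  where "wronski F G = pderiv F * seuler G - seuler F * pderiv G"

lemma wronski_mult_left: "wronski (F * F') G = F * wronski F' G + F' * wronski F G"
  by (simp add: wronski_def seuler_mult pderiv_mult algebra_simps)

lemma wronski_mult_right: "wronski F (G * G') = G * wronski F G' + G' * wronski F G"
  by (simp add: wronski_def seuler_mult pderiv_mult algebra_simps)

text \<open>For \<open>F\<close>, \<open>G\<close> split into linear factors, the biderivation property of the Wronskian reduces its
  representation in the ideal \<open>(F, G)\<close> to the identity
  \<open>s (a - b)' = c (a - b) = c ((x - b) - (x - a))\<close>, where \<open>c\<close> is a power series because the
  logarithmic derivative of a power series has at most a simple pole.\<close>
lemma wronski_linprod:
  assumes "\<And>a. a \<in> set as \<Longrightarrow> poly (linprod bs) a \<noteq> 0"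
  shows "\<exists>g1 g2. wronski (linprod as) (linprod bs) = linprod as * g1 + linprod bs * g2 \<and>
     (\<forall>i\<ge>length as. coeff g2 i = 0) \<and>
     fps_nth (coeff g2 (length as - 1)) 0 = of_nat (\<Sum>a\<leftarrow>as. subdegree (poly (linprod bs) a))"
  using assms
proof (induction as)
  case Nil
  show ?case by (intro exI[of _ 0]) (simp add: wronski_def)
next
  case (Cons a as)
  define L where "L = [:-a, 1:]"
  define G where "G = linprod bs"
  define F where "F = linprod as"
  have lin: "\<exists>h1 c. wronski L (linprod cs) = L * h1 + linprod cs * [:c:] \<and>
      fps_nth c 0 = of_nat (subdegree (poly (linprod cs) a))"
    if "poly (linprod cs) a \<noteq> 0" for cs
    using that
  proof (induction cs)
    case Nil
    show ?case by (intro exI[of _ 0]) (simp add: wronski_def)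
  next
    case (Cons b cs)
    have nz: "a - b \<noteq> 0" "poly (linprod cs) a \<noteq> 0" using Cons.prems by auto
    obtain h1 c where IH: "wronski L (linprod cs) = L * h1 + linprod cs * [:c:]"
        "fps_nth c 0 = of_nat (subdegree (poly (linprod cs) a))"
      using Cons.IH[OF nz(2)] by blast
    define u where "u = a - b"
    define v where "v = subdegree u"
    have un: "fps_nth u v \<noteq> 0" using nz unfolding v_def u_def by (intro nth_subdegree_nonzero)
    have "u dvd fps_X * fps_deriv u"
    proof (cases "fps_X * fps_deriv u = 0")
      case False
      have "fps_nth (fps_X * fps_deriv u) i = 0" if "i < v" for i
      proof -
        have "fps_nth u i = 0" using that unfolding v_def by (rule nth_less_subdegree_zero)
        thus ?thesis by (cases i) (simp_all only: fps_X_mult_nth fps_deriv_nth, simp_all)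
      qed
      hence "v \<le> subdegree (fps_X * fps_deriv u)"
        using False by (intro subdegree_geI)
      thus ?thesis using nz False by (simp add: fps_dvd_iff u_def v_def)
    next
      case True
      thus ?thesis by (simp only: dvd_0_right)
    qed
    then obtain k where k: "fps_X * fps_deriv u = u * k" by (auto elim: dvdE)
    \<comment> \<open>The derivation s d/ds multiplies the term of order v by v; comparing leading
      terms with those of \<open>u * k\<close> gives \<open>k\<close> the constant term v, the order
      of a - b.\<close>
    have "fps_nth (fps_X * fps_deriv u) v = of_nat v * fps_nth u v"
      by (cases v) auto
    moreover have "fps_nth (u * k) v = fps_nth u v * fps_nth k 0"
      unfolding v_def by (rule nth_subdegree_mult_left)
    ultimately have k0: "fps_nth k 0 = of_nat v" using un k by auto
    have "wronski L [:-b, 1:] = [:fps_X * fps_deriv (a - b):]"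
      by (rule poly_eqI) (auto simp: wronski_def L_def seuler_def pderiv_pCons map_poly_pCons algebra_simps coeff_pCons split: nat.splits)
    also have "\<dots> = [:u * k:]"
      unfolding u_def[symmetric] k ..
    also have "\<dots> = L * [:-k:] + [:-b, 1:] * [:k:]"
      by (simp add: L_def u_def algebra_simps)
    finally have "wronski L (linprod (b # cs)) = [:-b, 1:] * (L * h1 + linprod cs * [:c:])
        + linprod cs * (L * [:-k:] + [:-b, 1:] * [:k:])"
      unfolding linprod_Cons wronski_mult_right IH(1) by simp
    also have "\<dots> = L * ([:-b, 1:] * h1 + linprod cs * [:-k:]) + linprod (b # cs) * ([:c:] + [:k:])"
      unfolding linprod_Cons by (simp only: algebra_simps)
    finally have "wronski L (linprod (b # cs)) = L * ([:-b, 1:] * h1 + linprod cs * [:-k:]) + linprod (b # cs) * [:c + k:]"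
      by simp
    moreover have "poly (linprod (b # cs)) a = u * poly (linprod cs) a" by (simp add: u_def algebra_simps)
    ultimately show ?case using nz
      by (intro exI[of _ "[:-b, 1:] * h1 + linprod cs * [:-k:]"] exI[of _ "c + k"])
         (simp add: IH(2) k0 u_def v_def subdegree_mult left_diff_distrib[symmetric])
  qed
  obtain h1 c where lin': "wronski L G = L * h1 + G * [:c:]" "fps_nth c 0 = of_nat (subdegree (poly G a))"
    using lin[of bs] Cons.prems[of a] unfolding G_def by auto
  obtain g1 g2 where IH: "wronski F G = F * g1 + G * g2" "\<And>i. i \<ge> length as \<Longrightarrow> coeff g2 i = 0"
     "fps_nth (coeff g2 (length as - 1)) 0 = of_nat (\<Sum>a\<leftarrow>as. subdegree (poly G a))"
    using Cons unfolding F_def G_def by auto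
  have degF: "degree F = length as" "coeff F (length as) = 1"
    using lead_coeff_linprod[of as] by (simp_all add: F_def)
  have "wronski (L * F) G = L * (F * g1 + G * g2) + F * (L * h1 + G * [:c:])"
    unfolding wronski_mult_left IH(1) lin'(1) ..
  also have "\<dots> = (L * F) * (g1 + h1) + G * (L * g2 + F * [:c:])"
    by (simp only: algebra_simps)
  finally have 1: "wronski (L * F) G = (L * F) * (g1 + h1) + G * (L * g2 + F * [:c:])" .
  \<comment> \<open>\<open>L * g2\<close> and \<open>F * [:c:]\<close> both contribute to the new
    top degree \<open>length as\<close>, and their constant terms add up. For empty
    \<open>as\<close> the index \<open>length as - 1\<close> is 0, where \<open>g2\<close>
    vanishes.\<close>
  have Lg: "coeff (L * g2) (length as) = coeff g2 (length as - 1)"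
    using IH(2)[of "length as"] by (cases "length as") (auto simp: L_def)
  have 2: "coeff (L * g2 + F * [:c:]) i = 0" if "i \<ge> length (a # as)" for i
    using that IH(2) degF by (cases i) (auto simp: L_def coeff_eq_0)
  have 3: "fps_nth (coeff (L * g2 + F * [:c:]) (length (a # as) - 1)) 0
      = of_nat (\<Sum>a\<leftarrow>a # as. subdegree (poly G a))"
    using IH(3) lin'(2) degF(2) Lg by simp
  show ?case
    using 1 2 3 unfolding linprod_Cons L_def[symmetric] F_def[symmetric] G_def[symmetric] by blast
qed

abbreviation kpoly :: "complex \<Rightarrow> complex poly poly"
  where "kpoly c \<equiv> [:[:c:]:]"

interpretation kpoly: scalar_embedding kpoly
  by unfold_locales (simp_all add: one_pCons)

lemma quotient_basis_indep:
  "quotient_basis \<kappa> S J e \<Longrightarrow> (\<Sum>i\<in>J. \<kappa> (c i) * e i) \<in> S \<Longrightarrow> i \<in> J \<Longrightarrow> c i = 0"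
  by (auto simp: quotient_basis_def)

lemma monic_division:
  fixes f p :: "'a::idom poly"
  assumes "lead_coeff f = 1"
  shows "\<exists>q r. p = f * q + r \<and> (\<forall>i\<ge>degree f. coeff r i = 0)"
proof -
  have f0: "f \<noteq> 0" using assms by auto
  obtain q r where qr: "pseudo_divmod p f = (q, r)" by fastforce
  have "p = f * q + r" using pseudo_divmod(1)[OF f0 qr] assms by simp
  moreover have "\<forall>i\<ge>degree f. coeff r i = 0"
    using pseudo_divmod(2)[OF f0 qr] by (auto intro: coeff_eq_0)
  ultimately show ?thesis by blast
qed

lemma coeff_mult_monic_vanish:
  fixes f q :: "'a::comm_ring_1 poly"
  assumes "lead_coeff f = 1" "\<And>i. i \<ge> degree f \<Longrightarrow> coeff (f * q) i = 0"
  shows "q = 0"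
proof (rule ccontr)
  assume "q \<noteq> 0"
  have "coeff (f * q) (degree f + degree q) = lead_coeff f * lead_coeff q"
    by (rule coeff_mult_degree_sum)
  thus False using assms \<open>q \<noteq> 0\<close> by simp
qed

section \<open>Comparison of C[x,y] with C[[s]][x]\<close>

definition emb_fps :: "complex poly poly \<Rightarrow> complex fps poly"
  where "emb_fps p = map_poly fps_of_poly p"

lemma coeff_emb_fps [simp]: "coeff (emb_fps p) i = fps_of_poly (coeff p i)"
  by (simp add: emb_fps_def coeff_map_poly)

lemma emb_fps_mult: "emb_fps (p * q) = emb_fps p * emb_fps q"
  unfolding emb_fps_def by (rule map_poly_mult_hom) (simp_all add: fps_of_poly_add fps_of_poly_mult)

lemma emb_fps_add: "emb_fps (p + q) = emb_fps p + emb_fps q"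
  by (rule poly_eqI) (simp add: fps_of_poly_add)

lemma emb_fps_diff: "emb_fps (p - q) = emb_fps p - emb_fps q"
  by (rule poly_eqI) (simp add: fps_of_poly_diff)

lemma emb_fps_const: "emb_fps (kpoly c) = kfps c"
  by (rule poly_eqI) (auto simp: coeff_pCons fps_of_poly_const split: nat.splits)

lemma varY_power: "varY ^ M = [:monom 1 M:]"
proof (induction M)
  case (Suc M)
  show ?case unfolding power_Suc Suc by (simp add: varY_def monom_Suc)
qed (simp add: one_pCons)

lemma emb_fps_varY_power: "emb_fps (varY ^ M) = [:fps_X ^ M:]"
  by (rule poly_eqI) (auto simp: varY_power coeff_pCons fps_of_poly_monom split: nat.splits)

lemma degree_emb_fps: "degree (emb_fps p) = degree p"
  unfolding emb_fps_def by (rule degree_map_poly) (metis fps_of_poly_0 fps_of_poly_eq_iff)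

lemma coeff_varY_power_mult: "coeff (varY ^ M * p) i = monom 1 M * coeff p i"
  by (simp add: varY_power)

text \<open>Each coefficient is cut at order \<open>M\<close>. Modulo an ideal containing y^M this
  replaces power series by polynomials.\<close>

lemma truncate_emb_fps: "\<exists>A0 A1. A = emb_fps A0 + [:fps_X ^ M:] * A1"
proof -
  define t :: "complex fps \<Rightarrow> complex poly" where "t = (\<lambda>a. Poly (map (fps_nth a) [0..<M]))"
  have t: "coeff (t a) j = (if j < M then fps_nth a j else 0)" for a j
    by (simp add: t_def nth_default_def)
  have [simp]: "t 0 = 0" by (rule poly_eqI) (simp add: t)
  have "A = emb_fps (map_poly t A) + [:fps_X ^ M:] * map_poly (fps_shift M) A"
  proof (rule poly_eqI, rule fps_ext)
    fix i j
    show "fps_nth (coeff A i) j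
        = fps_nth (coeff (emb_fps (map_poly t A) + [:fps_X ^ M:] * map_poly (fps_shift M) A) i) j"
      by (simp add: coeff_map_poly t fps_X_power_mult_nth)
  qed
  thus ?thesis by blast
qed

lemma emb_fps_X_power_dvd:
  assumes "\<And>i j. j < M \<Longrightarrow> coeff (coeff q i) j = 0"
  shows "\<exists>q'. q = varY ^ M * q'"
proof -
  have "q = varY ^ M * map_poly (poly_shift M) q"
  proof (rule poly_eqI, rule poly_eqI)
    fix i j
    show "coeff (coeff q i) j
        = coeff (coeff (varY ^ M * map_poly (poly_shift M) q) i) j"
      using assms[of j i] by (simp add: coeff_varY_power_mult coeff_map_poly coeff_monom_mult coeff_poly_shift)
  qed
  thus ?thesis by blast
qed

text \<open>Extension to power series adds no polynomials to the ideal: truncating the multipliers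
  at order \<open>M\<close> changes the combination by a multiple of s^M, and the resulting
  difference from \<open>p\<close>, being a polynomial, is a multiple of y^M.\<close>

lemma emb_fps_ideal2D:
  assumes "varY ^ M \<in> ideal2 f1 f2" "emb_fps p \<in> ideal2 (emb_fps f1) (emb_fps f2)"
  shows "p \<in> ideal2 f1 f2"
proof -
  obtain A B where AB: "emb_fps p = emb_fps f1 * A + emb_fps f2 * B"
    using assms(2) by (auto simp: ideal2_def)
  obtain A0 A1 where A: "A = emb_fps A0 + [:fps_X ^ M:] * A1" using truncate_emb_fps by blast
  obtain B0 B1 where B: "B = emb_fps B0 + [:fps_X ^ M:] * B1" using truncate_emb_fps by blast
  define q where "q = p - (f1 * A0 + f2 * B0)"
  have "emb_fps q = [:fps_X ^ M:] * (emb_fps f1 * A1 + emb_fps f2 * B1)"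
    unfolding q_def emb_fps_diff emb_fps_add emb_fps_mult AB A B
    by (simp only: algebra_simps)
  hence "fps_of_poly (coeff q i) = fps_X ^ M * coeff (emb_fps f1 * A1 + emb_fps f2 * B1) i" for i
    by (metis coeff_emb_fps coeff_smult mult_pCons_left pCons_0_0 add_0_right mult_zero_left)
  hence "coeff (coeff q i) j = 0" if "j < M" for i j
    using that by (metis fps_X_power_mult_nth fps_of_poly_nth)
  then obtain q' where "q = varY ^ M * q'" using emb_fps_X_power_dvd by blast
  hence "q \<in> ideal2 f1 f2" using ideal2_mult[OF assms(1), of q'] by (simp add: mult.commute)
  from ideal2_add[OF this ideal2I[of f1 A0 f2 B0]] show ?thesis by (simp add: q_def)
qed

section \<open>Coordinates of power series over the subring of series in s^m\<close>

definition decimate :: "nat \<Rightarrow> nat \<Rightarrow> complex fps poly \<Rightarrow> complex fps poly"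
  where "decimate m k H = map_poly (\<lambda>a. Abs_fps (\<lambda>j. fps_nth a (m * j + k))) H"

lemma coeff_decimate [simp]:
  "fps_nth (coeff (decimate m k H) i) j = fps_nth (coeff H i) (m * j + k)"
proof -
  have "Abs_fps (\<lambda>j. fps_nth 0 (m * j + k)) = (0 :: complex fps)" by (rule fps_ext) simp
  thus ?thesis by (simp add: decimate_def coeff_map_poly)
qed

lemma decimate_add: "decimate m k (G + H) = decimate m k G + decimate m k H"
  by (intro poly_eqI fps_ext) simp

lemma decimate_sum: "decimate m k (sum f A) = (\<Sum>x\<in>A. decimate m k (f x))"
  by (intro poly_eqI fps_ext) (simp add: coeff_sum fps_sum_nth)

text \<open>In a(s^m) only exponents m i occur, and for k < m the condition m i \<le> m j + k means
  i \<le> j. So taking the coefficients at exponents congruent to k modulo m is linear over the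
  series in s^m.\<close>

lemma fps_mult_compose_power_nth:
  fixes a b :: "complex fps"
  assumes "m > 0" "k < m"
  shows "fps_nth ((a oo fps_X ^ m) * b) (m * j + k) = (\<Sum>i\<le>j. fps_nth a i * fps_nth b (m * (j - i) + k))"
proof -
  have "fps_nth ((a oo fps_X ^ m) * b) (m * j + k)
     = (\<Sum>l\<in>{0..m * j + k}. (if m dvd l then fps_nth a (l div m) else 0) * fps_nth b (m * j + k - l))"
    using assms(1) by (simp add: fps_mult_nth fps_nth_compose_X_power)
  also have "\<dots> = (\<Sum>l\<in>(*) m ` {..j}. (if m dvd l then fps_nth a (l div m) else 0) * fps_nth b (m * j + k - l))"
  proof (rule sum.mono_neutral_right)
    show "(*) m ` {..j} \<subseteq> {0..m * j + k}"
      by (auto intro!: trans_le_add1)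
    show "\<forall>l\<in>{0..m * j + k} - (*) m ` {..j}. (if m dvd l then fps_nth a (l div m) else 0) * fps_nth b (m * j + k - l) = 0"
    proof
      fix l assume l: "l \<in> {0..m * j + k} - (*) m ` {..j}"
      have "\<not> m dvd l"
      proof
        assume "m dvd l"
        then obtain i where i: "l = m * i" by (elim dvdE)
        have "m * i < m * Suc j" using l assms(2) unfolding i by simp
        hence "i < Suc j" by (simp only: mult_less_cancel1)
        hence "i \<le> j" by simp
        thus False using l i by blast
      qed
      thus "(if m dvd l then fps_nth a (l div m) else 0) * fps_nth b (m * j + k - l) = 0" by simp
    qed
  qed auto
  also have "\<dots> = (\<Sum>i\<le>j. fps_nth a i * fps_nth b (m * j + k - m * i))"
    using assms by (subst sum.reindex) (auto simp: inj_on_def)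
  also have "\<dots> = (\<Sum>i\<le>j. fps_nth a i * fps_nth b (m * (j - i) + k))"
  proof (rule sum.cong)
    fix i assume "i \<in> {..j}"
    hence "m * j + k - m * i = m * (j - i) + k"
      by (simp add: diff_mult_distrib2 mult_le_mono2)
    thus "fps_nth a i * fps_nth b (m * j + k - m * i) = fps_nth a i * fps_nth b (m * (j - i) + k)" by simp
  qed auto
  finally show ?thesis .
qed

lemma decimate_ramify_mult:
  assumes "m > 0" "k < m"
  shows "decimate m k (ramify m P * H) = P * decimate m k H"
proof (intro poly_eqI fps_ext)
  fix i j
  show "fps_nth (coeff (decimate m k (ramify m P * H)) i) j = fps_nth (coeff (P * decimate m k H) i) j"
    unfolding coeff_decimate coeff_mult fps_sum_nth coeff_ramify fps_mult_compose_power_nth[OF assms]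
    by (simp add: fps_mult_nth atLeast0AtMost)
qed

lemma decimate_X_power_ramify:
  assumes "m > 0" "k < m" "l < m"
  shows "decimate m k ([:fps_X ^ l:] * ramify m P) = (if k = l then P else 0)"
proof -
  have "decimate m k [:fps_X ^ l:] = (if k = l then 1 else 0)"
  proof (intro poly_eqI fps_ext)
    fix i j
    have "m * j + k = l \<longleftrightarrow> j = 0 \<and> k = l"
      using assms by (cases j) auto
    thus "fps_nth (coeff (decimate m k [:fps_X ^ l:]) i) j
        = fps_nth (coeff (if k = l then 1 else 0) i) j"
      by (auto simp: coeff_pCons coeff_1 fps_X_power_nth split: nat.splits)
  qed
  thus ?thesis
    unfolding mult.commute[of _ "ramify m P"] decimate_ramify_mult[OF assms(1,2)] by simp
qed

lemma decimate_decomp: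
  assumes "m > 0"
  shows "H = (\<Sum>k<m. [:fps_X ^ k:] * ramify m (decimate m k H))"
proof (intro poly_eqI fps_ext)
  fix i N
  have "fps_nth (coeff (\<Sum>k<m. [:fps_X ^ k:] * ramify m (decimate m k H)) i) N
     = (\<Sum>k<m. if k = N mod m then fps_nth (coeff H i) N else 0)"
    unfolding coeff_sum fps_sum_nth
  proof (rule sum.cong)
    fix k assume k: "k \<in> {..<m}"
    have "k \<le> N \<and> m dvd (N - k) \<longleftrightarrow> k = N mod m"
      using k by (auto simp: mod_eq_dvd_iff_nat[symmetric] minus_mod_eq_mult_div)
    moreover have "m * ((N - k) div m) + k = N" if "k = N mod m"
      using that by (simp add: minus_mod_eq_mult_div)
    ultimately show "fps_nth (coeff ([:fps_X ^ k:] * ramify m (decimate m k H)) i) N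
       = (if k = N mod m then fps_nth (coeff H i) N else 0)"
      using assms by (auto simp: fps_X_power_mult_nth fps_nth_compose_X_power)
  qed auto
  also have "\<dots> = fps_nth (coeff H i) N" using assms by simp
  finally show "fps_nth (coeff H i) N = fps_nth (coeff (\<Sum>k<m. [:fps_X ^ k:] * ramify m (decimate m k H)) i) N"
    by simp
qed

text \<open>\<open>\<complex>[[s]]\<close> is free over \<open>\<complex>[[s\<^sup>m]]\<close> with basis \<open>1, s, \<dots>, s\<^sup>m\<^sup>-\<^sup>1\<close>; \<open>decimate m k\<close> is the \<open>k\<close>-th
  coordinate.\<close>
lemma has_codim_ramify:
  assumes m: "m > 0" and M: "varY ^ M \<in> ideal2 f1 f2" and d: "has_codim kpoly (ideal2 f1 f2) d"
  shows "has_codim kfps (ideal2 (ramify m (emb_fps f1)) (ramify m (emb_fps f2))) (m * d)"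
proof -
  define T where "T = (\<lambda>p. ramify m (emb_fps p))"
  have T_mult: "T (p * q) = T p * T q" and T_add: "T (p + q) = T p + T q" for p q
    using m by (simp_all add: T_def emb_fps_mult emb_fps_add ramify_mult ramify_add)
  have T_k: "T (kpoly c) = kfps c" for c
    by (rule poly_eqI) (auto simp: T_def emb_fps_const coeff_pCons split: nat.splits)
  have T_sum: "T (sum f A) = (\<Sum>x\<in>A. T (f x))" for f and A :: "nat set"
  proof (induction A rule: infinite_finite_induct)
    case (infinite A) thus ?case using T_k[of 0] by simp
  next
    case empty thus ?case using T_k[of 0] by simp
  qed (simp add: T_add)
  have T_ideal: "T p \<in> ideal2 (T f1) (T f2)" if p: "p \<in> ideal2 f1 f2" for p
  proof -
    obtain A B where "p = f1 * A + f2 * B" using p by (auto simp: ideal2_def)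
    thus ?thesis by (simp only: T_add T_mult ideal2I)
  qed
  obtain e where e: "quotient_basis kpoly (ideal2 f1 f2) {..<d} e"
    using d unfolding has_codim_def by blast
  define J where "J = {..<m} \<times> {..<d}"
  define e' where "e' = (\<lambda>(k, i). [:fps_X ^ k:] * T (e i))"
  have sumJ: "(\<Sum>i\<in>J. kfps (c i) * e' i) = (\<Sum>k<m. [:fps_X ^ k:] * T (\<Sum>i<d. kpoly (c (k, i)) * e i))" for c
  proof -
    have "(\<Sum>i\<in>J. kfps (c i) * e' i) = (\<Sum>k<m. \<Sum>i<d. kfps (c (k, i)) * e' (k, i))"
      unfolding J_def by (simp only: sum.cartesian_product case_prod_eta) (simp add: case_prod_unfold)
    also have "\<dots> = (\<Sum>k<m. [:fps_X ^ k:] * T (\<Sum>i<d. kpoly (c (k, i)) * e i))"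
      unfolding T_sum T_mult T_k e'_def prod.case sum_distrib_left by (simp only: mult_ac)
    finally show ?thesis .
  qed
  have "quotient_basis kfps (ideal2 (T f1) (T f2)) J e'"
    unfolding quotient_basis_def
  proof (intro conjI allI impI)
    show "finite J" by (simp add: J_def)
  next
    fix H
    have "\<exists>P Q. decimate m k H = emb_fps P + [:fps_X ^ M:] * Q" for k using truncate_emb_fps by blast
    then obtain P Q where PQ: "\<And>k. decimate m k H = emb_fps (P k) + [:fps_X ^ M:] * Q k" by metis
    have "\<exists>c. P k - (\<Sum>i<d. kpoly (c i) * e i) \<in> ideal2 f1 f2" for k
      using e unfolding quotient_basis_def by blast
    then obtain c where c: "\<And>k. P k - (\<Sum>i<d. kpoly (c k i) * e i) \<in> ideal2 f1 f2" by metis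
    define c' where "c' = (\<lambda>(k, i). c k i)"
    \<comment> \<open>Each coordinate of \<open>H\<close> is a polynomial \<open>P k\<close> up to a
      multiple of y^M, and \<open>P k\<close> is expanded in the given basis; all errors lie in the
      ideal.\<close>
    have "H - (\<Sum>i\<in>J. kfps (c' i) * e' i)
       = (\<Sum>k<m. [:fps_X ^ k:] * (T (P k - (\<Sum>i<d. kpoly (c k i) * e i)) + ramify m (Q k) * T (varY ^ M)))"
    proof -
      have "ramify m (decimate m k H) - T (\<Sum>i<d. kpoly (c k i) * e i)
          = T (P k - (\<Sum>i<d. kpoly (c k i) * e i)) + ramify m (Q k) * T (varY ^ M)" for k
      proof -
        have "T (P k) = T (P k - (\<Sum>i<d. kpoly (c k i) * e i)) + T (\<Sum>i<d. kpoly (c k i) * e i)"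
          unfolding T_add[symmetric] by simp
        moreover have "ramify m (decimate m k H) = T (P k) + ramify m (Q k) * T (varY ^ M)"
          unfolding PQ T_def emb_fps_varY_power using m by (simp only: ramify_add ramify_mult mult.commute)
        ultimately show ?thesis by simp
      qed
      thus ?thesis
        by (subst decimate_decomp[OF m, of H])
           (simp only: sumJ c'_def prod.case sum_subtractf[symmetric] right_diff_distrib[symmetric])
    qed
    also have "\<dots> \<in> ideal2 (T f1) (T f2)"
      by (intro ideal2_sum ideal2_mult ideal2_add T_ideal c M)
    finally show "\<exists>c. H - (\<Sum>i\<in>J. kfps (c i) * e' i) \<in> ideal2 (T f1) (T f2)" by blast
  next
    fix c assume "(\<Sum>i\<in>J. kfps (c i) * e' i) \<in> ideal2 (T f1) (T f2)"
    then obtain A B where AB: "(\<Sum>k<m. [:fps_X ^ k:] * T (\<Sum>i<d. kpoly (c (k, i)) * e i)) = T f1 * A + T f2 * B"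
      unfolding sumJ by (auto simp: ideal2_def)
    have "c (k, i) = 0" if k: "k < m" and i: "i < d" for k i
    proof -
      \<comment> \<open>The k-th coordinate of the relation is a relation over unramified series,
        which descends to polynomials.\<close>
      have "(\<Sum>l<m. decimate m k ([:fps_X ^ l:] * T (\<Sum>i<d. kpoly (c (l, i)) * e i)))
          = emb_fps f1 * decimate m k A + emb_fps f2 * decimate m k B"
        using arg_cong[OF AB, of "decimate m k"] m k
        by (simp only: decimate_sum decimate_add T_def decimate_ramify_mult)
      also have "(\<Sum>l<m. decimate m k ([:fps_X ^ l:] * T (\<Sum>i<d. kpoly (c (l, i)) * e i)))
          = (\<Sum>l<m. if k = l then emb_fps (\<Sum>i<d. kpoly (c (l, i)) * e i) else 0)"
        unfolding T_def using m k by (intro sum.cong decimate_X_power_ramify) auto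
      also have "\<dots> = emb_fps (\<Sum>i<d. kpoly (c (k, i)) * e i)" using k by (simp add: sum.delta)
      finally have "emb_fps (\<Sum>i<d. kpoly (c (k, i)) * e i) \<in> ideal2 (emb_fps f1) (emb_fps f2)" by (simp only: ideal2I)
      hence "(\<Sum>i<d. kpoly (c (k, i)) * e i) \<in> ideal2 f1 f2" by (rule emb_fps_ideal2D[OF M])
      from quotient_basis_indep[OF e this] show ?thesis using i by simp
    qed
    thus "\<forall>i\<in>J. c i = 0" by (auto simp: J_def)
  qed
  from has_codimI[OF this] show ?thesis by (simp add: J_def T_def)
qed


section \<open>Existence and uniqueness of the solution\<close>

definition at_y :: "complex \<Rightarrow> complex poly poly \<Rightarrow> complex poly"
  where "at_y b p = map_poly (\<lambda>c. poly c b) p"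

lemma coeff_at_y [simp]: "coeff (at_y b p) i = poly (coeff p i) b"
  by (simp add: at_y_def coeff_map_poly)

lemma at_y_add: "at_y b (p + q) = at_y b p + at_y b q"
  by (rule poly_eqI) simp

lemma at_y_diff: "at_y b (p - q) = at_y b p - at_y b q"
  by (rule poly_eqI) simp

lemma at_y_mult: "at_y b (p * q) = at_y b p * at_y b q"
  unfolding at_y_def by (rule map_poly_mult_hom) simp_all

lemma at_y_const: "at_y b [:c:] = [:poly c b:]"
  by (rule poly_eqI) (auto simp: coeff_pCons split: nat.splits)

lemma poly_at_y: "poly (at_y b p) a = poly2 p (a, b)"
proof (induction p)
  case (pCons c p)
  have "at_y b (pCons c p) = pCons (poly c b) (at_y b p)"
    by (rule poly_eqI) (auto simp: coeff_pCons split: nat.splits)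
  thus ?case using pCons by (simp add: poly2_def)
qed (simp add: at_y_def poly2_def)

lemma at_y_eq_0D: "at_y b p = 0 \<Longrightarrow> \<exists>q. p = [:[:-b, 1:]:] * q"
proof -
  assume "at_y b p = 0"
  hence "poly (coeff p i) b = 0" for i by (metis coeff_at_y coeff_0)
  hence "[:-b, 1:] dvd coeff p i" for i by (simp add: poly_eq_0_iff_dvd)
  hence "[:[:-b, 1:]:] dvd p" by (simp add: const_poly_dvd_iff)
  thus ?thesis unfolding dvd_def .
qed

lemma at_y_monic_neq_0:
  assumes "lead_coeff f = 1" shows "at_y b f \<noteq> 0"
proof
  assume "at_y b f = 0"
  hence "coeff (at_y b f) (degree f) = 0" by simp
  thus False using assms by (simp only: coeff_at_y poly_1) simp
qed

lemma ex_at_y: "\<exists>q'. at_y b q' = q"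
proof -
  have "at_y b (map_poly (\<lambda>c. [:c:]) q) = q"
    by (rule poly_eqI) (simp add: coeff_map_poly)
  thus ?thesis by blast
qed

text \<open>From the two equations c B = F (u B - v A). The left side has no terms of degree
  \<open>degree F\<close> or more, and no nonzero multiple of the monic \<open>F\<close> is of this
  kind.\<close>

lemma monic_pair_unique:
  fixes F G :: "'a::idom poly"
  assumes "lead_coeff F = 1" "[:c:] = F * u + G * v" "c \<noteq> 0"
    and "F * A + G * B = 0" "\<And>i. i \<ge> degree F \<Longrightarrow> coeff B i = 0"
  shows "A = 0 \<and> B = 0"
proof -
  have "[:c:] * B = F * (u * B - v * A) + v * (F * A + G * B)"
    unfolding assms(2) by (simp only: algebra_simps)
  hence *: "[:c:] * B = F * (u * B - v * A)" using assms(4) by simp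
  have "coeff (F * (u * B - v * A)) i = 0" if "i \<ge> degree F" for i
    unfolding *[symmetric] using assms(5)[OF that] by simp
  hence "u * B - v * A = 0" by (rule coeff_mult_monic_vanish[OF assms(1)])
  hence "B = 0" using * assms(3) by simp
  moreover have "F \<noteq> 0" using assms(1) by auto
  ultimately show ?thesis using assms(4) by simp
qed

text \<open>Only what survives reversal is assumed: the leading form x^n is weakened to being monic
  of degree n in x, because the leading form of a reversed polynomial is in general not x^n.\<close>

locale axis_pair =
  fixes f1 f2 :: "complex poly poly" and n :: nat
  assumes n_pos: "n > 0"
    and monic1: "lead_coeff f1 = 1" and monic2: "lead_coeff f2 = 1"
    and deg1: "degree f1 = n" and deg2: "degree f2 = n"
    and zeros: "\<And>a b. poly2 f1 (a, b) = 0 \<Longrightarrow> poly2 f2 (a, b) = 0 \<Longrightarrow> b = 0"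
begin

text \<open>In place of a resultant, take a nonzero \<open>h\<close> of least degree in x in the
  ideal. By minimality, pseudo-division of ideal elements by \<open>h\<close> leaves no remainder.
  If \<open>h\<close> involved x, a zero of \<open>h\<close> at some y0 \<noteq> 0 where its leading
  coefficient does not vanish would be a common zero off the axis.\<close>

lemma ex_const_in_ideal: "\<exists>R. R \<noteq> 0 \<and> [:R:] \<in> ideal2 f1 f2"
proof -
  define P where "P = (\<lambda>k. \<exists>h\<in>ideal2 f1 f2. h \<noteq> 0 \<and> degree h = k)"
  have f: "f1 \<in> ideal2 f1 f2" "f2 \<in> ideal2 f1 f2"
    using ideal2I[of f1 1 f2 0] ideal2I[of f1 0 f2 1] by simp_all
  have "f1 \<noteq> 0" using monic1 by auto
  hence "P n" using f deg1 unfolding P_def by blast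
  hence "P (LEAST k. P k)" by (rule LeastI)
  then obtain h where h: "h \<in> ideal2 f1 f2" "h \<noteq> 0" "degree h = (LEAST k. P k)"
    unfolding P_def by blast
  show ?thesis
  proof (cases "degree h = 0")
    case True
    then obtain R where "h = [:R:]" by (rule degree_eq_zeroE)
    thus ?thesis using h by auto
  next
    case False
    have div: "\<exists>q k. [:lead_coeff h ^ k:] * f = h * q" if fI: "f \<in> ideal2 f1 f2" for f
    proof -
      obtain q r where qr: "pseudo_divmod f h = (q, r)" by fastforce
      define k where "k = Suc (degree f) - degree h"
      have eq: "[:lead_coeff h ^ k:] * f = h * q + r"
        using pseudo_divmod(1)[OF h(2) qr] by (simp add: k_def)
      have "r = [:lead_coeff h ^ k:] * f - q * h" unfolding eq by simp
      hence "r \<in> ideal2 f1 f2" by (simp only: ideal2_diff ideal2_mult fI h(1))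
      moreover have "r = 0 \<or> degree r < degree h" using pseudo_divmod(2)[OF h(2) qr] .
      ultimately have "r = 0" using h(3) not_less_Least[of "degree r" P] unfolding P_def by auto
      thus ?thesis using eq by auto
    qed
    have "finite (insert 0 {y. poly (lead_coeff h) y = 0})"
      using h(2) by (simp add: poly_roots_finite)
    then obtain y0 where y0: "y0 \<noteq> 0" "poly (lead_coeff h) y0 \<noteq> 0"
      using ex_new_if_finite[OF infinite_UNIV_char_0] by blast
    have "coeff (at_y y0 h) (degree h) \<noteq> 0" using y0(2) by simp
    hence "degree h \<le> degree (at_y y0 h)" by (rule le_degree)
    hence "degree (at_y y0 h) > 0" using False by simp
    hence "\<not> constant (poly (at_y y0 h))" by (simp add: constant_degree)
    then obtain x0 where x0: "poly (at_y y0 h) x0 = 0" using fundamental_theorem_of_algebra by blast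
    have "poly2 f (x0, y0) = 0" if fI: "f \<in> ideal2 f1 f2" for f
    proof -
      obtain q k where "[:lead_coeff h ^ k:] * f = h * q" using div[OF fI] by blast
      hence "at_y y0 [:lead_coeff h ^ k:] * at_y y0 f = at_y y0 h * at_y y0 q"
        by (simp only: at_y_mult[symmetric])
      hence "poly (at_y y0 [:lead_coeff h ^ k:]) x0 * poly (at_y y0 f) x0 = 0"
        using x0 by (simp only: poly_mult[symmetric]) simp
      thus ?thesis using y0(2) by (simp add: at_y_const poly_at_y)
    qed
    hence "y0 = 0" using f zeros by blast
    thus ?thesis using y0 by simp
  qed
qed

lemma coprime_at_y:
  assumes "b \<noteq> 0" shows "coprime (at_y b f1) (at_y b f2)"
proof (rule ccontr)
  assume nc: "\<not> coprime (at_y b f1) (at_y b f2)"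
  have nz: "at_y b f1 \<noteq> 0" using monic1 by (rule at_y_monic_neq_0)
  define g where "g = gcd (at_y b f1) (at_y b f2)"
  have "g \<noteq> 0" using nz by (simp add: g_def)
  have "\<not> is_unit g" using nc by (simp add: g_def coprime_iff_gcd_eq_1 is_unit_gcd_iff)
  hence "degree g > 0" using \<open>g \<noteq> 0\<close> is_unit_iff_degree by blast
  hence "\<not> constant (poly g)" by (simp add: constant_degree)
  then obtain x0 where "poly g x0 = 0" using fundamental_theorem_of_algebra by blast
  moreover have "g dvd at_y b f1" "g dvd at_y b f2" by (simp_all add: g_def)
  ultimately have "poly2 f1 (x0, b) = 0" "poly2 f2 (x0, b) = 0"
    by (auto simp: poly_at_y[symmetric] elim!: dvdE)
  thus False using zeros assms by blast
qed

text \<open>If \<open>R(y)\<close> lies in the ideal and \<open>R\<close> has a root \<open>y\<^sub>0 \<noteq> 0\<close>, then \<open>R / (y - y\<^sub>0)\<close> lies in the ideal as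
  well, since \<open>f\<^sub>1\<close> and \<open>f\<^sub>2\<close> are coprime on the line \<open>y = y\<^sub>0\<close>.\<close>
lemma ex_varY_power_in_ideal: "\<exists>M. varY ^ M \<in> ideal2 f1 f2"
proof -
  define P where "P = (\<lambda>k. \<exists>R. R \<noteq> 0 \<and> [:R:] \<in> ideal2 f1 f2 \<and> degree R = k)"
  have "\<exists>k. P k" using ex_const_in_ideal unfolding P_def by blast
  hence "P (LEAST k. P k)" by (rule LeastI_ex)
  then obtain R where R: "R \<noteq> 0" "[:R:] \<in> ideal2 f1 f2" "degree R = (LEAST k. P k)"
    unfolding P_def by blast
  have root0: "y = 0" if y: "poly R y = 0" for y
  proof (rule ccontr)
    assume "y \<noteq> 0"
    obtain R' where R': "R = [:-y, 1:] * R'" using y unfolding poly_eq_0_iff_dvd by (rule dvdE)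
    have "R' \<noteq> 0" using R R' by auto
    obtain u v where uv: "[:R:] = f1 * u + f2 * v" using R(2) by (auto simp: ideal2_def)
    have "at_y y [:R:] = at_y y f1 * at_y y u + at_y y f2 * at_y y v"
      unfolding uv by (simp only: at_y_mult at_y_add)
    hence eq: "at_y y f1 * at_y y u + at_y y f2 * at_y y v = 0" using y by (simp add: at_y_const)
    hence "at_y y f2 dvd at_y y f1 * at_y y u"
      by (metis add.commute add_eq_0_iff dvd_minus_iff dvd_triv_left)
    \<comment> \<open>On the line, the relation f1 u + f2 v = 0 between coprime polynomials is a
      multiple of the trivial one with multipliers f2 and -f1. Subtracting a lift of it makes both
      multipliers divisible by the linear factor.\<close>
    hence "at_y y f2 dvd at_y y u"
      using coprime_at_y[OF \<open>y \<noteq> 0\<close>] by (simp add: coprime_dvd_mult_right_iff coprime_commute)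
    then obtain q where q: "at_y y u = at_y y f2 * q" by (rule dvdE)
    have nz: "at_y y f2 \<noteq> 0" using monic2 by (rule at_y_monic_neq_0)
    have "at_y y f2 * (at_y y f1 * q + at_y y v) = 0" using eq unfolding q by (simp add: algebra_simps)
    hence v: "at_y y f1 * q + at_y y v = 0" using nz by simp
    obtain q' where q': "at_y y q' = q" using ex_at_y by blast
    have "at_y y (u - f2 * q') = 0"
      unfolding at_y_diff at_y_mult q q' by simp
    then obtain u' where u': "u - f2 * q' = [:[:-y, 1:]:] * u'" using at_y_eq_0D by blast
    have "at_y y (v + f1 * q') = 0"
      using v q' by (simp add: at_y_add at_y_mult add.commute)
    then obtain v' where v': "v + f1 * q' = [:[:-y, 1:]:] * v'" using at_y_eq_0D by blast
    have "[:R:] = f1 * (u - f2 * q') + f2 * (v + f1 * q')"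
      unfolding uv by (simp add: algebra_simps)
    also have "\<dots> = [:[:-y, 1:]:] * (f1 * u' + f2 * v')"
      unfolding u' v' by (simp only: algebra_simps)
    also have "[:R:] = [:[:-y, 1:]:] * [:R':]" unfolding R' by simp
    finally have "[:[:-y, 1:]:] * [:R':] = [:[:-y, 1:]:] * (f1 * u' + f2 * v')" .
    hence "[:R':] = f1 * u' + f2 * v'" by (subst (asm) mult_left_cancel) simp_all
    hence "P (degree R')" using \<open>R' \<noteq> 0\<close> unfolding P_def by (metis ideal2I)
    hence "degree R \<le> degree R'" unfolding R(3) by (rule Least_le)
    moreover have "degree R = Suc (degree R')" unfolding R' using \<open>R' \<noteq> 0\<close> by (subst degree_mult_eq) auto
    ultimately show False by simp
  qed
  define k where "k = order 0 R"
  obtain h where h: "R = [:0, 1:] ^ k * h" "\<not> [:0, 1:] dvd h"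
    using order_decomp[OF R(1), of 0] by (auto simp: k_def)
  have "poly h z \<noteq> 0" for z
  proof
    assume z: "poly h z = 0"
    hence "poly R z = 0" by (simp add: h)
    hence "z = 0" by (rule root0)
    thus False using h(2) z poly_eq_0_iff_dvd[of h 0] by simp
  qed
  hence "degree h = 0" using fundamental_theorem_of_algebra constant_degree by blast
  then obtain c where c: "h = [:c:]" by (rule degree_eq_zeroE)
  have "c \<noteq> 0" using R(1) h c by auto
  have "[:R:] = kpoly c * varY ^ k"
    unfolding varY_power h c by (simp add: monom_altdef)
  hence "kpoly (1 / c) * [:R:] = varY ^ k" using \<open>c \<noteq> 0\<close> by (simp add: one_pCons[symmetric])
  thus ?thesis using ideal2_mult[OF R(2)] by metis
qed

text \<open>The monomials x^i y^j with i < n and j < M span: divide by the monic \<open>f1\<close>,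
  then drop multiples of y^M.\<close>

lemma ex_codim: "\<exists>d. has_codim kpoly (ideal2 f1 f2) d"
proof -
  obtain M where M: "varY ^ M \<in> ideal2 f1 f2" using ex_varY_power_in_ideal by blast
  define e where "e = (\<lambda>(i, j). monom (monom (1::complex) j) i)"
  show ?thesis
  proof (rule kpoly.codim_exists[OF ideal2_add ideal2_mult])
    show "finite ({..<n} \<times> {..<M})" by simp
    show "\<forall>v. \<exists>c. v - (\<Sum>i\<in>{..<n} \<times> {..<M}. kpoly (c i) * e i) \<in> ideal2 f1 f2"
    proof
      fix p
      obtain q r where qr: "p = f1 * q + r" "\<And>i. i \<ge> n \<Longrightarrow> coeff r i = 0"
        using monic_division[OF monic1] deg1 by blast
      define c where "c = (\<lambda>(i, j). coeff2 r i j)"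
      define s where "s = (\<Sum>ij\<in>{..<n} \<times> {..<M}. kpoly (c ij) * e ij)"
      have cs: "coeff (coeff s i) j = (if j < M then coeff2 r i j else 0)" for i j
      proof -
        have "s = (\<Sum>i<n. \<Sum>j<M. monom (monom (coeff2 r i j) j) i)"
          unfolding s_def sum.cartesian_product
          by (intro sum.cong) (auto simp: c_def e_def smult_monom)
        hence "coeff (coeff s i) j
            = (\<Sum>i'<n. \<Sum>j'<M. if i' = i \<and> j' = j then coeff2 r i' j' else 0)"
          by (simp add: coeff_sum) (intro sum.cong refl, auto)
        also have "\<dots> = (\<Sum>i'<n. if i' = i then (if j < M then coeff2 r i j else 0) else 0)"
          by (intro sum.cong refl) (auto simp: sum.delta)
        also have "\<dots> = (if j < M then coeff2 r i j else 0)"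
          using qr(2)[of i] by (auto simp: coeff2_def)
        finally show ?thesis .
      qed
      obtain t where "r - s = varY ^ M * t"
        using emb_fps_X_power_dvd[of M "r - s"] by (auto simp: cs coeff2_def)
      hence "p - s = f1 * q + f2 * 0 + t * varY ^ M" using qr(1) by (simp add: algebra_simps)
      hence "p - s \<in> ideal2 f1 f2" by (simp only: ideal2_add ideal2I ideal2_mult M)
      thus "\<exists>c. p - (\<Sum>i\<in>{..<n} \<times> {..<M}. kpoly (c i) * e i) \<in> ideal2 f1 f2" unfolding s_def by blast
    qed
  qed
qed

lemma solution_unique:
  assumes "f1 * A + f2 * B = f1 * A' + f2 * B'"
    and "\<And>i. i \<ge> n \<Longrightarrow> coeff B i = 0" "\<And>i. i \<ge> n \<Longrightarrow> coeff B' i = 0"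
  shows "A = A' \<and> B = B'"
proof -
  obtain M u v where M: "varY ^ M = f1 * u + f2 * v"
    using ex_varY_power_in_ideal by (auto simp: ideal2_def)
  have "f1 * (A - A') + f2 * (B - B') = 0" using assms(1) by (simp add: algebra_simps)
  from monic_pair_unique[OF monic1 M[unfolded varY_power] _ this]
  show ?thesis using assms(2,3) deg1 by simp
qed

text \<open>Bezout's identity solves the equation up to a factor \<open>y\<^sup>M\<close>. By uniqueness the image of this
  solution over \<open>\<complex>[[s]]\<close> is \<open>s\<^sup>m\<^sup>M\<close> times the one obtained from the roots, hence divisible by \<open>y\<^sup>M\<close>.\<close>
theorem ex_solution:
  "\<exists>g1 g2 d. varY * jacobian_det f1 f2 = f1 * g1 + f2 * g2 \<and> (\<forall>i\<ge>n. coeff g2 i = 0) \<and>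
     has_codim kpoly (ideal2 f1 f2) d \<and> coeff2 g2 (n - 1) 0 = of_nat d"
proof -
  define J where "J = jacobian_det f1 f2"
  obtain M u v where M: "varY ^ M = f1 * u + f2 * v"
    using ex_varY_power_in_ideal by (auto simp: ideal2_def)
  obtain d where d: "has_codim kpoly (ideal2 f1 f2) d" using ex_codim by blast
  have "lead_coeff (emb_fps f1) = 1" "lead_coeff (emb_fps f2) = 1"
    using monic1 monic2 by (simp_all add: degree_emb_fps)
  hence "splits (emb_fps f1)" "splits (emb_fps f2)" by (auto intro: monic_fps_poly_splits)
  then obtain m1 m2 as0 bs0 where split: "m1 > 0" "m2 > 0"
      "ramify m1 (emb_fps f1) = linprod as0" "ramify m2 (emb_fps f2) = linprod bs0"
    unfolding splits_def by blast
  define m where "m = m1 * m2"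
  define T where "T = (\<lambda>p. ramify m (emb_fps p))"
  have m: "m > 0" using split by (simp add: m_def)
  have T_mult: "T (p * q) = T p * T q" and T_add: "T (p + q) = T p + T q" for p q
    using m by (simp_all add: T_def emb_fps_mult emb_fps_add ramify_mult ramify_add)
  have cT: "fps_nth (coeff (T p) i) (m * j) = coeff2 p i j" for p i j
    using m by (simp add: T_def fps_nth_compose_X_power coeff2_def)
  have X0: "fps_nth (fps_X ^ m :: complex fps) 0 = 0" using m by simp
  have T_Y: "T (varY ^ k) = [:fps_X ^ (m * k):]" for k
    by (rule poly_eqI) (auto simp: T_def emb_fps_varY_power coeff_pCons fps_X_power_compose[OF X0] power_mult split: nat.splits)
  obtain as where as: "T f1 = linprod as"
    using split by (simp add: T_def m_def flip: ramify_ramify) (simp add: ramify_linprod)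
  have "T f2 = ramify m1 (ramify m2 (emb_fps f2))"
    unfolding T_def m_def ramify_ramify[OF split(1,2)] by (simp only: mult.commute)
  then obtain bs where bs: "T f2 = linprod bs"
    using split by (simp add: ramify_linprod)
  have len: "length as = n"
    using as degree_linprod[of as] m by (simp add: T_def degree_emb_fps deg1 flip: as)
  have TM: "[:fps_X ^ (m * M):] = linprod as * T u + linprod bs * T v"
    using M by (simp only: T_Y[symmetric] as[symmetric] bs[symmetric] T_mult T_add)
  \<comment> \<open>The two polynomials have no common root: there the combination in
    \<open>TM\<close> would vanish, but it equals s^(m M).\<close>
  have nz: "poly (linprod bs) a \<noteq> 0" if a: "a \<in> set as" for a
  proof
    assume "poly (linprod bs) a = 0"
    hence "poly [:fps_X ^ (m * M) :: complex fps:] a = 0"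
      unfolding TM by (simp add: poly_linprod_eq_0[OF a])
    thus False by simp
  qed
  obtain g1 g2 where g: "wronski (linprod as) (linprod bs) = linprod as * g1 + linprod bs * g2"
      "\<And>i. i \<ge> n \<Longrightarrow> coeff g2 i = 0"
      "fps_nth (coeff g2 (n - 1)) 0 = of_nat (\<Sum>a\<leftarrow>as. subdegree (poly (linprod bs) a))"
    using wronski_linprod[of as bs, OF nz] unfolding len by blast
  have "varY ^ M \<in> ideal2 f1 f2" unfolding M by (rule ideal2I)
  hence "has_codim kfps (ideal2 (T f1) (T f2)) (m * d)"
    unfolding T_def using d by (rule has_codim_ramify[OF m])
  hence codim: "has_codim kfps (ideal2 (linprod as) (linprod bs)) (m * d)"
    unfolding as bs .
  \<comment> \<open>The same codimension counted twice: from the roots, and by base change from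
    C[x,y].\<close>
  have sd: "(\<Sum>a\<leftarrow>as. subdegree (poly (linprod bs) a)) = m * d"
    using kfps.codim_le[OF ideal2_0 ideal2_add ideal2_mult has_codim_linprod[OF nz] codim]
      kfps.codim_le[OF ideal2_0 ideal2_add ideal2_mult codim has_codim_linprod[OF nz]] by simp
  define \<mu> :: "complex fps poly" where "\<mu> = [:of_nat m:]"
  have wr: "wronski (T f1) (T f2) = \<mu> * T (varY * J)"
  proof -
    have T_dx: "T (dx p) = pderiv (T p)" for p
      by (intro poly_eqI fps_ext)
         (simp add: dx_def T_def coeff_pderiv fps_nth_compose_X_power m of_nat_poly fps_of_nat[symmetric] del: of_nat_Suc fps_of_nat)
    have fps_X_deriv_nth: "fps_nth (fps_X * fps_deriv a) N = of_nat N * fps_nth a N" for a :: "complex fps" and N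
      by (cases N) auto
    have cY: "coeff (coeff (varY * dy p) i) j = of_nat j * coeff (coeff p i) j" for p i j
      by (cases j) (simp_all add: varY_def dy_def coeff_map_poly coeff_pderiv)
    have s: "seuler (T p) = \<mu> * T (varY * dy p)" for p
    proof (intro poly_eqI fps_ext)
      fix i N
      show "fps_nth (coeff (seuler (T p)) i) N = fps_nth (coeff (\<mu> * T (varY * dy p)) i) N"
        using m by (auto simp: T_def \<mu>_def fps_nth_compose_X_power fps_X_deriv_nth cY)
    qed
    have "\<mu> * T (varY * J) = T (dx f1) * (\<mu> * T (varY * dy f2)) - (\<mu> * T (varY * dy f1)) * T (dx f2)"
    proof -
      have "varY * J + (varY * dy f1) * dx f2 = dx f1 * (varY * dy f2)"
        unfolding J_def jacobian_det_def by (simp only: algebra_simps)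
      hence "T (varY * J) + T (varY * dy f1) * T (dx f2) = T (dx f1) * T (varY * dy f2)"
        by (simp only: T_mult[symmetric] T_add[symmetric])
      hence eq: "T (varY * J) = T (dx f1) * T (varY * dy f2) - T (varY * dy f1) * T (dx f2)"
        by (simp only: eq_diff_eq)
      show ?thesis unfolding eq by (simp only: algebra_simps)
    qed
    thus ?thesis by (simp only: wronski_def s T_dx)
  qed
  \<comment> \<open>Reducing modulo \<open>f1\<close> brings the second multiplier below degree n in
    x, as uniqueness demands.\<close>
  obtain q r where qr: "v * (varY * J) = f1 * q + r" "\<And>i. i \<ge> n \<Longrightarrow> coeff r i = 0"
    using monic_division[OF monic1] deg1 by blast
  define G1 where "G1 = u * (varY * J) + f2 * q"
  have "varY ^ M * (varY * J) = f1 * (u * (varY * J)) + f2 * (v * (varY * J))"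
    unfolding M by (simp only: algebra_simps)
  hence eqG: "varY ^ M * (varY * J) = f1 * G1 + f2 * r"
    unfolding qr(1) G1_def by (simp only: algebra_simps)
  define X :: "complex fps poly" where "X = [:fps_X ^ (m * M):]"
  have eqX: "X * T (varY * J) = linprod as * T G1 + linprod bs * T r"
    using arg_cong[OF eqG, of T] by (simp only: T_mult T_add T_Y as bs X_def)
  have "X * (\<mu> * T (varY * J)) = \<mu> * (X * T (varY * J))" by (rule mult.left_commute)
  also have "\<dots> = linprod as * (\<mu> * T G1) + linprod bs * (\<mu> * T r)"
    unfolding eqX by (simp only: distrib_left mult.left_commute)
  finally have "X * wronski (T f1) (T f2) = linprod as * (\<mu> * T G1) + linprod bs * (\<mu> * T r)"
    unfolding wr .
  hence "linprod as * (X * g1) + linprod bs * (X * g2) = linprod as * (\<mu> * T G1) + linprod bs * (\<mu> * T r)"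
    unfolding as bs g(1) by (simp only: distrib_left mult.left_commute)
  hence "linprod as * (\<mu> * T G1 - X * g1) + linprod bs * (\<mu> * T r - X * g2) = 0"
    by (simp add: algebra_simps)
  from monic_pair_unique[OF lead_coeff_linprod TM _ this]
  have G: "\<mu> * T G1 = X * g1" "\<mu> * T r = X * g2"
    using g(2) qr(2) len by (simp_all add: T_def \<mu>_def X_def)
  have cX: "of_nat m * coeff2 p i j = fps_nth (fps_X ^ (m * M) * coeff h i) (m * j)"
    if "\<mu> * T p = X * h" for p h i j
  proof -
    have "fps_nth (coeff (\<mu> * T p) i) (m * j) = of_nat m * coeff2 p i j"
      by (simp add: \<mu>_def cT[symmetric] fps_of_nat[symmetric] del: fps_of_nat)
    thus ?thesis unfolding that by (simp add: X_def)
  qed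
  \<comment> \<open>The coefficient of y^j in \<open>p\<close> is read off at s^(m j), and for j < M
    this exponent lies below the order m M of \<open>X\<close>.\<close>
  have dvd: "\<exists>p'. p = varY ^ M * p'" if p: "\<mu> * T p = X * h" for p h
  proof (rule emb_fps_X_power_dvd)
    fix i j assume "j < M"
    hence "of_nat m * coeff2 p i j = 0" unfolding cX[OF p] using m by (simp add: fps_X_power_mult_nth)
    thus "coeff (coeff p i) j = 0" using m by (simp add: coeff2_def)
  qed
  obtain \<gamma>1 where \<gamma>1: "G1 = varY ^ M * \<gamma>1" using dvd[OF G(1)] by blast
  obtain \<gamma>2 where \<gamma>2: "r = varY ^ M * \<gamma>2" using dvd[OF G(2)] by blast
  have Y0: "varY ^ M \<noteq> 0" by (simp add: varY_power)
  have "varY ^ M * (varY * J) = varY ^ M * (f1 * \<gamma>1 + f2 * \<gamma>2)"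
    unfolding eqG \<gamma>1 \<gamma>2 by (simp only: algebra_simps)
  hence sol: "varY * J = f1 * \<gamma>1 + f2 * \<gamma>2" by (rule iffD1[OF mult_left_cancel[OF Y0]])
  have deg: "coeff \<gamma>2 i = 0" if "i \<ge> n" for i
  proof -
    have "monom 1 M * coeff \<gamma>2 i = 0"
      using qr(2)[OF that] unfolding \<gamma>2 coeff_varY_power_mult .
    thus ?thesis by simp
  qed
  \<comment> \<open>Dividing by y^M moves the coefficient of y^M in \<open>r\<close> to the constant
    term, which on the series side is the constant term computed from the roots.\<close>
  have "of_nat m * coeff2 \<gamma>2 (n - 1) 0 = of_nat m * coeff2 r (n - 1) M"
    unfolding \<gamma>2 coeff2_def coeff_varY_power_mult by (simp add: coeff_monom_mult)
  also have "\<dots> = of_nat m * of_nat d"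
    unfolding cX[OF G(2)] using g(3) sd by (simp add: fps_X_power_mult_nth)
  finally have "coeff2 \<gamma>2 (n - 1) 0 = of_nat d" using m by simp
  thus ?thesis using sol deg d J_def by blast
qed

end


section \<open>The bound on the total degree\<close>

lemma coeff2_add [simp]: "coeff2 (p + q) i j = coeff2 p i j + coeff2 q i j"
  and coeff2_diff [simp]: "coeff2 (p - q) i j = coeff2 p i j - coeff2 q i j"
  and coeff2_0 [simp]: "coeff2 0 i j = 0"
  by (simp_all add: coeff2_def)

lemma poly2_eqI: "(\<And>i j. coeff2 p i j = coeff2 q i j) \<Longrightarrow> p = q"
  by (intro poly_eqI) (simp add: coeff2_def)

lemma finite_coeff2: "finite {(i, j). coeff2 p i j \<noteq> 0}"
proof (rule finite_subset)
  show "{(i, j). coeff2 p i j \<noteq> 0} \<subseteq> (SIGMA i:{..degree p}. {..degree (coeff p i)})"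
    unfolding coeff2_def by (auto intro!: le_degree)
qed auto

lemma total_degree_le_iff: "total_degree p \<le> K \<longleftrightarrow> (\<forall>i j. coeff2 p i j \<noteq> 0 \<longrightarrow> i + j \<le> K)"
proof -
  have "{i + j |i j. coeff2 p i j \<noteq> 0} = (\<lambda>(i, j). i + j) ` {(i, j). coeff2 p i j \<noteq> 0}" by auto
  hence "finite (insert 0 {i + j |i j. coeff2 p i j \<noteq> 0})" using finite_coeff2[of p] by simp
  thus ?thesis unfolding total_degree_def by (auto simp: Max_le_iff)
qed

lemma total_degree_leD: "total_degree p \<le> K \<Longrightarrow> i + j > K \<Longrightarrow> coeff2 p i j = 0"
  using total_degree_le_iff[of p K] by (meson not_le)

lemma total_degree_diff_le: "total_degree p \<le> K \<Longrightarrow> total_degree q \<le> K \<Longrightarrow> total_degree (p - q) \<le> K"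
  unfolding total_degree_le_iff by (metis coeff2_diff diff_0_right)

lemma coeff2_mult: "coeff2 (p * q) i j = (\<Sum>a\<le>i. \<Sum>b\<le>j. coeff2 p a b * coeff2 q (i - a) (j - b))"
  by (simp add: coeff2_def coeff_mult coeff_sum)

lemma total_degree_mult_le:
  assumes "total_degree p \<le> K" "total_degree q \<le> L"
  shows "total_degree (p * q) \<le> K + L"
  unfolding total_degree_le_iff
proof (intro allI impI, rule ccontr)
  fix i j assume nz: "coeff2 (p * q) i j \<noteq> 0" and "\<not> i + j \<le> K + L"
  have "coeff2 p a b * coeff2 q (i - a) (j - b) = 0" if "a \<le> i" "b \<le> j" for a b
  proof -
    have "a + b > K \<or> (i - a) + (j - b) > L" using that \<open>\<not> i + j \<le> K + L\<close> by arith
    thus ?thesis using total_degree_leD assms by auto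
  qed
  hence "coeff2 (p * q) i j = 0" unfolding coeff2_mult by (intro sum.neutral ballI) auto
  thus False using nz by simp
qed

lemma coeff2_dx: "coeff2 (dx p) i j = of_nat (Suc i) * coeff2 p (Suc i) j"
  by (simp add: dx_def coeff2_def coeff_pderiv of_nat_poly del: of_nat_Suc)

lemma coeff2_varY_mult: "coeff2 (varY * p) i j = (if j = 0 then 0 else coeff2 p i (j - 1))"
  by (cases j) (simp_all add: varY_def coeff2_def)

lemma coeff2_varX_mult: "coeff2 (varX * p) i j = (if i = 0 then 0 else coeff2 p (i - 1) j)"
  by (cases i) (simp_all add: varX_def coeff2_def)

lemma coeff2_varY_power_mult: "coeff2 (varY ^ e * p) i j = (if j < e then 0 else coeff2 p i (j - e))"
  by (simp add: coeff2_def coeff_varY_power_mult coeff_monom_mult)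

lemma coeff2_dy: "coeff2 (dy p) i j = of_nat (Suc j) * coeff2 p i (Suc j)"
  by (simp add: dy_def coeff2_def coeff_map_poly coeff_pderiv del: of_nat_Suc)

lemma coeff2_varY_dy: "coeff2 (varY * dy p) i j = of_nat j * coeff2 p i j"
  by (cases j) (simp_all add: coeff2_varY_mult coeff2_dy)

lemma coeff2_varX_dx: "coeff2 (varX * dx p) i j = of_nat i * coeff2 p i j"
  by (cases i) (simp_all add: coeff2_varX_mult coeff2_dx)

text \<open>\<open>reverse_at K\<close> is the substitution \<open>p \<mapsto> y\<^sup>K p(x/y, 1/y)\<close>, which moves the point
  \<open>[0:1:0]\<close> at infinity to the origin.\<close>
definition reverse_at :: "nat \<Rightarrow> complex poly poly \<Rightarrow> complex poly poly"
  where "reverse_at K p = (\<Sum>i\<le>K. monom (\<Sum>k\<le>K - i. monom (coeff2 p i (K - i - k)) k) i)"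

lemma coeff2_reverse_at: "coeff2 (reverse_at K p) i k = (if i + k \<le> K then coeff2 p i (K - i - k) else 0)"
proof -
  have "coeff2 (reverse_at K p) i k
      = coeff (if i \<le> K then \<Sum>k\<le>K - i. monom (coeff2 p i (K - i - k)) k else 0) k"
    unfolding coeff2_def reverse_at_def by (simp add: coeff_sum)
  thus ?thesis by (auto simp: coeff_sum)
qed

lemma reverse_at_diff: "reverse_at K (p - q) = reverse_at K p - reverse_at K q"
  by (rule poly2_eqI) (simp add: coeff2_reverse_at)

lemma reverse_at_add: "reverse_at K (p + q) = reverse_at K p + reverse_at K q"
  by (rule poly2_eqI) (simp add: coeff2_reverse_at)

lemma poly2_conv_sum:
  assumes "total_degree p \<le> K"
  shows "poly2 p (a, b) = (\<Sum>i\<le>K. \<Sum>j\<le>K - i. coeff2 p i j * a ^ i * b ^ j)"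
proof -
  have P: "poly q x = (\<Sum>i\<le>N. coeff q i * x ^ i)"
    if "\<And>i. i > N \<Longrightarrow> coeff q i = 0" for q :: "complex poly" and x N
  proof -
    have "degree q \<le> N" using that by (rule degree_le[rule_format]) auto
    hence "(\<Sum>i\<le>N. coeff q i * x ^ i) = (\<Sum>i\<le>degree q. coeff q i * x ^ i)"
      by (intro sum.mono_neutral_right) (auto simp: coeff_eq_0)
    thus ?thesis by (simp add: poly_altdef)
  qed
  have c0: "coeff (coeff p i) j = 0" if "i + j > K" for i j
    using total_degree_leD[OF assms that] by (simp add: coeff2_def)
  have "poly2 p (a, b) = (\<Sum>i\<le>K. coeff (at_y b p) i * a ^ i)"
    unfolding poly_at_y[symmetric]
  proof (rule P)
    fix i assume "i > K"
    hence "coeff p i = 0" by (intro poly_eqI) (simp add: c0)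
    thus "coeff (at_y b p) i = 0" by simp
  qed
  also have "\<dots> = (\<Sum>i\<le>K. (\<Sum>j\<le>K - i. coeff2 p i j * b ^ j) * a ^ i)"
    by (intro sum.cong refl) (simp, subst P[where N = "K - _"], auto simp: c0 coeff2_def)
  also have "\<dots> = (\<Sum>i\<le>K. \<Sum>j\<le>K - i. coeff2 p i j * a ^ i * b ^ j)"
    by (simp add: sum_distrib_left sum_distrib_right mult_ac)
  finally show ?thesis .
qed

lemma total_degree_reverse_at: "total_degree (reverse_at K p) \<le> K"
  unfolding total_degree_le_iff by (simp add: coeff2_reverse_at)

lemma poly2_reverse_at:
  assumes "total_degree p \<le> K" "w \<noteq> 0"
  shows "poly2 (reverse_at K p) (a, w) = w ^ K * poly2 p (a / w, 1 / w)"
proof -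
  have "poly2 (reverse_at K p) (a, w) = (\<Sum>i\<le>K. \<Sum>k\<le>K - i. coeff2 (reverse_at K p) i k * a ^ i * w ^ k)"
    by (rule poly2_conv_sum) (rule total_degree_reverse_at)
  also have "\<dots> = (\<Sum>i\<le>K. \<Sum>j\<le>K - i. coeff2 (reverse_at K p) i (K - i - j) * a ^ i * w ^ (K - i - j))"
  proof (rule sum.cong[OF refl])
    have rev: "sum g {..m} = (\<Sum>j\<le>m. g (m - j))" for g :: "nat \<Rightarrow> complex" and m
      using sum.atLeastAtMost_rev[of g 0 m] by (simp add: atLeast0AtMost)
    show "(\<Sum>k\<le>K - i. coeff2 (reverse_at K p) i k * a ^ i * w ^ k)
        = (\<Sum>j\<le>K - i. coeff2 (reverse_at K p) i (K - i - j) * a ^ i * w ^ (K - i - j))" for i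
      by (rule rev)
  qed
  also have "\<dots> = (\<Sum>i\<le>K. \<Sum>j\<le>K - i. w ^ K * (coeff2 p i j * (a / w) ^ i * (1 / w) ^ j))"
  proof (intro sum.cong refl)
    fix i j assume ij: "i \<in> {..K}" "j \<in> {..K - i}"
    hence "w ^ K = w ^ (K - i - j) * w ^ i * w ^ j" by (simp flip: power_add)
    thus "coeff2 (reverse_at K p) i (K - i - j) * a ^ i * w ^ (K - i - j)
        = w ^ K * (coeff2 p i j * (a / w) ^ i * (1 / w) ^ j)"
      using ij assms(2) by (simp add: coeff2_reverse_at power_divide)
  qed
  also have "\<dots> = w ^ K * poly2 p (a / w, 1 / w)"
    by (simp add: poly2_conv_sum[OF assms(1)] sum_distrib_left)
  finally show ?thesis .
qed

lemma poly2_mult: "poly2 (p * q) z = poly2 p z * poly2 q z"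
  and poly2_add: "poly2 (p + q) z = poly2 p z + poly2 q z"
  by (cases z; simp add: poly2_def)+

lemma poly2_eqI_off_axis:
  assumes "\<And>a w. w \<noteq> 0 \<Longrightarrow> poly2 p (a, w) = poly2 q (a, w)"
  shows "p = q"
proof (rule poly_eqI)
  fix i
  define r where "r = coeff p i - coeff q i"
  have "poly r w = 0" if "w \<noteq> 0" for w
  proof -
    have "poly (at_y w p) = poly (at_y w q)" using assms[OF that] by (auto simp: poly_at_y)
    hence "at_y w p = at_y w q" by (simp only: poly_eq_poly_eq_iff)
    hence "coeff (at_y w p) i = coeff (at_y w q) i" by simp
    thus ?thesis by (simp add: r_def)
  qed
  hence "UNIV - {0} \<subseteq> {w. poly r w = 0}" by auto
  moreover have "infinite (UNIV - {0 :: complex})" using infinite_UNIV_char_0 by simp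
  ultimately have "r = 0" using poly_roots_finite finite_subset by blast
  thus "coeff p i = coeff q i" by (simp add: r_def)
qed

lemma reverse_at_mult:
  assumes "total_degree p \<le> K" "total_degree q \<le> L"
  shows "reverse_at (K + L) (p * q) = reverse_at K p * reverse_at L q"
  by (rule poly2_eqI_off_axis)
     (simp add: poly2_reverse_at assms poly2_mult total_degree_mult_le power_add)

lemma reverse_at_dx:
  "n > 0 \<Longrightarrow> reverse_at (n - 1) (dx p) = dx (reverse_at n p)"
  by (rule poly2_eqI) (auto simp: coeff2_reverse_at coeff2_dx diff_diff_add)

text \<open>A monomial x^i y^j is reversed to x^i y^k with i + j + k = n, so the eigenvalue j of y
  d/dy becomes n - i - k.\<close>

lemma reverse_at_varY_dy:
  "reverse_at n (varY * dy p) = kpoly (of_nat n) * reverse_at n p - varX * dx (reverse_at n p) - varY * dy (reverse_at n p)"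
proof (rule poly2_eqI)
  fix i k
  have k: "coeff2 (kpoly c * q) i k = c * coeff2 q i k" for c q by (simp add: coeff2_def)
  show "coeff2 (reverse_at n (varY * dy p)) i k
    = coeff2 (kpoly (of_nat n) * reverse_at n p - varX * dx (reverse_at n p) - varY * dy (reverse_at n p)) i k"
    unfolding coeff2_diff k coeff2_varX_dx coeff2_varY_dy coeff2_reverse_at
    by (auto simp: of_nat_diff algebra_simps)
qed

lemma total_degree_dx_le: "total_degree p \<le> n \<Longrightarrow> total_degree (dx p) \<le> n - 1"
  unfolding total_degree_le_iff coeff2_dx by fastforce

lemma total_degree_varY_dy_le: "total_degree p \<le> n \<Longrightarrow> total_degree (varY * dy p) \<le> n"
  unfolding total_degree_le_iff coeff2_varY_dy by auto

lemma varY_jacobian: "varY * jacobian_det f1 f2 = dx f1 * (varY * dy f2) - dx f2 * (varY * dy f1)"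
  unfolding jacobian_det_def by (simp only: algebra_simps)

text \<open>The terms with x d/dx cancel in the determinant. What remains besides the expression y J
  for the reversed pair is a combination of \<open>F1\<close> and \<open>F2\<close>, so the reversed
  equation can again be treated in the ideal of these two.\<close>

lemma reverse_at_varY_jacobian:
  assumes "n > 0" "total_degree f1 \<le> n" "total_degree f2 \<le> n"
  defines "F1 \<equiv> reverse_at n f1" and "F2 \<equiv> reverse_at n f2"
  shows "reverse_at (n - 1 + n) (varY * jacobian_det f1 f2)
    = kpoly (of_nat n) * (dx F1 * F2 - dx F2 * F1) - varY * jacobian_det F1 F2"
proof -
  have "reverse_at (n - 1 + n) (varY * jacobian_det f1 f2)
      = dx F1 * (kpoly (of_nat n) * F2 - varX * dx F2 - varY * dy F2)
        - dx F2 * (kpoly (of_nat n) * F1 - varX * dx F1 - varY * dy F1)"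
    unfolding varY_jacobian reverse_at_diff F1_def F2_def
    by (simp only: reverse_at_mult total_degree_dx_le total_degree_varY_dy_le assms(2,3)
        reverse_at_dx[OF assms(1)] reverse_at_varY_dy)
  also have "\<dots> = kpoly (of_nat n) * (dx F1 * F2 - dx F2 * F1) - varY * jacobian_det F1 F2"
    unfolding varY_jacobian by (simp only: algebra_simps)
  finally show ?thesis .
qed

lemma reverse_at_add_degree:
  assumes "total_degree p \<le> K"
  shows "reverse_at (K + e) p = varY ^ e * reverse_at K p"
proof (rule poly2_eqI)
  fix i k
  show "coeff2 (reverse_at (K + e) p) i k = coeff2 (varY ^ e * reverse_at K p) i k"
    unfolding coeff2_varY_power_mult coeff2_reverse_at
    using total_degree_leD[OF assms, of i "K + e - i - k"] by (auto simp: add.commute)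
qed

context axis_pair
begin

text \<open>At (a, w) with w \<noteq> 0 the reversed pair vanishes only if the original pair
  vanishes at (a/w, 1/w), a point off the axis.\<close>

lemma axis_pair_reverse:
  assumes "total_degree f1 \<le> n" "total_degree f2 \<le> n"
  shows "axis_pair (reverse_at n f1) (reverse_at n f2) n"
proof -
  have *: "lead_coeff (reverse_at n f) = 1 \<and> degree (reverse_at n f) = n"
    if f: "lead_coeff f = 1" "degree f = n" for f
  proof -
    have c: "coeff (reverse_at n f) n = 1"
    proof (rule poly_eqI)
      fix k show "coeff (coeff (reverse_at n f) n) k = coeff 1 k"
        using coeff2_reverse_at[of n f n k] f by (auto simp: coeff2_def coeff_1)
    qed
    have "coeff (reverse_at n f) i = 0" if "i > n" for i
      by (rule poly_eqI) (use coeff2_reverse_at[of n f i] that in \<open>simp add: coeff2_def\<close>)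
    hence "degree (reverse_at n f) = n"
      by (intro antisym degree_le le_degree) (auto simp: c)
    thus ?thesis using c by simp
  qed
  show ?thesis
  proof
    fix a w assume z: "poly2 (reverse_at n f1) (a, w) = 0" "poly2 (reverse_at n f2) (a, w) = 0"
    show "w = 0"
    proof (rule ccontr)
      assume w: "w \<noteq> 0"
      hence "1 / w = 0" using z zeros[of "a / w" "1 / w"] by (simp add: poly2_reverse_at assms)
      thus False using w by simp
    qed
  qed (use *[OF monic1 deg1] *[OF monic2 deg2] n_pos in blast)+
qed

text \<open>Here \<open>e\<close> is an a priori excess over the bound \<open>n - 1\<close>. Reversing the equation and comparing with
  the solution for the reversed pair shows that the reversed \<open>g\<^sub>1\<close>, \<open>g\<^sub>2\<close> are divisible by \<open>y\<^sup>e\<close>.\<close>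
theorem ex_solution_total_degree:
  assumes td: "total_degree f1 \<le> n" "total_degree f2 \<le> n"
  shows "\<exists>g1 g2 d. total_degree g1 \<le> n - 1 \<and> total_degree g2 \<le> n - 1 \<and>
     varY * jacobian_det f1 f2 = f1 * g1 + f2 * g2 \<and>
     has_codim kpoly (ideal2 f1 f2) d \<and> coeff2 g2 (n - 1) 0 = of_nat d"
proof -
  obtain g1 g2 d where g: "varY * jacobian_det f1 f2 = f1 * g1 + f2 * g2"
      "\<And>i. i \<ge> n \<Longrightarrow> coeff g2 i = 0" and d: "has_codim kpoly (ideal2 f1 f2) d"
      "coeff2 g2 (n - 1) 0 = of_nat d"
    using ex_solution by blast
  define F1 F2 where "F1 = reverse_at n f1" and "F2 = reverse_at n f2"
  interpret F: axis_pair F1 F2 n unfolding F1_def F2_def by (rule axis_pair_reverse[OF td])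
  obtain G1 G2 where G: "varY * jacobian_det F1 F2 = F1 * G1 + F2 * G2"
      "\<And>i. i \<ge> n \<Longrightarrow> coeff G2 i = 0"
    using F.ex_solution by blast
  \<comment> \<open>A crude value; it only has to make both bounds below true.\<close>
  define e where "e = total_degree g1 + total_degree g2"
  have tdg: "total_degree g1 \<le> n - 1 + e" "total_degree g2 \<le> n - 1 + e" by (simp_all add: e_def)
  define H1 H2 where "H1 = reverse_at (n - 1 + e) g1" and "H2 = reverse_at (n - 1 + e) g2"
  define c where "c = kpoly (of_nat n)"
  have "total_degree (varY * jacobian_det f1 f2) \<le> n - 1 + n"
    unfolding varY_jacobian
    by (intro total_degree_diff_le total_degree_mult_le total_degree_dx_le total_degree_varY_dy_le td)
  hence "reverse_at (n - 1 + n + e) (varY * jacobian_det f1 f2)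
      = varY ^ e * reverse_at (n - 1 + n) (varY * jacobian_det f1 f2)"
    by (rule reverse_at_add_degree)
  also have "\<dots> = varY ^ e * (c * (dx F1 * F2 - dx F2 * F1) - (F1 * G1 + F2 * G2))"
    unfolding reverse_at_varY_jacobian[OF n_pos td] F1_def[symmetric] F2_def[symmetric] G(1) c_def ..
  also have "\<dots> = F1 * (varY ^ e * (0 - c * dx F2 - G1)) + F2 * (varY ^ e * (c * dx F1 - G2))"
    by (simp only: algebra_simps) simp
  finally have 1: "reverse_at (n - 1 + n + e) (varY * jacobian_det f1 f2) = \<dots>" .
  have "n - 1 + n + e = n + (n - 1 + e)" by simp
  hence 2: "reverse_at (n - 1 + n + e) (varY * jacobian_det f1 f2) = F1 * H1 + F2 * H2"
    unfolding g(1) reverse_at_add F1_def F2_def H1_def H2_def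
    by (simp only: reverse_at_mult td tdg)
  have vH2: "coeff H2 i = 0" if "i \<ge> n" for i
  proof (rule poly_eqI)
    fix k show "coeff (coeff H2 i) k = coeff 0 k"
      using coeff2_reverse_at[of "n - 1 + e" g2 i k] g(2)[OF that] by (auto simp: H2_def coeff2_def)
  qed
  have vR: "coeff (varY ^ e * (c * dx F1 - G2)) i = 0" if "i \<ge> n" for i
  proof -
    have "coeff F1 (Suc i) = 0" using that F.deg1 by (intro coeff_eq_0) simp
    thus ?thesis using G(2)[OF that] by (simp add: coeff_varY_power_mult c_def dx_def coeff_pderiv)
  qed
  have "H1 = varY ^ e * (0 - c * dx F2 - G1) \<and> H2 = varY ^ e * (c * dx F1 - G2)"
    by (rule F.solution_unique[OF trans[OF 2[symmetric] 1] vH2 vR])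
  hence H: "coeff2 H1 i k = 0" "coeff2 H2 i k = 0" if "k < e" for i k
    using that by (simp_all only: coeff2_varY_power_mult if_True)
  have bound: "total_degree g \<le> n - 1"
    if tdg: "total_degree g \<le> n - 1 + e" and H: "\<And>i k. k < e \<Longrightarrow> coeff2 (reverse_at (n - 1 + e) g) i k = 0" for g
    unfolding total_degree_le_iff
  proof (intro allI impI, rule ccontr)
    fix i j assume nz: "coeff2 g i j \<noteq> 0" and ij: "\<not> i + j \<le> n - 1"
    have le: "i + j \<le> n - 1 + e" using tdg nz unfolding total_degree_le_iff by blast
    \<comment> \<open>A monomial of total degree above n - 1 would be reversed to one whose exponent
      k of y is less than e.\<close>
    define k where "k = n - 1 + e - i - j"
    have "k < e" "i + k \<le> n - 1 + e" "n - 1 + e - i - k = j" using le ij by (auto simp: k_def)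
    thus False using H[of k i] nz by (simp add: coeff2_reverse_at)
  qed
  have "total_degree g1 \<le> n - 1" "total_degree g2 \<le> n - 1"
    using bound[OF tdg(1)] bound[OF tdg(2)] H unfolding H1_def H2_def by blast+
  thus ?thesis using g(1) d by blast
qed

end


section \<open>Decomposition into local contributions\<close>

definition ideal_plus :: "'a::comm_ring_1 set \<Rightarrow> 'a \<Rightarrow> 'a set"
  where "ideal_plus I \<xi> = {u + \<xi> * c | u c. u \<in> I}"

lemma ideal_plusI: "u \<in> I \<Longrightarrow> u + \<xi> * c \<in> ideal_plus I \<xi>"
  by (auto simp: ideal_plus_def)

context
  fixes I :: "'a::comm_ring_1 set"
  assumes I0: "0 \<in> I" and I_add: "\<And>u v. u \<in> I \<Longrightarrow> v \<in> I \<Longrightarrow> u + v \<in> I"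
    and I_mult: "\<And>u v. u \<in> I \<Longrightarrow> v * u \<in> I"
begin

lemma ideal_plus_gen: "\<xi> * c \<in> ideal_plus I \<xi>"
  using ideal_plusI[OF I0, of \<xi> c] by simp

lemma ideal_plus_incl: "u \<in> I \<Longrightarrow> u \<in> ideal_plus I \<xi>"
  using ideal_plusI[of u I \<xi> 0] by simp

lemma ideal_plus_add:
  assumes "u \<in> ideal_plus I \<xi>" "v \<in> ideal_plus I \<xi>"
  shows "u + v \<in> ideal_plus I \<xi>"
proof -
  obtain a b c d where "u = a + \<xi> * c" "a \<in> I" "v = b + \<xi> * d" "b \<in> I"
    using assms by (auto simp: ideal_plus_def)
  hence "u + v = (a + b) + \<xi> * (c + d)" "a + b \<in> I" by (simp_all add: algebra_simps I_add)
  thus ?thesis by (simp only: ideal_plusI)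
qed

lemma ideal_plus_mult:
  assumes "u \<in> ideal_plus I \<xi>"
  shows "v * u \<in> ideal_plus I \<xi>"
proof -
  obtain a c where "u = a + \<xi> * c" "a \<in> I"
    using assms by (auto simp: ideal_plus_def)
  hence "v * u = v * a + \<xi> * (v * c)" by (simp add: algebra_simps)
  moreover have "v * a \<in> I" using \<open>a \<in> I\<close> by (rule I_mult)
  ultimately show ?thesis by (simp only: ideal_plusI)
qed

lemma ideal_plus_cross:
  assumes "u \<in> ideal_plus I \<xi>" shows "\<eta> * b * u \<in> ideal_plus I (\<xi> * \<eta>)"
proof -
  obtain a c where u: "u = a + \<xi> * c" "a \<in> I"
    using assms by (auto simp: ideal_plus_def)
  have "\<eta> * b * u = \<eta> * b * a + (\<xi> * \<eta>) * (b * c)" unfolding u by (simp add: algebra_simps)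
  thus ?thesis using I_mult[OF u(2)] by (simp only: ideal_plusI)
qed

lemma ideal_plus_mult_subset: "u \<in> ideal_plus I (\<xi> * \<eta>) \<Longrightarrow> u \<in> ideal_plus I \<xi>"
  by (auto simp: ideal_plus_def mult.assoc)

text \<open>Chinese remainder theorem: \<open>\<eta> * \<beta>\<close> is 1 modulo
  \<open>\<xi>\<close> and 0 modulo \<open>\<eta>\<close>, and \<open>\<xi> * \<alpha>\<close> the
  other way round. The two bases multiplied by these elements combine to one.\<close>

lemma has_codim_comaximal:
  assumes \<kappa>: "scalar_embedding \<kappa>"
    and comax: "\<xi> * \<alpha> + \<eta> * \<beta> = 1"
    and "has_codim \<kappa> (ideal_plus I \<xi>) d" "has_codim \<kappa> (ideal_plus I \<eta>) d'"
  shows "has_codim \<kappa> (ideal_plus I (\<xi> * \<eta>)) (d + d')"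
proof -
  obtain e e' where e: "quotient_basis \<kappa> (ideal_plus I \<xi>) {..<d} e"
      "quotient_basis \<kappa> (ideal_plus I \<eta>) {..<d'} e'"
    using assms unfolding has_codim_def by blast
  define J where "J = {..<d} <+> {..<d'}"
  define b where "b = case_sum (\<lambda>i. \<eta> * \<beta> * e i) (\<lambda>j. \<xi> * \<alpha> * e' j)"
  have sumJ: "(\<Sum>i\<in>J. \<kappa> (c i) * b i)
      = \<eta> * \<beta> * (\<Sum>i<d. \<kappa> (c (Inl i)) * e i) + \<xi> * \<alpha> * (\<Sum>i<d'. \<kappa> (c (Inr i)) * e' i)" for c
    unfolding J_def by (simp add: sum.Plus b_def sum_distrib_left mult_ac)
  have "quotient_basis \<kappa> (ideal_plus I (\<xi> * \<eta>)) J b"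
    unfolding quotient_basis_def
  proof (intro conjI allI impI)
    show "finite J" by (simp add: J_def)
  next
    fix v
    obtain c where c: "v - (\<Sum>i<d. \<kappa> (c i) * e i) \<in> ideal_plus I \<xi>"
      using e(1) unfolding quotient_basis_def by blast
    obtain c' where c': "v - (\<Sum>i<d'. \<kappa> (c' i) * e' i) \<in> ideal_plus I \<eta>"
      using e(2) unfolding quotient_basis_def by blast
    have "v = (\<xi> * \<alpha> + \<eta> * \<beta>) * v" unfolding comax by simp
    hence "v - (\<Sum>i\<in>J. \<kappa> (case_sum c c' i) * b i)
       = \<eta> * \<beta> * (v - (\<Sum>i<d. \<kappa> (c i) * e i)) + \<xi> * \<alpha> * (v - (\<Sum>i<d'. \<kappa> (c' i) * e' i))"
      unfolding sumJ by (simp add: algebra_simps)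
    moreover have "\<dots> \<in> ideal_plus I (\<xi> * \<eta>)"
      using ideal_plus_cross[OF c, of \<eta> \<beta>] ideal_plus_cross[OF c', of \<xi> \<alpha>]
      by (intro ideal_plus_add) (simp_all only: mult.commute[of \<eta> \<xi>])
    ultimately show "\<exists>c. v - (\<Sum>i\<in>J. \<kappa> (c i) * b i) \<in> ideal_plus I (\<xi> * \<eta>)" by metis
  next
    fix c assume "(\<Sum>i\<in>J. \<kappa> (c i) * b i) \<in> ideal_plus I (\<xi> * \<eta>)"
    hence w: "\<eta> * \<beta> * (\<Sum>i<d. \<kappa> (c (Inl i)) * e i) + \<xi> * \<alpha> * (\<Sum>i<d'. \<kappa> (c (Inr i)) * e' i)
        \<in> ideal_plus I (\<xi> * \<eta>)" (is "\<eta> * \<beta> * ?s + \<xi> * \<alpha> * ?t \<in> _") unfolding sumJ .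
    \<comment> \<open>Modulo \<open>\<xi>\<close> the whole combination is \<open>?s\<close>, and
      modulo \<open>\<eta>\<close> it is \<open>?t\<close>.\<close>
    have "?s = (\<xi> * \<alpha> + \<eta> * \<beta>) * ?s" "?t = (\<xi> * \<alpha> + \<eta> * \<beta>) * ?t" unfolding comax by simp_all
    hence st: "?s = (\<eta> * \<beta> * ?s + \<xi> * \<alpha> * ?t) + \<xi> * (\<alpha> * (?s - ?t))"
        "?t = (\<eta> * \<beta> * ?s + \<xi> * \<alpha> * ?t) + \<eta> * (\<beta> * (?t - ?s))"
      by (simp_all add: algebra_simps)
    have "?s \<in> ideal_plus I \<xi>"
      by (subst st(1)) (rule ideal_plus_add[OF ideal_plus_mult_subset[OF w] ideal_plus_gen])
    moreover have "?t \<in> ideal_plus I \<eta>"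
      by (subst st(2))
         (rule ideal_plus_add[OF ideal_plus_mult_subset[OF w[unfolded mult.commute[of \<xi> \<eta>]]] ideal_plus_gen])
    ultimately show "\<forall>i\<in>J. c i = 0"
      using quotient_basis_indep[OF e(1), of "\<lambda>i. c (Inl i)"] quotient_basis_indep[OF e(2), of "\<lambda>i. c (Inr i)"]
      by (auto simp: J_def)
  qed
  from has_codimI[OF this] show ?thesis by (simp add: J_def card_Plus)
qed

lemma has_codim_prod:
  assumes \<kappa>: "scalar_embedding \<kappa>" and "finite S"
    and comax: "\<And>a b. a \<in> S \<Longrightarrow> b \<in> S \<Longrightarrow> a \<noteq> b \<Longrightarrow> \<exists>\<alpha> \<beta>. \<xi> a * \<alpha> + \<xi> b * \<beta> = 1"
    and "\<And>a. a \<in> S \<Longrightarrow> has_codim \<kappa> (ideal_plus I (\<xi> a)) (d a)"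
  shows "has_codim \<kappa> (ideal_plus I (\<Prod>a\<in>S. \<xi> a)) (\<Sum>a\<in>S. d a)"
  using assms(2-)
proof (induction S rule: finite_induct)
  case empty
  have "v \<in> ideal_plus I 1" for v using ideal_plus_gen[of 1 v] by simp
  thus ?case unfolding has_codim_def quotient_basis_def by simp
next
  case (insert a S)
  note cm = insert.prems(1) and notin = insert.hyps(2)
  \<comment> \<open>Comaximality passes to products by multiplying two Bezout identities.\<close>
  have "\<exists>\<alpha> \<beta>. \<xi> a * \<alpha> + (\<Prod>b\<in>T. \<xi> b) * \<beta> = 1" if "finite T" "T \<subseteq> S" for T
    using that
  proof (induction T rule: finite_induct)
    case empty
    show ?case by (intro exI[of _ 0] exI[of _ 1]) simp
  next
    case (insert b T)
    then obtain \<alpha> \<beta> where 1: "\<xi> a * \<alpha> + (\<Prod>b\<in>T. \<xi> b) * \<beta> = 1" by auto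
    have "a \<noteq> b" using insert.prems notin by auto
    then obtain \<gamma> \<delta> where 2: "\<xi> a * \<gamma> + \<xi> b * \<delta> = 1" using cm[of a b] insert.prems by auto
    have "1 = (\<xi> a * \<alpha> + (\<Prod>b\<in>T. \<xi> b) * \<beta>) * (\<xi> a * \<gamma> + \<xi> b * \<delta>)" unfolding 1 2 by simp
    also have "\<dots> = \<xi> a * (\<alpha> * (\<xi> a * \<gamma> + \<xi> b * \<delta>) + (\<Prod>b\<in>T. \<xi> b) * \<beta> * \<gamma>) + (\<xi> b * (\<Prod>b\<in>T. \<xi> b)) * (\<beta> * \<delta>)"
      by (simp only: algebra_simps)
    finally show ?case using insert.hyps by (metis prod.insert)
  qed
  from this[OF insert.hyps(1)] obtain \<alpha> \<beta> where "\<xi> a * \<alpha> + (\<Prod>b\<in>S. \<xi> b) * \<beta> = 1" by auto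
  from has_codim_comaximal[OF \<kappa> this insert.prems(2)[of a]] insert show ?case by simp
qed

lemma ideal_plus_absorb: "\<xi> \<in> I \<Longrightarrow> ideal_plus I \<xi> = I"
proof (intro equalityI subsetI)
  fix u assume \<xi>: "\<xi> \<in> I" and "u \<in> ideal_plus I \<xi>"
  then obtain a c where "u = a + c * \<xi>" "a \<in> I" by (auto simp: ideal_plus_def mult.commute)
  thus "u \<in> I" using I_add I_mult[OF \<xi>] by simp
qed (rule ideal_plus_incl)

lemma power_add_mem:
  assumes "i \<in> I" shows "\<exists>u\<in>I. (i + b) ^ k = u + b ^ k"
proof (induction k)
  case 0 show ?case using I0 by (intro bexI[of _ 0]) simp_all
next
  case (Suc k)
  then obtain u where u: "u \<in> I" "(i + b) ^ k = u + b ^ k" by blast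
  have "(i + b) ^ Suc k = ((i + b) * u + b ^ k * i) + b ^ Suc k"
    unfolding power_Suc u(2) by (simp add: algebra_simps)
  thus ?case using I_add[OF I_mult[OF u(1)] I_mult[OF assms]] by blast
qed

end

section \<open>Powers of x - a at the common zeros\<close>

definition const_y :: "complex poly \<Rightarrow> complex poly poly"
  where "const_y p = map_poly (\<lambda>c. [:c:]) p"

lemma coeff_const_y [simp]: "coeff (const_y p) i = [:coeff p i:]"
  by (simp add: const_y_def coeff_map_poly)

lemma const_y_mult: "const_y (p * q) = const_y p * const_y q"
  unfolding const_y_def by (rule map_poly_mult_hom) simp_all

lemma const_y_1 [simp]: "const_y 1 = 1"
  by (rule poly_eqI) (simp add: coeff_1)

lemma const_y_add: "const_y (p + q) = const_y p + const_y q"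
  by (rule poly_eqI) simp

lemma const_y_power: "const_y (p ^ k) = const_y p ^ k"
  by (induction k) (simp_all add: const_y_mult)

lemma const_y_prod: "const_y (prod f A) = (\<Prod>x\<in>A. const_y (f x))"
  by (induction A rule: infinite_finite_induct) (simp_all add: const_y_mult)

lemma at_y_const_y [simp]: "at_y b (const_y p) = p"
  by (rule poly_eqI) simp

definition lin_x :: "complex \<Rightarrow> complex poly poly"
  where "lin_x a = const_y [:-a, 1:]"

lemma lin_x_comaximal:
  assumes "a \<noteq> b" shows "\<exists>\<alpha> \<beta>. lin_x a ^ K * \<alpha> + lin_x b ^ K * \<beta> = 1"
proof -
  have "coprime [:-a, 1:] [:-b, 1:]"
  proof (rule prime_elem_imp_coprime)
    show "\<not> [:-a, 1:] dvd [:-b, 1:]" using assms by (simp add: poly_eq_0_iff_dvd[symmetric])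
  qed (simp add: prime_elem_linear_field_poly)
  hence "coprime ([:-a, 1:] ^ K) ([:-b, 1:] ^ K)" by simp
  hence gcd: "gcd ([:-a, 1:] ^ K) ([:-b, 1:] ^ K) = 1" by (rule coprime_imp_gcd_eq_1)
  obtain u v where "u * [:-a, 1:] ^ K + v * [:-b, 1:] ^ K = 1"
    using bezout_coefficients_fst_snd[of "[:-a, 1:] ^ K" "[:-b, 1:] ^ K"] unfolding gcd by metis
  from arg_cong[OF this, of const_y] show ?thesis
    unfolding lin_x_def const_y_add const_y_mult const_y_power const_y_1 by (metis mult.commute)
qed

context axis_pair
begin

definition zero_set :: "complex set"
  where "zero_set = {a. poly2 f1 (a, 0) = 0 \<and> poly2 f2 (a, 0) = 0}"

lemma finite_zero_set: "finite zero_set"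
proof (rule finite_subset)
  show "zero_set \<subseteq> {a. poly (at_y 0 f1) a = 0}" by (auto simp: zero_set_def poly_at_y)
  show "finite {a. poly (at_y 0 f1) a = 0}" by (intro poly_roots_finite at_y_monic_neq_0 monic1)
qed

lemma common_zeros_eq: "common_zeros f1 f2 = (\<lambda>a. (a, 0)) ` zero_set"
  using zeros by (auto simp: common_zeros_def zero_set_def)

text \<open>On y = 0 the two polynomials generate the ideal of their gcd g. So g(x) lies in the
  ideal up to a multiple of y, and g(x)^M lies in the ideal itself because y^M does. All roots of g
  belong to \<open>zero_set\<close>, hence g^M divides a power of the product of the x - a.\<close>

lemma ex_prod_lin_x_in_ideal: "\<exists>K. (\<Prod>a\<in>zero_set. lin_x a ^ K) \<in> ideal2 f1 f2"
proof -
  obtain M where M: "varY ^ M \<in> ideal2 f1 f2" using ex_varY_power_in_ideal by blast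
  define g where "g = gcd (at_y 0 f1) (at_y 0 f2)"
  have g0: "g \<noteq> 0" using at_y_monic_neq_0[OF monic1] by (simp add: g_def)
  obtain s t where st: "s * at_y 0 f1 + t * at_y 0 f2 = g"
    using bezout_coefficients_fst_snd[of "at_y 0 f1" "at_y 0 f2"] unfolding g_def by metis
  define i where "i = f1 * const_y s + f2 * const_y t"
  have iI: "i \<in> ideal2 f1 f2" unfolding i_def by (rule ideal2I)
  have "at_y 0 (const_y g - i) = 0"
    unfolding at_y_diff i_def at_y_add at_y_mult at_y_const_y st[symmetric] by (simp add: mult.commute)
  then obtain q where q: "const_y g - i = varY * q" using at_y_eq_0D by (fastforce simp: varY_def)
  have "const_y g = i + varY * q" using q by (simp add: algebra_simps)
  moreover obtain u where "u \<in> ideal2 f1 f2" "(i + varY * q) ^ M = u + (varY * q) ^ M"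
    using power_add_mem[OF ideal2_0 ideal2_add ideal2_mult iI] by blast
  moreover have "(varY * q) ^ M \<in> ideal2 f1 f2"
    using ideal2_mult[OF M, of "q ^ M"] by (simp only: power_mult_distrib mult.commute)
  ultimately have gI: "const_y g ^ M \<in> ideal2 f1 f2" by (metis ideal2_add)
  have rootsZ: "a \<in> zero_set" if "poly g a = 0" for a
  proof -
    have "g dvd at_y 0 f1" "g dvd at_y 0 f2" by (simp_all add: g_def)
    thus ?thesis using that by (auto simp: zero_set_def poly_at_y[symmetric] elim!: dvdE)
  qed
  \<comment> \<open>Every root of g^M has order at most this number.\<close>
  define K where "K = M * degree g"
  have "g ^ M dvd (\<Prod>a\<in>zero_set. [:-a, 1:] ^ K)"
  proof -
    have dec: "smult (lead_coeff g) (\<Prod>z | poly g z = 0. [:-z, 1:] ^ order z g) = g"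
      by (rule complex_poly_decompose)
    have "(\<Prod>z | poly g z = 0. [:-z, 1:] ^ order z g) ^ M
        = (\<Prod>z | poly g z = 0. [:-z, 1:] ^ (order z g * M))"
      by (simp add: prod_power_distrib power_mult)
    also have "\<dots> dvd (\<Prod>z | poly g z = 0. [:-z, 1:] ^ K)"
    proof (intro prod_dvd_prod le_imp_power_dvd)
      fix z show "order z g * M \<le> K"
        using order_degree[OF g0, of z] by (simp add: K_def)
    qed
    also have "\<dots> dvd (\<Prod>a\<in>zero_set. [:-a, 1:] ^ K)"
      using rootsZ by (intro prod_dvd_prod_subset finite_zero_set) auto
    finally show ?thesis
      using g0 by (subst dec[symmetric]) (simp add: smult_power smult_dvd_iff)
  qed
  then obtain h where "(\<Prod>a\<in>zero_set. [:-a, 1:] ^ K) = h * g ^ M" by (metis dvdE mult.commute)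
  hence "const_y (\<Prod>a\<in>zero_set. [:-a, 1:] ^ K) = const_y h * const_y g ^ M"
    by (simp only: const_y_mult const_y_power)
  hence "(\<Prod>a\<in>zero_set. lin_x a ^ K) = const_y h * const_y g ^ M"
    by (simp only: const_y_prod const_y_power lin_x_def)
  thus ?thesis using ideal2_mult[OF gI] by metis
qed

text \<open>The product of the (x - a)^K already lies in the ideal, so adjoining it changes nothing,
  while comaximality splits the codimension into the contributions of the single (x - a)^K.\<close>

lemma codim_eq_sum:
  assumes d: "has_codim kpoly (ideal2 f1 f2) d" and K: "(\<Prod>a\<in>zero_set. lin_x a ^ K) \<in> ideal2 f1 f2"
  shows "\<exists>D. (\<forall>a\<in>zero_set. has_codim kpoly (ideal_plus (ideal2 f1 f2) (lin_x a ^ K)) (D a)) \<and>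
     d = (\<Sum>a\<in>zero_set. D a)"
proof -
  note I = ideal2_0[of f1 f2] ideal2_add[of _ f1 f2] ideal2_mult[of _ f1 f2]
  obtain e where e: "quotient_basis kpoly (ideal2 f1 f2) {..<d} e"
    using d unfolding has_codim_def by blast
  have "\<exists>d'. has_codim kpoly (ideal_plus (ideal2 f1 f2) (lin_x a ^ K)) d'" for a
  proof (rule kpoly.codim_exists)
    show "\<forall>v. \<exists>c. v - (\<Sum>i<d. kpoly (c i) * e i) \<in> ideal_plus (ideal2 f1 f2) (lin_x a ^ K)"
      using e ideal_plus_incl[OF I] unfolding quotient_basis_def by blast
  qed (auto intro: ideal_plus_add[OF I] ideal_plus_mult[OF I])
  then obtain D where D: "\<And>a. has_codim kpoly (ideal_plus (ideal2 f1 f2) (lin_x a ^ K)) (D a)" by metis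
  have "has_codim kpoly (ideal_plus (ideal2 f1 f2) (\<Prod>a\<in>zero_set. lin_x a ^ K)) (\<Sum>a\<in>zero_set. D a)"
    by (rule has_codim_prod[OF I kpoly.scalar_embedding_axioms finite_zero_set lin_x_comaximal D])
  hence S: "has_codim kpoly (ideal2 f1 f2) (\<Sum>a\<in>zero_set. D a)"
    by (simp only: ideal_plus_absorb[OF I K])
  have "d = (\<Sum>a\<in>zero_set. D a)"
    using kpoly.codim_le[OF I d S] kpoly.codim_le[OF I S d] by simp
  thus ?thesis using D by blast
qed

end


section \<open>Germs in two variables\<close>

definition hol_at :: "(complex \<times> complex \<Rightarrow> complex) \<Rightarrow> complex \<times> complex \<Rightarrow> bool"
  where "hol_at F z \<longleftrightarrow> (\<exists>a b. (F has_derivative (\<lambda>v. a * fst v + b * snd v)) (at z))"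

lemma holomorphic_near_iff: "holomorphic_near p F \<longleftrightarrow> (\<forall>\<^sub>F z in nhds p. hol_at F z)"
  unfolding holomorphic_near_def eventually_nhds hol_at_def by blast

lemma hol_atI: "(F has_derivative (\<lambda>v. a * fst v + b * snd v)) (at z) \<Longrightarrow> hol_at F z"
  by (auto simp: hol_at_def)

lemma hol_at_const [intro]: "hol_at (\<lambda>z. c) z"
  by (rule hol_atI[of _ 0 0]) simp

lemma hol_at_fst [intro]: "hol_at fst z"
  by (rule hol_atI[of _ 1 0]) (simp add: has_derivative_fst)

lemma hol_at_snd [intro]: "hol_at snd z"
  by (rule hol_atI[of _ 0 1]) (simp add: has_derivative_snd)

lemma hol_at_add [intro]: "hol_at F z \<Longrightarrow> hol_at G z \<Longrightarrow> hol_at (\<lambda>z. F z + G z) z"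
proof -
  assume "hol_at F z" "hol_at G z"
  then obtain a b c d where "(F has_derivative (\<lambda>v. a * fst v + b * snd v)) (at z)"
    "(G has_derivative (\<lambda>v. c * fst v + d * snd v)) (at z)" by (auto simp: hol_at_def)
  from has_derivative_add[OF this] show ?thesis
    by (intro hol_atI[of _ "a + c" "b + d"]) (simp add: algebra_simps)
qed

lemma hol_at_mult [intro]: "hol_at F z \<Longrightarrow> hol_at G z \<Longrightarrow> hol_at (\<lambda>z. F z * G z) z"
proof -
  assume "hol_at F z" "hol_at G z"
  then obtain a b c d where "(F has_derivative (\<lambda>v. a * fst v + b * snd v)) (at z)"
    "(G has_derivative (\<lambda>v. c * fst v + d * snd v)) (at z)" by (auto simp: hol_at_def)
  from has_derivative_mult[OF this] show ?thesis
    by (intro hol_atI[of _ "F z * c + G z * a" "F z * d + G z * b"]) (simp add: algebra_simps)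
qed

lemma hol_at_compose:
  assumes "(f has_field_derivative f') (at (F z))" "hol_at F z"
  shows "hol_at (\<lambda>z. f (F z)) z"
proof -
  obtain a b where F: "(F has_derivative (\<lambda>v. a * fst v + b * snd v)) (at z)"
    using assms(2) by (auto simp: hol_at_def)
  have "(f has_derivative (\<lambda>x. f' * x)) (at (F z))" using assms(1) by (simp add: has_field_derivative_def)
  from has_derivative_compose[OF F this] show ?thesis
    by (intro hol_atI[of _ "f' * a" "f' * b"]) (simp add: algebra_simps)
qed

lemma hol_at_uminus [intro]: "hol_at F z \<Longrightarrow> hol_at (\<lambda>z. - F z) z"
  using hol_at_mult[OF hol_at_const[of "-1"]] by simp

lemma hol_at_diff [intro]: "hol_at F z \<Longrightarrow> hol_at G z \<Longrightarrow> hol_at (\<lambda>z. F z - G z) z"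
  using hol_at_add[OF _ hol_at_uminus] by simp

lemma hol_at_inverse: "hol_at F z \<Longrightarrow> F z \<noteq> 0 \<Longrightarrow> hol_at (\<lambda>z. inverse (F z)) z"
  by (rule hol_at_compose[OF DERIV_inverse])

lemma hol_at_power [intro]: "hol_at F z \<Longrightarrow> hol_at (\<lambda>z. F z ^ k) z"
  by (induction k) auto

lemma hol_at_cong:
  assumes "\<forall>\<^sub>F w in nhds z. F w = G w" "hol_at F z"
  shows "hol_at G z"
proof -
  obtain a b where F: "(F has_derivative (\<lambda>v. a * fst v + b * snd v)) (at z)"
    using assms(2) by (auto simp: hol_at_def)
  have "\<forall>\<^sub>F w in at z. F w = G w" "F z = G z"
    using assms(1) by (auto simp: eventually_at_filter eventually_mono dest: eventually_nhds_x_imp_x)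
  from has_derivative_transform_eventually[OF F this] show ?thesis by (intro hol_atI) simp
qed

lemma hol_at_isCont: "hol_at F z \<Longrightarrow> isCont F z"
  by (auto simp: hol_at_def has_derivative_continuous)

lemma hol_at_slice_x:
  assumes "hol_at F (x, y)" shows "(\<lambda>x. F (x, y)) field_differentiable (at x)"
proof -
  obtain a b where F: "(F has_derivative (\<lambda>v. a * fst v + b * snd v)) (at (x, y))"
    using assms by (auto simp: hol_at_def)
  have "((\<lambda>x. (x, y)) has_derivative (\<lambda>h. (h, 0))) (at x)"
    by (auto intro!: derivative_eq_intros)
  from has_derivative_compose[OF this F]
  have "((\<lambda>x. F (x, y)) has_derivative (\<lambda>h. a * h)) (at x)" by simp
  thus ?thesis unfolding field_differentiable_def has_field_derivative_def by blast
qed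

lemma hol_at_slice_y:
  assumes "hol_at F (x, y)" shows "(\<lambda>y. F (x, y)) field_differentiable (at y)"
proof -
  obtain a b where F: "(F has_derivative (\<lambda>v. a * fst v + b * snd v)) (at (x, y))"
    using assms by (auto simp: hol_at_def)
  have "((\<lambda>y. (x, y)) has_derivative (\<lambda>h. (0, h))) (at y)"
    by (auto intro!: derivative_eq_intros)
  from has_derivative_compose[OF this F]
  have "((\<lambda>y. F (x, y)) has_derivative (\<lambda>h. b * h)) (at y)" by simp
  thus ?thesis unfolding field_differentiable_def has_field_derivative_def by blast
qed

lemma has_derivative_zero_quadratic:
  fixes R :: "'a::real_normed_vector \<Rightarrow> 'b::real_normed_vector"
  assumes "\<forall>\<^sub>F z in at z0. norm (R z) \<le> K * norm (z - z0) ^ 2" "R z0 = 0"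
  shows "(R has_derivative (\<lambda>_. 0)) (at z0)"
  unfolding has_derivative_iff_norm
proof (intro conjI)
  have "((\<lambda>z. K * norm (z - z0)) \<longlongrightarrow> 0) (at z0)"
    by (auto intro!: tendsto_eq_intros)
  moreover have "\<forall>\<^sub>F z in at z0. norm (norm (R z - R z0 - 0) / norm (z - z0)) \<le> K * norm (z - z0)"
    using assms(1)
  proof (rule eventually_mono)
    fix z assume "norm (R z) \<le> K * norm (z - z0) ^ 2"
    thus "norm (norm (R z - R z0 - 0) / norm (z - z0)) \<le> K * norm (z - z0)"
      using assms(2) by (cases "z = z0") (auto simp: divide_simps power2_eq_square mult_ac)
  qed
  ultimately show "((\<lambda>z. norm (R z - R z0 - 0) / norm (z - z0)) \<longlongrightarrow> 0) (at z0)"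
    by (rule Lim_null_comparison[rotated])
qed simp

text \<open>Cauchy's inequality on discs of radius r/4 around points of the half-size ball bounds
  the second derivative by 2 B / (r/4)^2 = 32 B / r^2; Taylor's formula turns this into the bound on
  the remainder.\<close>

lemma holomorphic_quadratic_remainder:
  assumes f: "f holomorphic_on ball x0 r" and r: "r > 0" and B: "\<And>x. x \<in> ball x0 r \<Longrightarrow> cmod (f x) \<le> B"
    and x: "x \<in> ball x0 (r / 2)"
  shows "cmod (f x - f x0 - deriv f x0 * (x - x0)) \<le> (32 * B / r\<^sup>2) * cmod (x - x0) ^ 2"
proof -
  have "cmod ((deriv ^^ 0) f x - (\<Sum>i\<le>1. (deriv ^^ i) f x0 * (x - x0) ^ i / fact i))
     \<le> (32 * B / r\<^sup>2) * cmod (x - x0) ^ (Suc 1) / fact 1"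
  proof (rule complex_Taylor)
    show "convex (ball x0 (r / 2))" by simp
    fix i z assume "z \<in> ball x0 (r / 2)"
    hence "z \<in> ball x0 r" using r by auto
    hence "((deriv ^^ i) f has_field_derivative (deriv ^^ Suc i) f z) (at z)"
      using f by (intro has_field_derivative_higher_deriv) auto
    thus "((deriv ^^ i) f has_field_derivative (deriv ^^ Suc i) f z) (at z within ball x0 (r / 2))"
      by (rule has_field_derivative_at_within)
  next
    fix z assume z: "z \<in> ball x0 (r / 2)"
    have sub: "cball z (r / 4) \<subseteq> ball x0 r"
    proof
      fix w assume "w \<in> cball z (r / 4)"
      hence "dist x0 w < r / 2 + r / 4 + r / 4"
        using z r dist_triangle[of x0 w z] by auto
      thus "w \<in> ball x0 r" by simp
    qed
    have "cmod ((deriv ^^ 2) f z) \<le> fact 2 * B / (r / 4) ^ 2"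
    proof (rule Cauchy_inequality)
      show "f holomorphic_on ball z (r / 4)"
        using f sub ball_subset_cball by (blast intro: holomorphic_on_subset)
      show "continuous_on (cball z (r / 4)) f"
        using f sub by (blast intro: continuous_on_subset holomorphic_on_imp_continuous_on)
      show "\<And>w. cmod (z - w) = r / 4 \<Longrightarrow> cmod (f w) \<le> B"
        using sub by (intro B) (auto simp: dist_norm)
    qed (use r in auto)
    also have "\<dots> = 32 * B / r\<^sup>2" by (simp add: power_divide)
    finally show "cmod ((deriv ^^ Suc 1) f z) \<le> 32 * B / r\<^sup>2" by (simp add: numeral_2_eq_2)
  qed (use x r in auto)
  thus ?thesis by (simp add: algebra_simps power2_eq_square)
qed

text \<open>The remainder \<open>E\<close> of the first order expansion of \<open>F\<close> in \<open>x\<close> is \<open>O(|x - x\<^sub>0|\<^sup>2)\<close> uniformly in \<open>y\<close>;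
  Cauchy's inequality in \<open>y\<close> transfers this bound to the slope of \<open>E\<close>, and the slopes of the two
  other terms are holomorphic functions of \<open>y\<close> alone.\<close>
lemma hol_at_slope:
  assumes r: "r > 0" and F: "\<And>x y. x \<in> ball a r \<Longrightarrow> y \<in> ball b r \<Longrightarrow> hol_at F (x, y)"
    and bound: "\<And>x y. x \<in> ball a r \<Longrightarrow> y \<in> ball b r \<Longrightarrow> cmod (F (x, y)) \<le> B"
    and x0: "x0 \<in> ball a r"
  defines "G \<equiv> \<lambda>(x, y). if y = b then deriv (\<lambda>y. F (x, y)) b else (F (x, y) - F (x, b)) / (y - b)"
  shows "hol_at G (x0, b)"
proof -
  define \<rho> where "\<rho> = r - dist a x0"
  have \<rho>: "\<rho> > 0" "ball x0 \<rho> \<subseteq> ball a r"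
    using x0 dist_triangle[of a _ x0] by (auto simp: \<rho>_def dist_commute) (smt (verit) dist_commute dist_triangle)
  define p where "p = (\<lambda>y. deriv (\<lambda>x. F (x, y)) x0)"
  define E where "E = (\<lambda>x y. F (x, y) - F (x0, y) - p y * (x - x0))"
  define K where "K = 32 * B / \<rho>\<^sup>2"
  have Fx: "(\<lambda>x. F (x, y)) holomorphic_on ball a r" if "y \<in> ball b r" for y
    unfolding holomorphic_on_def
    using that by (auto intro!: field_differentiable_at_within hol_at_slice_x F)
  have Fy: "(\<lambda>y. F (x, y)) holomorphic_on ball b r" if "x \<in> ball a r" for x
    unfolding holomorphic_on_def
    using that by (auto intro!: field_differentiable_at_within hol_at_slice_y F)
  have E: "cmod (E x y) \<le> K * cmod (x - x0) ^ 2" if "x \<in> ball x0 (\<rho> / 2)" "y \<in> ball b r" for x y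
    unfolding E_def p_def K_def
  proof (rule holomorphic_quadratic_remainder)
    show "(\<lambda>x. F (x, y)) holomorphic_on ball x0 \<rho>" using Fx[OF that(2)] \<rho>(2) by (rule holomorphic_on_subset)
    show "\<And>x. x \<in> ball x0 \<rho> \<Longrightarrow> cmod (F (x, y)) \<le> B" using \<rho>(2) that(2) by (intro bound) auto
  qed (use that \<rho> in auto)
  have "cmod (F (x0, b)) \<le> B" using bound[of x0 b] x0 r by simp
  hence "0 \<le> B" by (rule order_trans[OF norm_ge_zero])
  hence K: "K \<ge> 0" by (simp add: K_def)
  \<comment> \<open>Steps tending to 0 inside the half-size ball; \<open>p\<close> is the locally
    uniform limit of the difference quotients along them, hence holomorphic in y.\<close>
  define h where "h = (\<lambda>n::nat. complex_of_real (\<rho> / (2 * (real n + 2))))"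
  have h: "h n \<noteq> 0" "x0 + h n \<in> ball x0 (\<rho> / 2)" "cmod (h n) = \<rho> / (2 * (real n + 2))" for n
    using \<rho> by (auto simp: h_def dist_norm norm_divide divide_simps simp del: of_real_divide)
  have p: "p holomorphic_on ball b r"
  proof (rule holomorphic_uniform_sequence)
    fix n show "(\<lambda>y. (F (x0 + h n, y) - F (x0, y)) / h n) holomorphic_on ball b r"
    proof (intro holomorphic_intros Fy)
      have "x0 + h n \<in> ball x0 \<rho>" using h(2)[of n] \<rho>(1) by simp
      thus "x0 + h n \<in> ball a r" using \<rho>(2) by blast
    qed (use h x0 in auto)
  next
    fix y assume y: "y \<in> ball b r"
    obtain d where d: "d > 0" "cball y d \<subseteq> ball b r" using y open_contains_cball[THEN iffD1, OF open_ball] by blast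
    have "uniform_limit (cball y d) (\<lambda>n y. (F (x0 + h n, y) - F (x0, y)) / h n) p sequentially"
    proof (rule metric_uniform_limit_imp_uniform_limit)
      show "uniform_limit (cball y d) (\<lambda>n y. K * cmod (h n)) (\<lambda>_. 0 :: real) sequentially"
      proof (rule uniform_limit_sequentially_iff[THEN iffD2], intro allI impI)
        fix e :: real assume "e > 0"
        have "(\<lambda>n. K * (\<rho> / (2 * (real n + 2)))) \<longlonglongrightarrow> 0" by real_asymp
        from LIMSEQ_D[OF this \<open>e > 0\<close>] show "\<exists>N. \<forall>n\<ge>N. \<forall>x\<in>cball y d. dist (K * cmod (h n)) 0 < e"
          using h(3) by auto
      qed
      have "dist ((F (x0 + h n, w) - F (x0, w)) / h n) (p w) \<le> dist (K * cmod (h n)) 0" if "w \<in> cball y d" for w n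
      proof -
        have "(F (x0 + h n, w) - F (x0, w)) / h n - p w = E (x0 + h n) w / h n"
          using h(1) by (simp add: E_def field_simps)
        also have "cmod \<dots> \<le> K * cmod (h n) ^ 2 / cmod (h n)"
          using E[OF h(2)[of n], of w] that d by (auto simp: norm_divide intro!: divide_right_mono)
        also have "\<dots> = K * cmod (h n)" using h(1) by (simp add: power2_eq_square)
        finally show ?thesis using K by (simp add: dist_norm)
      qed
      thus "\<forall>\<^sub>F n in sequentially. \<forall>w\<in>cball y d. dist ((F (x0 + h n, w) - F (x0, w)) / h n) (p w) \<le> dist (K * cmod (h n)) 0"
        by simp
    qed
    thus "\<exists>d>0. cball y d \<subseteq> ball b r \<and>
        uniform_limit (cball y d) (\<lambda>n y. (F (x0 + h n, y) - F (x0, y)) / h n) p sequentially"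
      using d by blast
  qed auto
  have b: "b \<in> interior (ball b r)" "b \<in> ball b r" using r by auto
  define H where "H = (\<lambda>y. if y = b then deriv (\<lambda>y. F (x0, y)) b else (F (x0, y) - F (x0, b)) / (y - b))"
  define P where "P = (\<lambda>y. if y = b then deriv p b else (p y - p b) / (y - b))"
  have H: "H holomorphic_on ball b r" unfolding H_def by (rule pole_lemma[OF Fy[OF x0] b(1)])
  have P: "P holomorphic_on ball b r" unfolding P_def by (rule pole_lemma[OF p b(1)])
  \<comment> \<open>\<open>R\<close> is the slope in y of the remainder \<open>E\<close>. A
    quadratic bound makes its derivative at (x0, b) vanish, so only the part built from
    \<open>H\<close> and \<open>P\<close> contributes to the derivative of \<open>G\<close>.\<close>
  define R where "R = (\<lambda>z. G z - (H (snd z) + (fst z - x0) * P (snd z)))"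
  define K1 where "K1 = K / (r / 2)"
  have R: "cmod (R (x, y)) \<le> K1 * cmod (x - x0) ^ 2" if x: "x \<in> ball x0 (\<rho> / 2)" and y: "y \<in> ball b (r / 2)" for x y
  proof -
    have "x \<in> ball x0 \<rho>" using x \<rho>(1) by simp
    hence xa: "x \<in> ball a r" using \<rho>(2) by blast
    have Eh: "E x holomorphic_on ball b r"
      unfolding E_def by (intro holomorphic_intros Fy p xa x0)
    have dE: "cmod (deriv (E x) w) \<le> K1 * cmod (x - x0) ^ 2" if w: "w \<in> ball b (r / 2)" for w
    proof -
      have sub: "cball w (r / 2) \<subseteq> ball b r"
      proof
        fix v assume "v \<in> cball w (r / 2)"
        thus "v \<in> ball b r" using w dist_triangle[of b v w] by auto
      qed
      have "cmod ((deriv ^^ 1) (E x) w) \<le> fact 1 * (K * cmod (x - x0) ^ 2) / (r / 2) ^ 1"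
      proof (rule Cauchy_inequality)
        show "E x holomorphic_on ball w (r / 2)"
          using Eh sub ball_subset_cball by (blast intro: holomorphic_on_subset)
        show "continuous_on (cball w (r / 2)) (E x)"
          using Eh sub by (blast intro: continuous_on_subset holomorphic_on_imp_continuous_on)
        show "\<And>v. cmod (w - v) = r / 2 \<Longrightarrow> cmod (E x v) \<le> K * cmod (x - x0) ^ 2"
          using sub x by (intro E) (auto simp: dist_norm)
      qed (use r in auto)
      thus ?thesis by (simp add: K1_def mult_ac)
    qed
    have bb: "b \<in> ball b (r / 2)" using r by simp
    show ?thesis
    proof (cases "y = b")
      case True
      have df: "(\<lambda>y. F (x, y)) field_differentiable at b" "(\<lambda>y. F (x0, y)) field_differentiable at b" "p field_differentiable at b"
        using Fy[OF xa] Fy[OF x0] p b by (auto intro: holomorphic_on_imp_differentiable_at)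
      have "deriv (E x) b = deriv (\<lambda>y. F (x, y)) b - deriv (\<lambda>y. F (x0, y)) b - deriv p b * (x - x0)"
        unfolding E_def using df
        by (auto intro!: DERIV_imp_deriv derivative_eq_intros simp: field_differentiable_derivI)
      hence "R (x, y) = deriv (E x) b"
        using True by (simp add: R_def G_def H_def P_def algebra_simps)
      thus ?thesis using dE[OF bb] by simp
    next
      case False
      have "cmod (E x y - E x b) \<le> (K1 * cmod (x - x0) ^ 2) * cmod (y - b)"
      proof (rule field_differentiable_bound)
        fix w assume "w \<in> ball b (r / 2)"
        hence wb: "w \<in> ball b r" using r by simp
        show "(E x has_field_derivative deriv (E x) w) (at w within ball b (r / 2))"
          by (rule has_field_derivative_at_within[OF holomorphic_derivI[OF Eh open_ball wb]])
      next
        show "convex (ball b (r / 2))" by simp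
      qed (use dE y bb in auto)
      moreover have "R (x, y) = (E x y - E x b) / (y - b)"
      proof -
        have "R (x, y) = (F (x, y) - F (x, b)) / (y - b)
            - ((F (x0, y) - F (x0, b)) / (y - b) + (x - x0) * ((p y - p b) / (y - b)))"
          using False by (simp add: R_def G_def H_def P_def)
        also have "\<dots> = ((F (x, y) - F (x, b)) - ((F (x0, y) - F (x0, b)) + (x - x0) * (p y - p b))) / (y - b)"
          by (simp only: times_divide_eq_right add_divide_distrib[symmetric] diff_divide_distrib[symmetric])
        also have "\<dots> = (E x y - E x b) / (y - b)"
          by (rule arg_cong[of _ _ "\<lambda>t. t / (y - b)"]) (simp add: E_def algebra_simps)
        finally show ?thesis .
      qed
      ultimately show ?thesis using False by (simp only: norm_divide) (simp add: pos_divide_le_eq)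
    qed
  qed
  have nb: "\<forall>\<^sub>F z in nhds (x0, b). z \<in> ball x0 (\<rho> / 2) \<times> ball b (r / 2)"
    by (rule eventually_nhds_in_open) (use \<rho> r in \<open>auto intro: open_Times\<close>)
  have "(R has_derivative (\<lambda>_. 0)) (at (x0, b))"
  proof (rule has_derivative_zero_quadratic)
    show "R (x0, b) = 0" by (simp add: R_def G_def H_def)
    have "\<forall>\<^sub>F z in nhds (x0, b). norm (R z) \<le> K1 * norm (z - (x0, b)) ^ 2"
      using nb
    proof eventually_elim
      case (elim z)
      hence "norm (R z) \<le> K1 * cmod (fst z - x0) ^ 2" using R[of "fst z" "snd z"] by auto
      also have "\<dots> \<le> K1 * norm (z - (x0, b)) ^ 2"
        using K r norm_fst_le[of "fst z - x0" "snd z - b"]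
        by (intro mult_left_mono power_mono) (auto simp: K1_def minus_prod_def)
      finally show ?case .
    qed
    thus "\<forall>\<^sub>F z in at (x0, b). norm (R z) \<le> K1 * norm (z - (x0, b)) ^ 2"
      by (simp add: eventually_at_filter eventually_mono)
  qed
  hence hR: "hol_at R (x0, b)" by (intro hol_atI[of _ 0 0]) simp
  have "(H has_field_derivative deriv H b) (at (snd (x0, b)))"
    unfolding snd_conv by (rule holomorphic_derivI[OF H open_ball b(2)])
  note hH = hol_at_compose[OF this hol_at_snd]
  have "(P has_field_derivative deriv P b) (at (snd (x0, b)))"
    unfolding snd_conv by (rule holomorphic_derivI[OF P open_ball b(2)])
  note hP = hol_at_compose[OF this hol_at_snd]
  have "hol_at (\<lambda>z. R z + (H (snd z) + (fst z - x0) * P (snd z))) (x0, b)"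
    by (rule hol_at_add[OF hR hol_at_add[OF hH hol_at_mult[OF hol_at_diff[OF hol_at_fst hol_at_const] hP]]])
  thus ?thesis by (simp add: R_def)
qed


section \<open>Closure properties of holomorphic functions near a point\<close>

lemma holomorphic_near_const: "holomorphic_near p (\<lambda>z. c)"
  and holomorphic_near_fst: "holomorphic_near p fst"
  and holomorphic_near_snd: "holomorphic_near p snd"
  unfolding holomorphic_near_iff by (intro always_eventually allI hol_at_const hol_at_fst hol_at_snd)+

lemma holomorphic_near_add:
  "holomorphic_near p F \<Longrightarrow> holomorphic_near p G \<Longrightarrow> holomorphic_near p (\<lambda>z. F z + G z)"
  unfolding holomorphic_near_iff by (erule (1) eventually_elim2) (rule hol_at_add)

lemma holomorphic_near_diff:
  "holomorphic_near p F \<Longrightarrow> holomorphic_near p G \<Longrightarrow> holomorphic_near p (\<lambda>z. F z - G z)"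
  unfolding holomorphic_near_iff by (erule (1) eventually_elim2) (rule hol_at_diff)

lemma holomorphic_near_mult:
  "holomorphic_near p F \<Longrightarrow> holomorphic_near p G \<Longrightarrow> holomorphic_near p (\<lambda>z. F z * G z)"
  unfolding holomorphic_near_iff by (erule (1) eventually_elim2) (rule hol_at_mult)

lemma holomorphic_near_power:
  "holomorphic_near p F \<Longrightarrow> holomorphic_near p (\<lambda>z. F z ^ k)"
  unfolding holomorphic_near_iff by (elim eventually_mono) (rule hol_at_power)

lemmas holomorphic_near_intros = holomorphic_near_const holomorphic_near_fst holomorphic_near_snd
  holomorphic_near_add holomorphic_near_diff holomorphic_near_mult holomorphic_near_power

lemma holomorphic_near_sum:
  "(\<And>i. i \<in> A \<Longrightarrow> holomorphic_near p (F i)) \<Longrightarrow> holomorphic_near p (\<lambda>z. \<Sum>i\<in>A. F i z)"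
  by (induction A rule: infinite_finite_induct) (auto intro: holomorphic_near_intros)

lemma holomorphic_near_isCont: "holomorphic_near p F \<Longrightarrow> isCont F p"
  unfolding holomorphic_near_iff by (auto dest!: eventually_nhds_x_imp_x hol_at_isCont)

lemma holomorphic_near_inverse:
  assumes "holomorphic_near p F" "F p \<noteq> 0"
  shows "holomorphic_near p (\<lambda>z. inverse (F z))"
proof -
  have "(F \<longlongrightarrow> F p) (at p)" using holomorphic_near_isCont[OF assms(1)] by (simp add: isCont_def)
  from tendsto_imp_eventually_ne[OF this assms(2)]
  have "\<forall>\<^sub>F z in nhds p. F z \<noteq> 0"
    unfolding eventually_at_filter by (rule eventually_mono) (use assms(2) in auto)
  thus ?thesis using assms(1) unfolding holomorphic_near_iff
    by eventually_elim (rule hol_at_inverse)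
qed

lemma holomorphic_near_compose_fst:
  assumes "\<phi> analytic_on {fst p}" shows "holomorphic_near p (\<lambda>z. \<phi> (fst z))"
proof -
  obtain e where e: "e > 0" "\<phi> holomorphic_on ball (fst p) e"
    using assms by (auto simp: analytic_on_def)
  have "\<forall>\<^sub>F z in nhds p. z \<in> ball (fst p) e \<times> UNIV"
    by (rule eventually_nhds_in_open) (use e in \<open>auto intro: open_Times simp: mem_Times_iff\<close>)
  thus ?thesis unfolding holomorphic_near_iff
  proof eventually_elim
    case (elim z)
    hence "fst z \<in> ball (fst p) e" by auto
    hence "(\<phi> has_field_derivative deriv \<phi> (fst z)) (at (fst z))"
      by (rule holomorphic_derivI[OF e(2) open_ball])
    thus ?case by (rule hol_at_compose) auto
  qed
qed

text \<open>Division by y - b in the manner of Hadamard. A compact bidisc provides the uniform bound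
  needed for differentiability of the slope on y = b; elsewhere the slope is a quotient of
  holomorphic functions.\<close>

lemma holomorphic_near_slope:
  assumes "holomorphic_near (a, b) F"
  shows "\<exists>G. holomorphic_near (a, b) G \<and> (\<forall>z. F z = F (fst z, b) + (snd z - b) * G z) \<and>
    (\<lambda>x. F (x, b)) analytic_on {a}"
proof -
  obtain U where U: "open U" "(a, b) \<in> U" "\<And>z. z \<in> U \<Longrightarrow> hol_at F z"
    using assms unfolding holomorphic_near_iff eventually_nhds by blast
  obtain e where e: "e > 0" "cball (a, b) e \<subseteq> U"
    using U(1,2) open_contains_cball by blast
  define r where "r = e / 2"
  have r: "r > 0" using e by (simp add: r_def)
  have sub: "cball a r \<times> cball b r \<subseteq> U"
  proof
    fix z assume "z \<in> cball a r \<times> cball b r"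
    hence "dist (a, b) z \<le> r + r"
      by (cases z) (auto simp: dist_Pair_Pair intro!: order_trans[OF sqrt_sum_squares_le_sum])
    thus "z \<in> U" using e(2) by (auto simp: r_def)
  qed
  have hol: "hol_at F (x, y)" if "x \<in> cball a r" "y \<in> cball b r" for x y
    using sub that by (intro U(3)) auto
  have "continuous_on (cball a r \<times> cball b r) F"
    using hol by (auto intro!: continuous_at_imp_continuous_on hol_at_isCont)
  hence "bounded (F ` (cball a r \<times> cball b r))"
    by (intro compact_imp_bounded compact_continuous_image compact_Times) auto
  then obtain B where "\<forall>w\<in>F ` (cball a r \<times> cball b r). norm w \<le> B" unfolding bounded_iff by blast
  hence B: "cmod (F (x, y)) \<le> B" if "x \<in> ball a r" "y \<in> ball b r" for x y
    using that by auto
  define G where "G = (\<lambda>(x, y). if y = b then deriv (\<lambda>y. F (x, y)) b else (F (x, y) - F (x, b)) / (y - b))"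
  have "hol_at G (x, y)" if xy: "x \<in> ball a r" "y \<in> ball b r" for x y
  proof (cases "y = b")
    case True
    show ?thesis unfolding G_def True
      by (rule hol_at_slope[where r = r and B = B]) (use hol xy r B in auto)
  next
    case False
    have "hol_at F (x, b)" using hol xy r by auto
    from hol_at_slice_x[OF this] obtain f' where "((\<lambda>x. F (x, b)) has_field_derivative f') (at (fst (x, y)))"
      by (auto simp: field_differentiable_def)
    hence "hol_at (\<lambda>z. F (fst z, b)) (x, y)" by (rule hol_at_compose) auto
    hence "hol_at (\<lambda>z. (F z - F (fst z, b)) * inverse (snd z - b)) (x, y)"
      using hol xy False by (intro hol_at_mult hol_at_diff hol_at_inverse hol_at_snd hol_at_const) auto
    moreover have "\<forall>\<^sub>F z in nhds (x, y). (F z - F (fst z, b)) * inverse (snd z - b) = G z"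
    proof -
      have "\<forall>\<^sub>F z in nhds (x, y). z \<in> UNIV \<times> (- {b})"
        by (rule eventually_nhds_in_open) (use False in \<open>auto intro: open_Times\<close>)
      thus ?thesis
      proof eventually_elim
        case (elim z)
        hence "snd z \<noteq> b" by (simp add: mem_Times_iff)
        thus ?case by (cases z) (simp add: G_def divide_inverse)
      qed
    qed
    ultimately show ?thesis by (rule hol_at_cong[rotated])
  qed
  moreover have "\<forall>\<^sub>F z in nhds (a, b). z \<in> ball a r \<times> ball b r"
    by (rule eventually_nhds_in_open) (use r in \<open>auto intro: open_Times\<close>)
  ultimately have "holomorphic_near (a, b) G"
    unfolding holomorphic_near_iff by (auto elim!: eventually_mono)
  moreover have "\<forall>z. F z = F (fst z, b) + (snd z - b) * G z"
    by (auto simp: G_def)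
  moreover have "(\<lambda>x. F (x, b)) analytic_on {a}"
    unfolding analytic_on_def holomorphic_on_def
    using r hol by (auto intro!: exI[of _ r] field_differentiable_at_within hol_at_slice_x)
  ultimately show ?thesis by blast
qed

section \<open>Taylor expansion at a point and uniqueness of the coefficients\<close>

lemma holomorphic_near_taylor_y:
  assumes "holomorphic_near (a, b) F"
  shows "\<exists>\<phi> G. (\<forall>j. \<phi> j analytic_on {a}) \<and> holomorphic_near (a, b) G \<and>
    (\<forall>z. F z = (\<Sum>j<M. (snd z - b) ^ j * \<phi> j (fst z)) + (snd z - b) ^ M * G z)"
proof (induction M)
  case 0
  show ?case using assms by (intro exI[of _ "\<lambda>_ _. 0"] exI[of _ F]) auto
next
  case (Suc M)
  then obtain \<phi> G where IH: "\<And>j. \<phi> j analytic_on {a}" "holomorphic_near (a, b) G"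
    "\<And>z. F z = (\<Sum>j<M. (snd z - b) ^ j * \<phi> j (fst z)) + (snd z - b) ^ M * G z" by blast
  obtain H where H: "holomorphic_near (a, b) H" "\<And>z. G z = G (fst z, b) + (snd z - b) * H z"
     "(\<lambda>x. G (x, b)) analytic_on {a}" using holomorphic_near_slope[OF IH(2)] by blast
  define \<psi> where "\<psi> = \<phi>(M := (\<lambda>x. G (x, b)))"
  have "F z = (\<Sum>j<Suc M. (snd z - b) ^ j * \<psi> j (fst z)) + (snd z - b) ^ Suc M * H z" for z
  proof -
    have "(\<Sum>j<M. (snd z - b) ^ j * \<psi> j (fst z)) = (\<Sum>j<M. (snd z - b) ^ j * \<phi> j (fst z))"
      by (intro sum.cong) (auto simp: \<psi>_def)
    thus ?thesis by (subst IH(3), subst H(2)) (simp add: \<psi>_def algebra_simps)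
  qed
  moreover have "\<psi> j analytic_on {a}" for j using IH(1) H(3) by (simp add: \<psi>_def)
  ultimately show ?case using H(1) by blast
qed

lemma analytic_taylor:
  assumes "\<phi> analytic_on {a}"
  shows "\<exists>c \<psi>. \<psi> analytic_on {a} \<and> (\<forall>x. \<phi> x = (\<Sum>i<K. c i * (x - a) ^ i) + (x - a) ^ K * \<psi> x)"
proof (induction K)
  case 0
  show ?case using assms by (intro exI[of _ "\<lambda>_. 0"] exI[of _ \<phi>]) auto
next
  case (Suc K)
  then obtain c \<psi> where IH: "\<psi> analytic_on {a}" "\<And>x. \<phi> x = (\<Sum>i<K. c i * (x - a) ^ i) + (x - a) ^ K * \<psi> x"
    by blast
  obtain e where e: "e > 0" "\<psi> holomorphic_on ball a e" using IH(1) by (auto simp: analytic_on_def)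
  define \<theta> where "\<theta> = (\<lambda>x. if x = a then deriv \<psi> a else (\<psi> x - \<psi> a) / (x - a))"
  define c' where "c' = c(K := \<psi> a)"
  have "\<theta> holomorphic_on ball a e" unfolding \<theta>_def using e by (intro pole_lemma) auto
  hence "\<theta> analytic_on {a}" using e by (auto simp: analytic_on_def)
  moreover have "\<phi> x = (\<Sum>i<Suc K. c' i * (x - a) ^ i) + (x - a) ^ Suc K * \<theta> x" for x
  proof -
    have \<psi>: "\<psi> x = \<psi> a + (x - a) * \<theta> x" by (simp add: \<theta>_def)
    have "(\<Sum>i<K. c' i * (x - a) ^ i) = (\<Sum>i<K. c i * (x - a) ^ i)"
      by (intro sum.cong) (auto simp: c'_def)
    thus ?thesis by (subst IH(2), subst \<psi>) (simp add: c'_def algebra_simps)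
  qed
  ultimately show ?case by blast
qed

text \<open>Expand in y, with coefficients analytic in x alone, then expand these in x. Both
  remainders stay holomorphic, so every germ is a polynomial modulo (x - a)^K and (y - b)^M.\<close>

lemma holomorphic_near_taylor:
  assumes "holomorphic_near (a, b) F"
  shows "\<exists>c A B. holomorphic_near (a, b) A \<and> holomorphic_near (a, b) B \<and>
    (\<forall>z. F z = (\<Sum>i<K. \<Sum>j<M. c i j * (fst z - a) ^ i * (snd z - b) ^ j)
       + (fst z - a) ^ K * A z + (snd z - b) ^ M * B z)"
proof -
  obtain \<phi> G where G: "\<And>j. \<phi> j analytic_on {a}" "holomorphic_near (a, b) G"
    "\<And>z. F z = (\<Sum>j<M. (snd z - b) ^ j * \<phi> j (fst z)) + (snd z - b) ^ M * G z"
    using holomorphic_near_taylor_y[OF assms] by blast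
  have "\<exists>c \<psi>. \<psi> analytic_on {a} \<and> (\<forall>x. \<phi> j x = (\<Sum>i<K. c i * (x - a) ^ i) + (x - a) ^ K * \<psi> x)" for j
    by (rule analytic_taylor[OF G(1)])
  then obtain c \<psi> where \<psi>: "\<And>j. \<psi> j analytic_on {a}"
     "\<And>j x. \<phi> j x = (\<Sum>i<K. c j i * (x - a) ^ i) + (x - a) ^ K * \<psi> j x" by metis
  define A where "A = (\<lambda>z. \<Sum>j<M. (snd z - b) ^ j * \<psi> j (fst z))"
  have "holomorphic_near (a, b) (\<lambda>z. \<psi> j (fst z))" for j
    using \<psi>(1) by (intro holomorphic_near_compose_fst) simp
  hence "holomorphic_near (a, b) A" unfolding A_def
    by (intro holomorphic_near_sum holomorphic_near_intros)
  moreover have "F z = (\<Sum>i<K. \<Sum>j<M. c j i * (fst z - a) ^ i * (snd z - b) ^ j)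
       + (fst z - a) ^ K * A z + (snd z - b) ^ M * G z" for z
  proof -
    have "(\<Sum>j<M. (snd z - b) ^ j * \<phi> j (fst z))
        = (\<Sum>j<M. \<Sum>i<K. c j i * (fst z - a) ^ i * (snd z - b) ^ j) + (fst z - a) ^ K * A z"
      unfolding \<psi>(2) A_def by (simp add: sum_distrib_left sum.distrib algebra_simps)
    also have "(\<Sum>j<M. \<Sum>i<K. c j i * (fst z - a) ^ i * (snd z - b) ^ j)
        = (\<Sum>i<K. \<Sum>j<M. c j i * (fst z - a) ^ i * (snd z - b) ^ j)"
      by (rule sum.swap)
    finally show ?thesis by (subst G(3)) simp
  qed
  ultimately show ?thesis using G(2) by (intro exI[of _ "\<lambda>i j. c j i"]) blast
qed

text \<open>Letting y tend to b gives \<open>\<alpha> 0 = 0\<close>; dividing by y - b then lowers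
  \<open>M\<close> by one.\<close>

lemma polynomial_vanishing_order:
  fixes \<alpha> :: "nat \<Rightarrow> complex"
  assumes "\<forall>\<^sub>F y in at b. (\<Sum>j<M. \<alpha> j * (y - b) ^ j) = (y - b) ^ M * \<delta> y" "isCont \<delta> b"
  shows "\<forall>j<M. \<alpha> j = 0"
  using assms(1)
proof (induction M arbitrary: \<alpha>)
  case (Suc M)
  have lim: "(\<delta> \<longlongrightarrow> \<delta> b) (at b)" using assms(2) by (simp add: isCont_def)
  have "((\<lambda>y. (y - b) ^ Suc M * \<delta> y) \<longlongrightarrow> (b - b) ^ Suc M * \<delta> b) (at b)"
    by (intro tendsto_intros lim)
  hence "((\<lambda>y. \<Sum>j<Suc M. \<alpha> j * (y - b) ^ j) \<longlongrightarrow> (b - b) ^ Suc M * \<delta> b) (at b)"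
    using Suc.prems by (simp only: tendsto_cong)
  moreover have "((\<lambda>y. \<Sum>j<Suc M. \<alpha> j * (y - b) ^ j) \<longlongrightarrow> (\<Sum>j<Suc M. \<alpha> j * (b - b) ^ j)) (at b)"
    by (intro tendsto_intros)
  ultimately have "(\<Sum>j<Suc M. \<alpha> j * (b - b) ^ j) = (b - b) ^ Suc M * \<delta> b"
    using tendsto_unique trivial_limit_at by blast
  moreover have "(\<Sum>j<Suc M. \<alpha> j * (b - b) ^ j) = \<alpha> 0"
    by (subst sum.lessThan_Suc_shift) simp
  ultimately have 0: "\<alpha> 0 = 0" by simp
  have "\<forall>\<^sub>F y in at b. y \<noteq> b" by (simp add: eventually_at_filter)
  with Suc.prems have "\<forall>\<^sub>F y in at b. (\<Sum>j<M. \<alpha> (Suc j) * (y - b) ^ j) = (y - b) ^ M * \<delta> y"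
  proof eventually_elim
    case (elim y)
    have "(y - b) * (\<Sum>j<M. \<alpha> (Suc j) * (y - b) ^ j) = (\<Sum>j<Suc M. \<alpha> j * (y - b) ^ j)"
      by (subst sum.lessThan_Suc_shift) (simp add: 0 sum_distrib_left mult_ac)
    also have "\<dots> = (y - b) * ((y - b) ^ M * \<delta> y)" using elim(1) by (simp add: mult_ac)
    finally show ?case using elim(2) by simp
  qed
  from Suc.IH[OF this] show ?case using 0 by (auto simp: less_Suc_eq_0_disj)
qed auto

text \<open>Expanding \<open>A\<close> in y turns the equation, for fixed x near a, into a
  polynomial in y of degree below \<open>M\<close> that equals (y - b)^M times a function continuous
  at b. So its coefficients vanish, and these are equations of the same kind in x.\<close>

lemma taylor_coeffs_unique:
  assumes eq: "\<forall>\<^sub>F z in nhds (a, b). (\<Sum>i<K. \<Sum>j<M. c i j * (fst z - a) ^ i * (snd z - b) ^ j)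
      = (fst z - a) ^ K * A z + (snd z - b) ^ M * B z"
    and A: "holomorphic_near (a, b) A" and B: "holomorphic_near (a, b) B"
    and ij: "i < K" "j < M"
  shows "c i j = 0"
proof -
  obtain \<gamma> G where G: "\<And>j. \<gamma> j analytic_on {a}" "holomorphic_near (a, b) G"
    "\<And>z. A z = (\<Sum>j<M. (snd z - b) ^ j * \<gamma> j (fst z)) + (snd z - b) ^ M * G z"
    using holomorphic_near_taylor_y[OF A] by blast
  define \<alpha> where "\<alpha> = (\<lambda>j x. (\<Sum>i<K. c i j * (x - a) ^ i) - (x - a) ^ K * \<gamma> j x)"
  define D where "D = (\<lambda>z. B z + (fst z - a) ^ K * G z)"
  have D: "holomorphic_near (a, b) D" unfolding D_def by (intro holomorphic_near_intros B G)
  hence "\<forall>\<^sub>F z in nhds (a, b). isCont D z"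
    unfolding holomorphic_near_iff by (auto elim!: eventually_mono intro: hol_at_isCont)
  moreover have "\<forall>\<^sub>F z in nhds (a, b). (\<Sum>j<M. \<alpha> j (fst z) * (snd z - b) ^ j) = (snd z - b) ^ M * D z"
    using eq
  proof eventually_elim
    case (elim z)
    have "(\<Sum>j<M. \<alpha> j (fst z) * (snd z - b) ^ j)
        = (\<Sum>j<M. \<Sum>i<K. c i j * (fst z - a) ^ i * (snd z - b) ^ j)
          - (fst z - a) ^ K * (\<Sum>j<M. (snd z - b) ^ j * \<gamma> j (fst z))"
      unfolding \<alpha>_def by (simp add: sum_distrib_left sum_distrib_right sum_subtractf algebra_simps)
    also have "(\<Sum>j<M. \<Sum>i<K. c i j * (fst z - a) ^ i * (snd z - b) ^ j)
        = (\<Sum>i<K. \<Sum>j<M. c i j * (fst z - a) ^ i * (snd z - b) ^ j)"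
      by (rule sum.swap)
    also have "\<dots> = (fst z - a) ^ K * A z + (snd z - b) ^ M * B z" by (rule elim)
    finally show ?case by (simp add: G(3)[of z] D_def algebra_simps)
  qed
  ultimately have "\<forall>\<^sub>F z in nhds a \<times>\<^sub>F nhds b. isCont D z \<and>
      (\<Sum>j<M. \<alpha> j (fst z) * (snd z - b) ^ j) = (snd z - b) ^ M * D z"
    unfolding nhds_prod by (rule eventually_conj)
  then obtain P Q where PQ: "eventually P (nhds a)" "eventually Q (nhds b)"
     "\<And>x y. P x \<Longrightarrow> Q y \<Longrightarrow> isCont D (x, y) \<and> (\<Sum>j<M. \<alpha> j x * (y - b) ^ j) = (y - b) ^ M * D (x, y)"
    unfolding eventually_prod_filter by auto
  have "\<alpha> j x = 0" if "P x" for x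
  proof -
    have "\<forall>j<M. \<alpha> j x = 0"
    proof (rule polynomial_vanishing_order)
      show "\<forall>\<^sub>F y in at b. (\<Sum>j<M. \<alpha> j x * (y - b) ^ j) = (y - b) ^ M * D (x, y)"
        using PQ(2) PQ(3)[OF that] by (auto simp: eventually_at_filter elim!: eventually_mono)
      have "isCont D (x, b)" using PQ(3)[OF that] eventually_nhds_x_imp_x[OF PQ(2)] by blast
      thus "isCont (\<lambda>y. D (x, y)) b"
        by (intro isCont_o2[of b "\<lambda>y. (x, y)" D]) (auto intro!: continuous_intros)
    qed
    thus ?thesis using ij by blast
  qed
  hence "\<forall>\<^sub>F x in at a. (\<Sum>i<K. c i j * (x - a) ^ i) = (x - a) ^ K * \<gamma> j x"
    using PQ(1) by (auto simp: eventually_at_filter \<alpha>_def elim!: eventually_mono)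
  moreover have "isCont (\<gamma> j) a"
    using G(1)[of j] by (auto dest!: analytic_at_imp_isCont)
  ultimately show ?thesis using polynomial_vanishing_order[of "\<lambda>i. c i j" a K "\<gamma> j"] ij by blast
qed


section \<open>The ring of germs and the intersection multiplicity\<close>

lemma germ_eq_iff: "germ p F = germ p G \<longleftrightarrow> (\<forall>\<^sub>F z in nhds p. F z = G z)"
proof
  assume "germ p F = germ p G"
  moreover have "F \<in> germ p F" by (simp add: germ_def)
  ultimately show "\<forall>\<^sub>F z in nhds p. F z = G z" by (simp add: germ_def)
next
  assume *: "\<forall>\<^sub>F z in nhds p. F z = G z"
  have "(\<forall>\<^sub>F z in nhds p. H z = F z) \<longleftrightarrow> (\<forall>\<^sub>F z in nhds p. H z = G z)" for H
    using * by (intro eventually_subst) (auto elim!: eventually_mono)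
  thus "germ p F = germ p G" by (simp add: germ_def)
qed

lemma germ_in_carrier: "holomorphic_near p F \<Longrightarrow> germ p F \<in> carrier (germ_ring p)"
  by (simp add: germ_ring_def)

lemma germ_carrierE:
  assumes "x \<in> carrier (germ_ring p)"
  obtains F where "holomorphic_near p F" "x = germ p F"
  using assms by (auto simp: germ_ring_def)

lemma germ_lift2:
  "(\<Union>F'\<in>germ p F. \<Union>G'\<in>germ p G. germ p (\<lambda>z. h (F' z) (G' z))) = germ p (\<lambda>z. h (F z) (G z))"
proof -
  have "germ p (\<lambda>z. h (F' z) (G' z)) = germ p (\<lambda>z. h (F z) (G z))" if "F' \<in> germ p F" "G' \<in> germ p G" for F' G'
  proof -
    have "\<forall>\<^sub>F z in nhds p. F' z = F z" "\<forall>\<^sub>F z in nhds p. G' z = G z" using that by (simp_all add: germ_def)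
    thus ?thesis unfolding germ_eq_iff by eventually_elim simp
  qed
  moreover have "F \<in> germ p F" "G \<in> germ p G" by (simp_all add: germ_def)
  ultimately show ?thesis by blast
qed

lemma germ_mult: "germ p F \<otimes>\<^bsub>germ_ring p\<^esub> germ p G = germ p (\<lambda>z. F z * G z)"
  using germ_lift2[where h = "(*)" and p = p and F = F and G = G] by (simp add: germ_ring_def)

lemma germ_add: "germ p F \<oplus>\<^bsub>germ_ring p\<^esub> germ p G = germ p (\<lambda>z. F z + G z)"
  using germ_lift2[where h = "(+)" and p = p and F = F and G = G] by (simp add: germ_ring_def)

lemma germ_one: "\<one>\<^bsub>germ_ring p\<^esub> = germ p (\<lambda>z. 1)"
  and germ_zero: "\<zero>\<^bsub>germ_ring p\<^esub> = germ p (\<lambda>z. 0)"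
  by (simp_all add: germ_ring_def)

lemmas germ_simps = germ_mult germ_add germ_one germ_zero

lemma cring_germ_ring: "cring (germ_ring p)"
proof (rule cringI)
  show "abelian_group (germ_ring p)"
  proof (rule abelian_groupI)
    fix x assume "x \<in> carrier (germ_ring p)"
    then obtain F where F: "holomorphic_near p F" "x = germ p F" by (rule germ_carrierE)
    have "holomorphic_near p (\<lambda>z. 0 - F z)" by (intro holomorphic_near_intros F)
    thus "\<exists>y\<in>carrier (germ_ring p). y \<oplus>\<^bsub>germ_ring p\<^esub> x = \<zero>\<^bsub>germ_ring p\<^esub>"
      unfolding F(2) by (intro bexI[of _ "germ p (\<lambda>z. 0 - F z)"]) (simp_all add: germ_simps germ_in_carrier)
  qed (auto elim!: germ_carrierE simp: germ_simps add_ac intro!: germ_in_carrier holomorphic_near_intros)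
  show "Group.comm_monoid (germ_ring p)"
    by (rule Group.comm_monoidI)
       (auto elim!: germ_carrierE simp: germ_simps mult_ac intro!: germ_in_carrier holomorphic_near_intros)
qed (auto elim!: germ_carrierE simp: germ_simps algebra_simps)

text \<open>A quotient basis is carried along the surjection \<open>\<psi>\<close> with kernel
  \<open>J\<close> to a basis of the algebra. That 1 lies outside \<open>J\<close> makes the image
  \<open>K\<close> of the scalars a field.\<close>

lemma dimension_of_quotient:
  fixes A (structure) and \<psi> :: "'a::comm_ring_1 \<Rightarrow> 'b" and \<kappa> :: "complex \<Rightarrow> 'a"
  assumes "ring A" and "scalar_embedding \<kappa>"
    and add: "\<And>x y. \<psi> (x + y) = \<psi> x \<oplus> \<psi> y"
    and mult: "\<And>x y. \<psi> (x * y) = \<psi> x \<otimes> \<psi> y"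
    and one: "\<psi> 1 = \<one>"
    and surj: "carrier A = range \<psi>"
    and ker: "\<And>x. \<psi> x = \<zero> \<longleftrightarrow> x \<in> J"
    and J0: "0 \<in> J" and J1: "1 \<notin> J"
    and codim: "has_codim \<kappa> J d"
  defines "K \<equiv> range (\<lambda>c. \<psi> (\<kappa> c))"
  shows "subfield K A" and "ring.dimension A d K (carrier A)"
proof -
  interpret ring A by fact
  interpret \<kappa>: scalar_embedding \<kappa> by fact
  have carr: "\<psi> x \<in> carrier A" for x using surj by blast
  have zero: "\<psi> 0 = \<zero>" using ker J0 by simp
  have neg: "\<ominus> \<psi> x = \<psi> (- x)" for x
    by (rule minus_equality) (simp_all add: add[symmetric] zero carr)
  have "subcring K A"
  proof (rule subcringI, rule subringI)
    show "K \<subseteq> carrier A" using carr by (auto simp: K_def)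
    show "\<one> \<in> K" unfolding K_def one[symmetric] \<kappa>.emb_1[symmetric] by blast
  next
    fix h assume "h \<in> K" thus "\<ominus> h \<in> K"
      by (auto simp: K_def neg \<kappa>.emb_minus[symmetric])
  next
    fix h1 h2 assume "h1 \<in> K" "h2 \<in> K"
    thus "h1 \<otimes> h2 \<in> K" "h1 \<oplus> h2 \<in> K" "h1 \<otimes> h2 = h2 \<otimes> h1"
      by (auto simp: K_def mult[symmetric] add[symmetric] \<kappa>.emb_add[symmetric] \<kappa>.emb_mult[symmetric] mult.commute)
  qed
  moreover have "Units (A \<lparr> carrier := K \<rparr>) = K - {\<zero>}"
  proof (intro equalityI subsetI)
    fix x assume "x \<in> Units (A \<lparr> carrier := K \<rparr>)"
    then obtain y where y: "x \<in> K" "y \<in> K" "x \<otimes> y = \<one>" by (auto simp: Units_def)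
    have "\<one> \<noteq> \<zero>" using ker[of 1] J1 one by simp
    moreover have "y \<in> carrier A" using y(2) carr by (auto simp: K_def)
    ultimately have "x \<noteq> \<zero>" using y by auto
    thus "x \<in> K - {\<zero>}" using y by simp
  next
    fix x assume x: "x \<in> K - {\<zero>}"
    then obtain c where c: "x = \<psi> (\<kappa> c)" by (auto simp: K_def)
    have "c \<noteq> 0" using x c zero by auto
    hence "\<psi> (\<kappa> c) \<otimes> \<psi> (\<kappa> (1 / c)) = \<one>" "\<psi> (\<kappa> (1 / c)) \<otimes> \<psi> (\<kappa> c) = \<one>"
      by (simp_all add: mult[symmetric] \<kappa>.emb_mult[symmetric] \<kappa>.emb_1 one)
    moreover have "\<psi> (\<kappa> (1 / c)) \<in> K" by (simp add: K_def)
    ultimately show "x \<in> Units (A \<lparr> carrier := K \<rparr>)"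
      using x c by (auto simp: Units_def)
  qed
  ultimately show sf: "subfield K A" by (rule subfieldI)
  obtain e where e: "quotient_basis \<kappa> J {..<d} e" using codim unfolding has_codim_def by blast
  define Us where "Us = map (\<lambda>i. \<psi> (e i)) [0..<d]"
  have Us: "set Us \<subseteq> carrier A" using carr by (auto simp: Us_def)
  have comb: "combine (map (\<lambda>i. \<psi> (\<kappa> (c i))) xs) (map (\<lambda>i. \<psi> (e i)) xs) = \<psi> (\<Sum>i\<leftarrow>xs. \<kappa> (c i) * e i)" for c xs
    by (induction xs) (simp_all add: zero add mult)
  have comb: "combine (map (\<lambda>i. \<psi> (\<kappa> (c i))) [0..<d]) Us = \<psi> (\<Sum>i<d. \<kappa> (c i) * e i)" for c
    unfolding Us_def comb by (simp add: sum_list_distinct_conv_sum_set atLeast0LessThan)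
  have span: "Span K Us = carrier A"
  proof (intro equalityI subsetI)
    fix x assume "x \<in> Span K Us"
    thus "x \<in> carrier A" using Span_in_carrier[OF subfieldE(3)[OF sf] Us] by blast
  next
    fix x assume "x \<in> carrier A"
    then obtain q where q: "x = \<psi> q" using surj by blast
    obtain c where "q - (\<Sum>i<d. \<kappa> (c i) * e i) \<in> J" using e unfolding quotient_basis_def by blast
    hence "\<psi> (q - (\<Sum>i<d. \<kappa> (c i) * e i)) = \<zero>" by (simp add: ker)
    moreover have "\<psi> q = \<psi> (q - (\<Sum>i<d. \<kappa> (c i) * e i)) \<oplus> \<psi> (\<Sum>i<d. \<kappa> (c i) * e i)"
      unfolding add[symmetric] by simp
    ultimately have "x = combine (map (\<lambda>i. \<psi> (\<kappa> (c i))) [0..<d]) Us"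
      using carr by (simp add: q comb)
    thus "x \<in> Span K Us"
      unfolding Span_mem_iff_length_version[OF sf Us]
      by (intro exI[of _ "map (\<lambda>i. \<psi> (\<kappa> (c i))) [0..<d]"]) (auto simp: K_def Us_def)
  qed
  have "independent K Us"
  proof (rule ccontr)
    assume "dependent K Us"
    from dependent_imp_non_trivial_combine[OF sf Us this]
    obtain Ks where Ks: "length Ks = length Us" "combine Ks Us = \<zero>" "set Ks \<subseteq> K" "set Ks \<noteq> {\<zero>}" .
    have len: "length Ks = d" using Ks(1) by (simp add: Us_def)
    have "\<exists>c. Ks ! i = \<psi> (\<kappa> c)" if "i < d" for i
    proof -
      have "Ks ! i \<in> K" using Ks(3) nth_mem[of i Ks] that len by blast
      thus ?thesis by (auto simp: K_def)
    qed
    then obtain c where c: "\<And>i. i < d \<Longrightarrow> Ks ! i = \<psi> (\<kappa> (c i))" by metis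
    have Ks_eq: "Ks = map (\<lambda>i. \<psi> (\<kappa> (c i))) [0..<d]"
      by (rule nth_equalityI) (simp_all add: len c)
    have "(\<Sum>i<d. \<kappa> (c i) * e i) \<in> J" using Ks(2) unfolding Ks_eq comb by (simp add: ker)
    hence "c i = 0" if "i < d" for i using quotient_basis_indep[OF e, of c i] that by simp
    hence "\<forall>i<d. Ks ! i = \<zero>" using c zero by simp
    hence "set Ks \<subseteq> {\<zero>}" using len by (auto simp: in_set_conv_nth)
    \<comment> \<open>\<open>set Ks \<noteq> {\<zero>}\<close> also holds for the empty list, so the
      case d = 0 is left; there the quotient is trivial, against 1 lying outside
      \<open>J\<close>.\<close>
    hence "d = 0" using Ks(4) len by (cases Ks) auto
    hence "1 \<in> J" using e unfolding quotient_basis_def by simp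
    thus False using J1 by simp
  qed
  from dimension_independent[OF this] show "dimension d K (carrier A)"
    unfolding span by (simp add: Us_def)
qed

section \<open>From polynomials to germs\<close>

lemma poly2_const [simp]: "poly2 (kpoly c) = (\<lambda>z. c)" "poly2 1 = (\<lambda>z. 1)" "poly2 0 = (\<lambda>z. 0)"
  by (auto simp: poly2_def fun_eq_iff)

lemma poly2_varY [simp]: "poly2 varY z = snd z"
  by (cases z) (simp add: poly2_def varY_def)

lemma lin_x_eq: "lin_x a = [:-[:a:], 1:]"
  unfolding lin_x_def by (rule poly_eqI) (auto simp: coeff_pCons one_pCons split: nat.splits)

lemma poly2_lin_x [simp]: "poly2 (lin_x a) z = fst z - a"
  by (cases z) (simp add: poly2_def lin_x_eq)

lemma poly2_power [simp]: "poly2 (q ^ k) z = poly2 q z ^ k"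
  by (induction k) (simp_all add: poly2_mult)

lemma poly2_sum [simp]: "poly2 (\<Sum>i\<in>S. f i) z = (\<Sum>i\<in>S. poly2 (f i) z)"
  by (induction S rule: infinite_finite_induct) (simp_all add: poly2_add)

lemma poly2_diff: "poly2 (q - r) z = poly2 q z - poly2 r z"
  by (cases z) (simp add: poly2_def)

lemma poly2_prod: "poly2 (\<Prod>i\<in>S. f i) z = (\<Prod>i\<in>S. poly2 (f i) z)"
  by (induction S rule: infinite_finite_induct) (simp_all add: poly2_mult)

lemma holomorphic_near_poly2: "holomorphic_near p (poly2 q)"
proof -
  define K where "K = total_degree q"
  have "poly2 q = (\<lambda>z. \<Sum>i\<le>K. \<Sum>j\<le>K - i. coeff2 q i j * fst z ^ i * snd z ^ j)"
  proof
    fix z show "poly2 q z = (\<Sum>i\<le>K. \<Sum>j\<le>K - i. coeff2 q i j * fst z ^ i * snd z ^ j)"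
      using poly2_conv_sum[of q K "fst z" "snd z"] by (simp add: K_def)
  qed
  thus ?thesis by (simp only:) (intro holomorphic_near_sum holomorphic_near_intros)
qed

text \<open>The algebraic counterpart of the expansion of germs, with polynomial remainders: divide
  repeatedly by x - a, then cut the coefficients at order M in y.\<close>

lemma poly_taylor:
  "\<exists>c r s. q = (\<Sum>i<K. \<Sum>j<M. kpoly (c i j) * lin_x a ^ i * varY ^ j) + lin_x a ^ K * r + varY ^ M * s"
proof -
  have "\<exists>c r. q = (\<Sum>i<K. lin_x a ^ i * [:c i:]) + lin_x a ^ K * r"
  proof (induction K)
    case 0 show ?case by auto
  next
    case (Suc K)
    then obtain c r where IH: "q = (\<Sum>i<K. lin_x a ^ i * [:c i:]) + lin_x a ^ K * r" by blast
    have "poly (r - [:poly r [:a:]:]) [:a:] = 0" by simp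
    then obtain r' where "r - [:poly r [:a:]:] = lin_x a * r'"
      unfolding poly_eq_0_iff_dvd lin_x_eq by (rule dvdE)
    hence r: "r = [:poly r [:a:]:] + lin_x a * r'" by (metis add.commute diff_add_cancel)
    define c' where "c' = c(K := poly r [:a:])"
    have "(\<Sum>i<K. lin_x a ^ i * [:c' i:]) = (\<Sum>i<K. lin_x a ^ i * [:c i:])"
      by (intro sum.cong) (auto simp: c'_def)
    hence "q = (\<Sum>i<Suc K. lin_x a ^ i * [:c' i:]) + lin_x a ^ Suc K * r'"
      by (subst IH, subst r) (simp add: c'_def distrib_left mult_ac add_ac)
    thus ?case by blast
  qed
  then obtain c r where q: "q = (\<Sum>i<K. lin_x a ^ i * [:c i:]) + lin_x a ^ K * r" by blast
  have c: "[:c i:] = (\<Sum>j<M. kpoly (coeff (c i) j) * varY ^ j) + varY ^ M * [:poly_shift M (c i):]" for i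
  proof -
    have "c i = (\<Sum>j<M. monom (coeff (c i) j) j) + monom 1 M * poly_shift M (c i)"
      by (rule poly_eqI) (simp add: coeff_sum coeff_monom_mult coeff_poly_shift)
    hence "[:c i:] = [:\<Sum>j<M. monom (coeff (c i) j) j:] + [:monom 1 M * poly_shift M (c i):]"
      by (metis add_pCons add_0_right)
    moreover have "[:\<Sum>j\<in>S. monom (coeff (c i) j) j:] = (\<Sum>j\<in>S. kpoly (coeff (c i) j) * varY ^ j)" for S
    proof (induction S rule: infinite_finite_induct)
      case (insert x S)
      have "[:\<Sum>j\<in>insert x S. monom (coeff (c i) j) j:]
          = [:monom (coeff (c i) x) x:] + [:\<Sum>j\<in>S. monom (coeff (c i) j) j:]"
        using insert.hyps by simp
      also have "[:monom (coeff (c i) x) x:] = kpoly (coeff (c i) x) * varY ^ x"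
        by (simp add: varY_power smult_monom)
      finally show ?case unfolding insert.IH sum.insert[OF insert.hyps] .
    qed simp_all
    ultimately show ?thesis by (simp add: varY_power)
  qed
  have "q = (\<Sum>i<K. \<Sum>j<M. kpoly (coeff (c i) j) * lin_x a ^ i * varY ^ j) + lin_x a ^ K * r
      + varY ^ M * (\<Sum>i<K. lin_x a ^ i * [:poly_shift M (c i):])"
    by (subst q, subst c) (simp add: distrib_left sum.distrib sum_distrib_left mult_ac add_ac del: mult_pCons_left mult_pCons_right)
  thus ?thesis by (intro exI[of _ "\<lambda>i j. coeff (c i) j"] exI)
qed

definition local_member :: "complex \<times> complex \<Rightarrow> complex poly poly \<Rightarrow> complex poly poly
    \<Rightarrow> (complex \<times> complex \<Rightarrow> complex) \<Rightarrow> bool"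
  where "local_member p f1 f2 H \<longleftrightarrow> (\<exists>A B. holomorphic_near p A \<and> holomorphic_near p B \<and>
    (\<forall>\<^sub>F z in nhds p. H z = poly2 f1 z * A z + poly2 f2 z * B z))"

lemma local_memberI:
  "holomorphic_near p A \<Longrightarrow> holomorphic_near p B \<Longrightarrow>
   \<forall>\<^sub>F z in nhds p. H z = poly2 f1 z * A z + poly2 f2 z * B z \<Longrightarrow> local_member p f1 f2 H"
  by (auto simp: local_member_def)

lemma local_member_add:
  assumes "local_member p f1 f2 F" "local_member p f1 f2 G"
  shows "local_member p f1 f2 (\<lambda>z. F z + G z)"
proof -
  obtain A B where F: "holomorphic_near p A" "holomorphic_near p B"
     "\<forall>\<^sub>F z in nhds p. F z = poly2 f1 z * A z + poly2 f2 z * B z" using assms(1) by (auto simp: local_member_def)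
  obtain A' B' where G: "holomorphic_near p A'" "holomorphic_near p B'"
     "\<forall>\<^sub>F z in nhds p. G z = poly2 f1 z * A' z + poly2 f2 z * B' z" using assms(2) by (auto simp: local_member_def)
  show ?thesis
  proof (rule local_memberI)
    show "holomorphic_near p (\<lambda>z. A z + A' z)" "holomorphic_near p (\<lambda>z. B z + B' z)"
      by (intro holomorphic_near_intros F G)+
    show "\<forall>\<^sub>F z in nhds p. F z + G z = poly2 f1 z * (A z + A' z) + poly2 f2 z * (B z + B' z)"
      using F(3) G(3) by eventually_elim (simp add: algebra_simps)
  qed
qed

lemma local_member_mult:
  assumes "local_member p f1 f2 F" "holomorphic_near p G"
  shows "local_member p f1 f2 (\<lambda>z. G z * F z)"
proof -
  obtain A B where F: "holomorphic_near p A" "holomorphic_near p B"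
     "\<forall>\<^sub>F z in nhds p. F z = poly2 f1 z * A z + poly2 f2 z * B z" using assms(1) by (auto simp: local_member_def)
  show ?thesis
  proof (rule local_memberI)
    show "holomorphic_near p (\<lambda>z. G z * A z)" "holomorphic_near p (\<lambda>z. G z * B z)"
      by (intro holomorphic_near_intros F assms)+
    show "\<forall>\<^sub>F z in nhds p. G z * F z = poly2 f1 z * (G z * A z) + poly2 f2 z * (G z * B z)"
      using F(3) by eventually_elim (simp add: algebra_simps)
  qed
qed

lemma local_member_cong:
  assumes "local_member p f1 f2 F" "\<forall>\<^sub>F z in nhds p. F z = G z"
  shows "local_member p f1 f2 G"
proof -
  obtain A B where F: "holomorphic_near p A" "holomorphic_near p B"
     "\<forall>\<^sub>F z in nhds p. F z = poly2 f1 z * A z + poly2 f2 z * B z" using assms(1) by (auto simp: local_member_def)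
  from assms(2) F(3) have "\<forall>\<^sub>F z in nhds p. G z = poly2 f1 z * A z + poly2 f2 z * B z"
    by eventually_elim simp
  thus ?thesis using F by (intro local_memberI)
qed

lemma local_member_ideal2: "q \<in> ideal2 f1 f2 \<Longrightarrow> local_member p f1 f2 (poly2 q)"
proof -
  assume "q \<in> ideal2 f1 f2"
  then obtain A B where "q = f1 * A + f2 * B" by (auto simp: ideal2_def)
  thus ?thesis
    by (intro local_memberI[of p "poly2 A" "poly2 B"] holomorphic_near_poly2) (simp add: poly2_add poly2_mult)
qed

lemma local_member_zero: "local_member p f1 f2 (\<lambda>z. 0)"
  using local_member_ideal2[of 0 f1 f2 p] by simp

text \<open>The germs of local members form an ideal containing both generators, hence contain the
  generated ideal; conversely a combination of the generators lies in it.\<close>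

lemma germ_in_local_ideal_iff:
  assumes "holomorphic_near p H"
  shows "germ p H \<in> local_ideal p f1 f2 \<longleftrightarrow> local_member p f1 f2 H"
proof -
  interpret R: cring "germ_ring p" by (rule cring_germ_ring)
  define S where "S = germ p ` {H. holomorphic_near p H \<and> local_member p f1 f2 H}"
  have gens: "{germ p (poly2 f1), germ p (poly2 f2)} \<subseteq> carrier (germ_ring p)"
    by (simp add: germ_in_carrier holomorphic_near_poly2)
  have "ideal S (germ_ring p)"
  proof (rule idealI[OF R.ring_axioms])
    show "subgroup S (add_monoid (germ_ring p))"
    proof (rule R.add.subgroupI)
      show "S \<subseteq> carrier (germ_ring p)" by (auto simp: S_def germ_in_carrier)
      show "S \<noteq> {}" unfolding S_def using local_member_zero holomorphic_near_const by blast
    next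
      fix x assume "x \<in> S"
      then obtain F where F: "x = germ p F" "holomorphic_near p F" "local_member p f1 f2 F" by (auto simp: S_def)
      define G where "G = (\<lambda>z. (- 1) * F z)"
      have G: "holomorphic_near p G" "local_member p f1 f2 G"
        unfolding G_def by (intro holomorphic_near_intros F local_member_mult)+
      have "\<ominus>\<^bsub>germ_ring p\<^esub> x = germ p G"
        by (rule R.minus_equality) (simp_all add: F G germ_in_carrier germ_simps, simp add: G_def)
      thus "\<ominus>\<^bsub>germ_ring p\<^esub> x \<in> S" using G unfolding S_def by blast
    next
      fix x y assume "x \<in> S" "y \<in> S"
      then obtain F G where F: "x = germ p F" "holomorphic_near p F" "local_member p f1 f2 F"
         and G: "y = germ p G" "holomorphic_near p G" "local_member p f1 f2 G" by (auto simp: S_def)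
      show "x \<oplus>\<^bsub>germ_ring p\<^esub> y \<in> S"
        unfolding F(1) G(1) germ_add S_def
        using local_member_add[OF F(3) G(3)] holomorphic_near_add[OF F(2) G(2)] by blast
    qed
  next
    fix x y assume x: "x \<in> S" and y: "y \<in> carrier (germ_ring p)"
    then obtain F where F: "x = germ p F" "holomorphic_near p F" "local_member p f1 f2 F" by (auto simp: S_def)
    obtain G where G: "holomorphic_near p G" "y = germ p G" using y by (rule germ_carrierE)
    show yx: "y \<otimes>\<^bsub>germ_ring p\<^esub> x \<in> S"
      unfolding F(1) G(2) germ_mult S_def
      using local_member_mult[OF F(3) G(1)] holomorphic_near_mult[OF G(1) F(2)] by blast
    show "x \<otimes>\<^bsub>germ_ring p\<^esub> y \<in> S"
      using yx R.m_comm[of x y] y F by (simp add: germ_in_carrier)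
  qed
  moreover have "germ p (poly2 f1) \<in> S" "germ p (poly2 f2) \<in> S"
    using local_member_ideal2[of f1 f1 f2 p] local_member_ideal2[of f2 f1 f2 p]
      ideal2I[of f1 1 f2 0] ideal2I[of f1 0 f2 1] holomorphic_near_poly2
    unfolding S_def by auto
  ultimately have sub: "local_ideal p f1 f2 \<subseteq> S"
    unfolding local_ideal_def by (intro R.genideal_minimal) auto
  interpret I: ideal "local_ideal p f1 f2" "germ_ring p"
    unfolding local_ideal_def by (rule R.genideal_ideal[OF gens])
  have genI: "germ p (poly2 f1) \<in> local_ideal p f1 f2" "germ p (poly2 f2) \<in> local_ideal p f1 f2"
    using R.genideal_self[OF gens] unfolding local_ideal_def by auto
  show ?thesis
  proof
    assume "germ p H \<in> local_ideal p f1 f2"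
    then obtain F where "germ p H = germ p F" "local_member p f1 f2 F" using sub by (auto simp: S_def)
    thus "local_member p f1 f2 H" unfolding germ_eq_iff
      by (auto intro: local_member_cong elim!: eventually_mono)
  next
    assume "local_member p f1 f2 H"
    then obtain A B where AB: "holomorphic_near p A" "holomorphic_near p B"
       "\<forall>\<^sub>F z in nhds p. H z = poly2 f1 z * A z + poly2 f2 z * B z" by (auto simp: local_member_def)
    have "germ p H = germ p (poly2 f1) \<otimes>\<^bsub>germ_ring p\<^esub> germ p A \<oplus>\<^bsub>germ_ring p\<^esub> germ p (poly2 f2) \<otimes>\<^bsub>germ_ring p\<^esub> germ p B"
      using AB(3) by (simp add: germ_simps germ_eq_iff)
    also have "\<dots> \<in> local_ideal p f1 f2"
      using genI AB by (intro I.a_closed I.I_r_closed germ_in_carrier)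
    finally show "germ p H \<in> local_ideal p f1 f2" .
  qed
qed

context axis_pair
begin

text \<open>Polynomials map onto the local algebra, because (x - a)^K and y^M vanish there and
  Taylor polynomials therefore represent all germs. The kernel is exactly the ideal with (x - a)^K
  adjoined, so its codimension is the dimension of the local algebra.\<close>

lemma intersection_multiplicity_eq:
  assumes a: "a \<in> zero_set" and K: "(\<Prod>b\<in>zero_set. lin_x b ^ K) \<in> ideal2 f1 f2"
    and d: "has_codim kpoly (ideal_plus (ideal2 f1 f2) (lin_x a ^ K)) d"
  shows "intersection_multiplicity (a, 0) f1 f2 = enat d"
proof -
  define p where "p = (a, 0 :: complex)"
  define J where "J = ideal_plus (ideal2 f1 f2) (lin_x a ^ K)"
  define I where "I = local_ideal p f1 f2"
  note ax = ideal2_0[of f1 f2] ideal2_add[of _ f1 f2] ideal2_mult[of _ f1 f2]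
  interpret R: cring "germ_ring p" by (rule cring_germ_ring)
  have "{germ p (poly2 f1), germ p (poly2 f2)} \<subseteq> carrier (germ_ring p)"
    by (simp add: germ_in_carrier holomorphic_near_poly2)
  then interpret I: ideal I "germ_ring p"
    unfolding I_def local_ideal_def by (rule R.genideal_ideal)
  obtain M where M: "varY ^ M \<in> ideal2 f1 f2" using ex_varY_power_in_ideal by blast
  have memY: "local_member p f1 f2 (\<lambda>z. snd z ^ M)"
    using local_member_ideal2[OF M, of p] by (auto elim!: local_member_cong)
  have memX: "local_member p f1 f2 (\<lambda>z. (fst z - a) ^ K)"
  proof -
    \<comment> \<open>The factors at the other zeros are units at \<open>p\<close> and can be
      divided out of the product.\<close>
    define W where "W = (\<Prod>b\<in>zero_set - {a}. lin_x b ^ K)"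
    have "poly2 W p \<noteq> 0"
      using finite_zero_set by (auto simp: W_def poly2_prod p_def)
    hence inv: "holomorphic_near p (\<lambda>z. inverse (poly2 W z))"
      by (rule holomorphic_near_inverse[OF holomorphic_near_poly2])
    have "(poly2 W \<longlongrightarrow> poly2 W p) (at p)"
      using holomorphic_near_isCont[OF holomorphic_near_poly2] by (simp add: isCont_def)
    from tendsto_imp_eventually_ne[OF this \<open>poly2 W p \<noteq> 0\<close>]
    have nz: "\<forall>\<^sub>F z in nhds p. poly2 W z \<noteq> 0"
      unfolding eventually_at_filter by (rule eventually_mono) (use \<open>poly2 W p \<noteq> 0\<close> in auto)
    have "(\<Prod>b\<in>zero_set. lin_x b ^ K) = lin_x a ^ K * W"
      unfolding W_def using a finite_zero_set by (simp add: prod.remove)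
    hence "local_member p f1 f2 (poly2 (lin_x a ^ K * W))" using local_member_ideal2[OF K, of p] by simp
    from local_member_mult[OF this inv] show ?thesis
    proof (rule local_member_cong)
      show "\<forall>\<^sub>F z in nhds p. inverse (poly2 W z) * poly2 (lin_x a ^ K * W) z = (fst z - a) ^ K"
        using nz by eventually_elim (simp add: poly2_mult)
    qed
  qed
  have memXA: "local_member p f1 f2 (\<lambda>z. (fst z - a) ^ K * A z)" "local_member p f1 f2 (\<lambda>z. snd z ^ M * A z)"
    if "holomorphic_near p A" for A
    using local_member_mult[OF memX that] local_member_mult[OF memY that] by (simp_all add: mult.commute)
  have taylor: "\<exists>P A B. holomorphic_near p A \<and> holomorphic_near p B \<and>
      (\<forall>z. F z = poly2 P z + (fst z - a) ^ K * A z + snd z ^ M * B z)"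
    if F: "holomorphic_near p F" for F
  proof -
    obtain c A B where AB: "holomorphic_near p A" "holomorphic_near p B"
      "\<And>z. F z = (\<Sum>i<K. \<Sum>j<M. c i j * (fst z - a) ^ i * (snd z - 0) ^ j)
         + (fst z - a) ^ K * A z + (snd z - 0) ^ M * B z"
      using holomorphic_near_taylor[of a 0 F M K] F unfolding p_def by blast
    have "F z = poly2 (\<Sum>i<K. \<Sum>j<M. kpoly (c i j) * lin_x a ^ i * varY ^ j) z
         + (fst z - a) ^ K * A z + snd z ^ M * B z" for z
      by (subst AB(3)) (simp add: poly2_mult del: mult_pCons_left)
    thus ?thesis using AB by blast
  qed
  have mem_iff: "local_member p f1 f2 (poly2 q) \<longleftrightarrow> q \<in> J" for q
  proof
    assume "q \<in> J"
    then obtain u C where "u \<in> ideal2 f1 f2" "q = u + lin_x a ^ K * C" by (auto simp: J_def ideal_plus_def)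
    hence "local_member p f1 f2 (\<lambda>z. poly2 u z + (fst z - a) ^ K * poly2 C z)"
      by (intro local_member_add local_member_ideal2 memXA holomorphic_near_poly2)
    moreover have "poly2 q = (\<lambda>z. poly2 u z + (fst z - a) ^ K * poly2 C z)"
      using \<open>q = _\<close> by (auto simp: poly2_add poly2_mult)
    ultimately show "local_member p f1 f2 (poly2 q)" by simp
  next
    assume "local_member p f1 f2 (poly2 q)"
    then obtain A B where AB: "holomorphic_near p A" "holomorphic_near p B"
      "\<forall>\<^sub>F z in nhds p. poly2 q z = poly2 f1 z * A z + poly2 f2 z * B z" by (auto simp: local_member_def)
    obtain P1 A1 B1 where 1: "holomorphic_near p A1" "holomorphic_near p B1"
      "\<And>z. A z = poly2 P1 z + (fst z - a) ^ K * A1 z + snd z ^ M * B1 z" using taylor[OF AB(1)] by blast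
    obtain P2 A2 B2 where 2: "holomorphic_near p A2" "holomorphic_near p B2"
      "\<And>z. B z = poly2 P2 z + (fst z - a) ^ K * A2 z + snd z ^ M * B2 z" using taylor[OF AB(2)] by blast
    \<comment> \<open>Replacing the multipliers by their Taylor polynomials leaves a polynomial q -
      u that is locally a combination of (x - a)^K and y^M. Its low Taylor coefficients vanish, so
      it is such a combination with polynomial multipliers.\<close>
    define u where "u = f1 * P1 + f2 * P2"
    obtain c r s where c: "q - u = (\<Sum>i<K. \<Sum>j<M. kpoly (c i j) * lin_x a ^ i * varY ^ j)
        + lin_x a ^ K * r + varY ^ M * s" using poly_taylor by blast
    define A' where "A' = (\<lambda>z. poly2 f1 z * A1 z + poly2 f2 z * A2 z - poly2 r z)"
    define B' where "B' = (\<lambda>z. poly2 f1 z * B1 z + poly2 f2 z * B2 z - poly2 s z)"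
    have "c i j = 0" if "i < K" "j < M" for i j
    proof (rule taylor_coeffs_unique[where a = a and b = 0 and K = K and M = M and A = A' and B = B'])
      show "holomorphic_near (a, 0) A'" "holomorphic_near (a, 0) B'"
        unfolding A'_def B'_def p_def[symmetric] by (intro holomorphic_near_intros holomorphic_near_poly2 1 2)+
      show "\<forall>\<^sub>F z in nhds (a, 0). (\<Sum>i<K. \<Sum>j<M. c i j * (fst z - a) ^ i * (snd z - 0) ^ j)
          = (fst z - a) ^ K * A' z + (snd z - 0) ^ M * B' z"
        using AB(3) unfolding p_def[symmetric]
      proof eventually_elim
        case (elim z)
        have "poly2 (q - u) z = (\<Sum>i<K. \<Sum>j<M. c i j * (fst z - a) ^ i * (snd z - 0) ^ j)
            + (fst z - a) ^ K * poly2 r z + snd z ^ M * poly2 s z"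
          unfolding c by (simp add: poly2_add poly2_mult del: mult_pCons_left)
        moreover have "poly2 (q - u) z = (fst z - a) ^ K * (poly2 f1 z * A1 z + poly2 f2 z * A2 z)
            + snd z ^ M * (poly2 f1 z * B1 z + poly2 f2 z * B2 z)"
          unfolding u_def poly2_diff poly2_add poly2_mult elim 1(3) 2(3) by (simp add: algebra_simps)
        ultimately show ?case by (simp add: A'_def B'_def algebra_simps)
      qed
    qed (use that in auto)
    hence "q - u = lin_x a ^ K * r + varY ^ M * s" unfolding c by simp
    hence "q = (u + s * varY ^ M) + lin_x a ^ K * r" by (simp add: algebra_simps)
    moreover have "u + s * varY ^ M \<in> ideal2 f1 f2" unfolding u_def by (intro ax(2,3) ideal2I M)
    ultimately show "q \<in> J" unfolding J_def by (simp only: ideal_plusI)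
  qed
  define A where "A = local_algebra p f1 f2"
  have A: "A = germ_ring p Quot I" by (simp add: A_def local_algebra_def I_def)
  define \<psi> where "\<psi> = (\<lambda>q. I +>\<^bsub>germ_ring p\<^esub> germ p (poly2 q))"
  have hol: "germ p (poly2 q) \<in> carrier (germ_ring p)" for q
    by (simp add: germ_in_carrier holomorphic_near_poly2)
  have hom: "\<psi> (x + y) = \<psi> x \<oplus>\<^bsub>A\<^esub> \<psi> y" "\<psi> (x * y) = \<psi> x \<otimes>\<^bsub>A\<^esub> \<psi> y" "\<psi> 1 = \<one>\<^bsub>A\<^esub>" for x y
    using ring_hom_add[OF I.rcos_ring_hom hol hol, of x y] ring_hom_mult[OF I.rcos_ring_hom hol hol, of x y]
      ring_hom_one[OF I.rcos_ring_hom]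
    by (simp_all add: \<psi>_def A germ_simps poly2_add[abs_def] poly2_mult[abs_def])
  have zero: "\<zero>\<^bsub>A\<^esub> = I" by (simp add: A FactRing_def)
  have cos_iff: "I +>\<^bsub>germ_ring p\<^esub> germ p F = I \<longleftrightarrow> local_member p f1 f2 F" if "holomorphic_near p F" for F
    using I.rcos_const_imp_mem[OF germ_in_carrier[OF that]] I.a_rcos_const[of "germ p F"]
      germ_in_local_ideal_iff[OF that] unfolding I_def by blast
  have ker: "\<psi> q = \<zero>\<^bsub>A\<^esub> \<longleftrightarrow> q \<in> J" for q
    unfolding \<psi>_def zero cos_iff[OF holomorphic_near_poly2] by (rule mem_iff)
  have surj: "carrier A = range \<psi>"
  proof (intro equalityI subsetI)
    fix x assume "x \<in> carrier A"
    then obtain y where y: "y \<in> carrier (germ_ring p)" "x = I +>\<^bsub>germ_ring p\<^esub> y"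
      by (auto simp: A FactRing_def A_RCOSETS_def')
    obtain F where F: "holomorphic_near p F" "y = germ p F" using y(1) by (rule germ_carrierE)
    obtain P A1 B1 where T: "holomorphic_near p A1" "holomorphic_near p B1"
      "\<And>z. F z = poly2 P z + (fst z - a) ^ K * A1 z + snd z ^ M * B1 z" using taylor[OF F(1)] by blast
    define E where "E = (\<lambda>z. (fst z - a) ^ K * A1 z + snd z ^ M * B1 z)"
    have E: "holomorphic_near p E" unfolding E_def by (intro holomorphic_near_intros T)
    have "local_member p f1 f2 E" unfolding E_def by (intro local_member_add memXA T)
    hence E0: "I +>\<^bsub>germ_ring p\<^esub> germ p E = \<zero>\<^bsub>A\<^esub>" using cos_iff[OF E] zero by simp
    have "y = germ p (poly2 P) \<oplus>\<^bsub>germ_ring p\<^esub> germ p E"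
      unfolding F(2) germ_add germ_eq_iff by (simp add: T(3) E_def add.assoc)
    hence "x = \<psi> P \<oplus>\<^bsub>A\<^esub> (I +>\<^bsub>germ_ring p\<^esub> germ p E)"
      unfolding y(2) \<psi>_def A using ring_hom_add[OF I.rcos_ring_hom hol germ_in_carrier[OF E]] by simp
    also have "\<dots> = \<psi> P \<oplus>\<^bsub>A\<^esub> \<psi> 0" using E0 ker[of 0] ideal_plus_incl[OF ax ax(1)] by (simp add: J_def)
    also have "\<dots> = \<psi> P" by (simp add: hom(1)[symmetric])
    finally show "x \<in> range \<psi>" by blast
  next
    fix x assume "x \<in> range \<psi>"
    thus "x \<in> carrier A" using hol by (auto simp: A FactRing_def A_RCOSETS_def' \<psi>_def)
  qed
  have J1: "1 \<notin> J"
  proof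
    assume "1 \<in> J"
    hence "local_member p f1 f2 (poly2 1)" by (simp only: mem_iff)
    then obtain C D where "\<forall>\<^sub>F z in nhds p. poly2 1 z = poly2 f1 z * C z + poly2 f2 z * D z"
      by (auto simp: local_member_def)
    \<comment> \<open>Evaluation at \<open>p\<close>, where both polynomials vanish, gives 1 =
      0.\<close>
    from eventually_nhds_x_imp_x[OF this] show False
      using a by (simp add: zero_set_def p_def)
  qed
  have scalars: "local_scalars p f1 f2 = range (\<lambda>c. \<psi> (kpoly c))"
    by (simp add: local_scalars_def \<psi>_def I_def)
  have ringA: "ring A" unfolding A by (rule I.quotient_is_ring)
  have J0: "0 \<in> J" unfolding J_def by (rule ideal_plus_incl[OF ax ax(1)])
  have dim: "subfield (local_scalars p f1 f2) A" "ring.dimension A d (local_scalars p f1 f2) (carrier A)"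
    using dimension_of_quotient[OF ringA kpoly.scalar_embedding_axioms hom surj ker J0 J1 d[folded J_def]]
    unfolding scalars by blast+
  interpret A: ring A by (rule ringA)
  have "A.dim (local_scalars p f1 f2) (carrier A) = d"
    using A.dimI[OF dim] by (simp add: over_def)
  moreover have "A.finite_dimension (local_scalars p f1 f2) (carrier A)"
    by (rule A.finite_dimensionI[OF dim(2)])
  ultimately show ?thesis
    unfolding intersection_multiplicity_def Let_def p_def[symmetric] A_def[symmetric] by simp
qed

theorem total_intersection_number_eq:
  assumes d: "has_codim kpoly (ideal2 f1 f2) d"
  shows "total_intersection_number f1 f2 = enat d"
proof -
  obtain K where K: "(\<Prod>a\<in>zero_set. lin_x a ^ K) \<in> ideal2 f1 f2" using ex_prod_lin_x_in_ideal by blast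
  obtain D where D: "\<And>a. a \<in> zero_set \<Longrightarrow> has_codim kpoly (ideal_plus (ideal2 f1 f2) (lin_x a ^ K)) (D a)"
      "d = (\<Sum>a\<in>zero_set. D a)"
    using codim_eq_sum[OF d K] by blast
  have fin: "finite (common_zeros f1 f2)" using finite_zero_set by (simp add: common_zeros_eq)
  have enat_sum: "(\<Sum>a\<in>S. enat (D a)) = enat (\<Sum>a\<in>S. D a)" for S :: "complex set"
    by (induction S rule: infinite_finite_induct) (simp_all add: zero_enat_def)
  have "(\<Sum>p\<in>common_zeros f1 f2. intersection_multiplicity p f1 f2)
      = (\<Sum>a\<in>zero_set. intersection_multiplicity (a, 0) f1 f2)"
    unfolding common_zeros_eq by (subst sum.reindex) (auto simp: inj_on_def)
  also have "\<dots> = (\<Sum>a\<in>zero_set. enat (D a))"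
    by (intro sum.cong refl) (simp add: intersection_multiplicity_eq[OF _ K D(1)])
  finally show ?thesis using fin by (simp add: total_intersection_number_def enat_sum D(2))
qed

end

text \<open>The coefficient of x^n is a polynomial in y with constant term 1; its terms of positive
  degree, like all higher powers of x, would have total degree above n.\<close>

lemma monic_of_homogeneous_part:
  assumes "total_degree f = n" "homogeneous_part n f = varX ^ n"
  shows "lead_coeff f = 1 \<and> degree f = n"
proof -
  have "varX ^ n = monom 1 n" by (simp add: varX_def monom_altdef)
  hence "coeff (homogeneous_part n f) n = 1" using assms(2) by simp
  moreover have "coeff (homogeneous_part n f) n = monom (coeff2 f n 0) 0"
    by (simp add: homogeneous_part_def coeff_sum)
  ultimately have "coeff (monom (coeff2 f n 0) 0) 0 = coeff 1 0" by simp
  hence "coeff2 f n 0 = 1" by simp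
  moreover have td: "coeff2 f i j = 0" if "i + j > n" for i j
    using total_degree_leD[of f n i j] assms(1) that by simp
  ultimately have c: "coeff f n = 1"
    by (intro poly_eqI) (auto simp: coeff2_def coeff_1)
  have "coeff f i = 0" if "i > n" for i
    by (rule poly_eqI) (use td that in \<open>simp add: coeff2_def\<close>)
  hence "degree f = n" by (intro antisym degree_le le_degree) (auto simp: c)
  thus ?thesis using c by simp
qed

theorem theorem1p1:
  fixes f1 f2 :: "complex poly poly" and n :: nat
  assumes "discrete (common_zeros f1 f2)"
    and "n > 0"
    and "total_degree f1 = n" and "total_degree f2 = n"
    and "homogeneous_part n f1 = varX ^ n" and "homogeneous_part n f2 = varX ^ n"
    and "\<forall>(a, b) \<in> common_zeros f1 f2. b = 0"
  shows "(\<exists>!(g1, g2). total_degree g1 \<le> n - 1 \<and> total_degree g2 \<le> n - 1 \<and>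
            varY * jacobian_det f1 f2 = f1 * g1 + f2 * g2) \<and>
         (\<forall>g1 g2. total_degree g1 \<le> n - 1 \<and> total_degree g2 \<le> n - 1 \<and>
            varY * jacobian_det f1 f2 = f1 * g1 + f2 * g2 \<longrightarrow>
            (\<exists>N. total_intersection_number f1 f2 = enat N \<and>
                 of_nat N = coeff2 g2 (n - 1) 0))"
proof -
  note monic = monic_of_homogeneous_part[OF assms(3,5)] monic_of_homogeneous_part[OF assms(4,6)]
  interpret axis_pair f1 f2 n
  proof
    show "n > 0" by fact
    show "lead_coeff f1 = 1" "lead_coeff f2 = 1" "degree f1 = n" "degree f2 = n"
      by (rule conjunct1[OF monic(1)] conjunct1[OF monic(2)] conjunct2[OF monic(1)] conjunct2[OF monic(2)])+
    fix a b assume "poly2 f1 (a, b) = 0" "poly2 f2 (a, b) = 0"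
    hence "(a, b) \<in> common_zeros f1 f2" by (simp add: common_zeros_def)
    from bspec[OF assms(7) this] show "b = 0" by simp
  qed
  obtain h1 h2 d where h: "total_degree h1 \<le> n - 1" "total_degree h2 \<le> n - 1"
     "varY * jacobian_det f1 f2 = f1 * h1 + f2 * h2" and d: "has_codim kpoly (ideal2 f1 f2) d"
     "coeff2 h2 (n - 1) 0 = of_nat d"
    using ex_solution_total_degree[OF eq_refl[OF assms(3)] eq_refl[OF assms(4)]] by blast
  \<comment> \<open>Total degree at most n - 1 puts the degree in x below n, the bound under which
    solutions are unique.\<close>
  have deg: "coeff g i = 0" if "total_degree g \<le> n - 1" "i \<ge> n" for g i
    by (rule poly_eqI) (use total_degree_leD[OF that(1), of i] that(2) n_pos in \<open>simp add: coeff2_def\<close>)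
  have uniq: "g1 = h1 \<and> g2 = h2"
    if "total_degree g1 \<le> n - 1" "total_degree g2 \<le> n - 1" "varY * jacobian_det f1 f2 = f1 * g1 + f2 * g2" for g1 g2
  proof (rule solution_unique)
    show "f1 * g1 + f2 * g2 = f1 * h1 + f2 * h2" using that(3) h(3) by simp
  qed (rule deg[OF that(2)] deg[OF h(2)], assumption)+
  show ?thesis
  proof (intro conjI allI impI)
    show "\<exists>!(g1, g2). total_degree g1 \<le> n - 1 \<and> total_degree g2 \<le> n - 1 \<and>
            varY * jacobian_det f1 f2 = f1 * g1 + f2 * g2"
    proof (rule ex1I[of _ "(h1, h2)"])
      show "case (h1, h2) of (g1, g2) \<Rightarrow> total_degree g1 \<le> n - 1 \<and> total_degree g2 \<le> n - 1 \<and>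
            varY * jacobian_det f1 f2 = f1 * g1 + f2 * g2"
        using h by simp
      fix g assume "case g of (g1, g2) \<Rightarrow> total_degree g1 \<le> n - 1 \<and> total_degree g2 \<le> n - 1 \<and>
            varY * jacobian_det f1 f2 = f1 * g1 + f2 * g2"
      hence "fst g = h1 \<and> snd g = h2" unfolding case_prod_unfold by (intro uniq) blast+
      thus "g = (h1, h2)" by (simp add: prod_eq_iff)
    qed
  next
    fix g1 g2 assume "total_degree g1 \<le> n - 1 \<and> total_degree g2 \<le> n - 1 \<and>
            varY * jacobian_det f1 f2 = f1 * g1 + f2 * g2"
    hence "g2 = h2" using uniq by blast
    thus "\<exists>N. total_intersection_number f1 f2 = enat N \<and> of_nat N = coeff2 g2 (n - 1) 0"
      using d total_intersection_number_eq by auto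
  qed
qed

end
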